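(* Let $f\colon(\mathbb{C}^2,\mathbf{0})\to(\mathbb{C},0)$ be an irreducible analytic germ with zero locus $X$, multiplicity $m$ at $\mathbf{0}$ and Puiseux pairs $(\beta_1,e_1),\dots,(\beta_s,e_s)$; set $e_0=m$, $\beta_0=0$, $\beta_{s+1}=+\infty$. Let $\Gamma$ be a real analytic half-branch at $\mathbf{0}\in\mathbb{C}^2$ with contact $c=c(\Gamma,X)<+\infty$, and let $k\in\{0,\dots,s\}$ be the unique integer with $\beta_k\le m\cdot c<\beta_{k+1}$. Then the order of $f$ along $\Gamma$ is $$\nu_f(\Gamma)=e_k\, c+(e_0-e_1)\frac{\beta_1}{m}+\dots+(e_{k-1}-e_k)\frac{\beta_k}{m}=e_k\Big(c-\frac{\beta_k}{m}\Big)+\sum_{i=0}^{k-1}e_i\Big(\frac{\beta_{i+1}}{m}-\frac{\beta_i}{m}\Big)$$ (empty sums being $0$ when $k=0$).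
   Context: Puiseux pairs: in suitable local holomorphic coordinates $(x,y)$ the zero locus $X$ is parameterized by $x\mapsto(x^m,\Psi(x))$, $\Psi(x)=\sum_{j>m}a_jx^j$; set $e_0=m$, $\beta_{i+1}=\min\{j:a_j\ne0,\ e_i\nmid j\}$, $e_{i+1}=\gcd(e_i,\beta_{i+1})$, until $e_s=1$. A map germ $\phi\colon(\mathbb{R}_{\ge0},0)\to\mathbb{C}^N$ is ramified analytic if $\phi(t)=\tilde\phi(t^{p/q})$ for some convergent power series $\tilde\phi$ and coprime positive integers $p,q$; a ramified analytic unit if moreover $\tilde\phi(0)\neq0$. A real analytic half-branch at $\mathbf{0}$ is the germ of the image of $[0,\varepsilon)$ under a nonconstant real analytic map $\gamma$ with $\gamma(0)=\mathbf{0}$. An analytic arc is a nonconstant germ $\alpha\colon[0,\varepsilon)\to\mathbb{C}^2$ with $\alpha(0)=\mathbf{0}$, such that $t\mapsto\alpha(t^e)$ is real analytic for some positive integer $e$, and $at\le|\alpha(t)|\le bt$ for small $t$ with constants $0<a<b$. Every half-branch $\Gamma$ is parameterized by analytic arcs. Order: for an analytic arc $\alpha$, $f(\alpha(t))=t^{\nu}V(t)$ with $V$ a ramified analytic unit and $\nu\in\mathbb{Q}_{>0}\cup\{+\infty\}$; $\nu_f(\Gamma):=\nu$ for any analytic arc $\alpha$ parameterizing $\Gamma$ (independent of the choice). Contact: with $X(r)=\{p\in X:|p|=r\}$, $c(\alpha,X)=\lim_{t\to0^+}\log(\mathrm{dist}(\alpha(t),X(|\alpha(t)|)))/\log t$,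 and $c(\Gamma,X):=c(\alpha,X)$ for any analytic arc $\alpha$ parameterizing $\Gamma$ (independent of the choice). *)

theory Defs
  imports "HOL-Analysis.Analysis"
begin

definition germ_eq :: "(complex \<times> complex) set \<Rightarrow> (complex \<times> complex) set \<Rightarrow> bool" where
  "germ_eq A B \<longleftrightarrow> (\<exists>U. open U \<and> (0::complex \<times> complex) \<in> U \<and> A \<inter> U = B \<inter> U)"

definition analytic2_germ :: "(complex \<times> complex \<Rightarrow> complex) \<Rightarrow> bool" where
  "analytic2_germ f \<longleftrightarrow> (\<exists>r>0. \<exists>C :: nat \<Rightarrow> nat \<Rightarrow> complex.
     \<forall>x y. cmod x < r \<and> cmod y < r \<longrightarrow>
        ((\<lambda>(i,j). C i j * x ^ i * y ^ j) has_sum f (x, y)) UNIV)"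

definition germ_mult :: "(complex \<times> complex \<Rightarrow> complex) \<Rightarrow> nat \<Rightarrow> bool" where
  "germ_mult f m \<longleftrightarrow> (\<exists>r>0. \<exists>C :: nat \<Rightarrow> nat \<Rightarrow> complex.
     (\<forall>x y. cmod x < r \<and> cmod y < r \<longrightarrow>
        ((\<lambda>(i,j). C i j * x ^ i * y ^ j) has_sum f (x, y)) UNIV) \<and>
     (\<forall>i j. i + j < m \<longrightarrow> C i j = 0) \<and> (\<exists>i j. i + j = m \<and> C i j \<noteq> 0))"

definition irreducible_germ :: "(complex \<times> complex \<Rightarrow> complex) \<Rightarrow> bool" where
  "irreducible_germ f \<longleftrightarrow> analytic2_germ f \<and> f 0 = 0 \<and>
     (\<forall>g h. analytic2_germ g \<and> analytic2_germ h \<and> (\<forall>\<^sub>F p in nhds 0. f p = g p * h p)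
        \<longrightarrow> g 0 \<noteq> 0 \<or> h 0 \<noteq> 0)"

definition biholo_germ :: "(complex \<times> complex \<Rightarrow> complex \<times> complex) \<Rightarrow> bool" where
  "biholo_germ \<Phi> \<longleftrightarrow> analytic2_germ (fst \<circ> \<Phi>) \<and> analytic2_germ (snd \<circ> \<Phi>) \<and> \<Phi> 0 = 0 \<and>
     (\<exists>\<Theta>. analytic2_germ (fst \<circ> \<Theta>) \<and> analytic2_germ (snd \<circ> \<Theta>) \<and> \<Theta> 0 = 0 \<and>
        (\<forall>\<^sub>F p in nhds 0. \<Theta> (\<Phi> p) = p) \<and> (\<forall>\<^sub>F p in nhds 0. \<Phi> (\<Theta> p) = p))"

definition puiseux_param ::
  "(complex \<times> complex \<Rightarrow> complex) \<Rightarrow> (complex \<times> complex \<Rightarrow> complex \<times> complex) \<Rightarrow> nat \<Rightarrow> (nat \<Rightarrow> complex) \<Rightarrow> bool" where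
  "puiseux_param f \<Phi> m a \<longleftrightarrow> biholo_germ \<Phi> \<and> m > 0 \<and> (\<forall>j\<le>m. a j = 0) \<and>
     (\<exists>\<rho>>0. (\<forall>t. cmod t < \<rho> \<longrightarrow> summable (\<lambda>j. a j * t ^ j)) \<and>
        germ_eq {p. f p = 0} ((\<lambda>t. \<Phi> (t ^ m, \<Sum>j. a j * t ^ j)) ` ball 0 \<rho>))"

definition puiseux_char :: "nat \<Rightarrow> (nat \<Rightarrow> complex) \<Rightarrow> nat \<Rightarrow> (nat \<Rightarrow> nat) \<Rightarrow> (nat \<Rightarrow> nat) \<Rightarrow> bool" where
  "puiseux_char m a s \<beta> e \<longleftrightarrow> e 0 = m \<and> \<beta> 0 = 0 \<and> e s = 1 \<and> (\<forall>i<s. e i \<noteq> 1) \<and>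
     (\<forall>i<s. (\<exists>j. a j \<noteq> 0 \<and> \<not> e i dvd j) \<and>
            \<beta> (Suc i) = (LEAST j. a j \<noteq> 0 \<and> \<not> e i dvd j) \<and>
            e (Suc i) = gcd (e i) (\<beta> (Suc i)))"

definition real_analytic_right :: "(real \<Rightarrow> complex \<times> complex) \<Rightarrow> real \<Rightarrow> bool" where
  "real_analytic_right g \<epsilon> \<longleftrightarrow> (\<exists>C :: nat \<Rightarrow> complex \<times> complex.
     \<forall>t. 0 \<le> t \<and> t < \<epsilon> \<longrightarrow> (\<lambda>n. t ^ n *\<^sub>R C n) sums g t)"

(* \<gamma> : [0,\<epsilon>) \<rightarrow> C^2 nonconstant real analytic with \<gamma>(0) = 0; the half-branch is the germ of \<gamma>([0,\<epsilon>)) *)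
definition half_branch_map :: "(real \<Rightarrow> complex \<times> complex) \<Rightarrow> real \<Rightarrow> bool" where
  "half_branch_map \<gamma> \<epsilon> \<longleftrightarrow> \<epsilon> > 0 \<and> \<gamma> 0 = 0 \<and> real_analytic_right \<gamma> \<epsilon> \<and>
     (\<exists>t. 0 \<le> t \<and> t < \<epsilon> \<and> \<gamma> t \<noteq> \<gamma> 0)"

definition analytic_arc :: "(real \<Rightarrow> complex \<times> complex) \<Rightarrow> bool" where
  "analytic_arc \<alpha> \<longleftrightarrow> \<alpha> 0 = 0 \<and>
     (\<exists>e::nat. e > 0 \<and> (\<exists>\<epsilon>>0. real_analytic_right (\<lambda>t. \<alpha> (t ^ e)) \<epsilon>)) \<and>
     (\<exists>a b. 0 < a \<and> a < b \<and> (\<forall>\<^sub>F t in at_right 0. a * t \<le> norm (\<alpha> t) \<and> norm (\<alpha> t) \<le> b * t))"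

definition arc_parameterizes :: "(real \<Rightarrow> complex \<times> complex) \<Rightarrow> (complex \<times> complex) set \<Rightarrow> bool" where
  "arc_parameterizes \<alpha> \<Gamma> \<longleftrightarrow> analytic_arc \<alpha> \<and> (\<exists>\<delta>>0. germ_eq (\<alpha> ` {0..<\<delta>}) \<Gamma>)"

definition sphere_part :: "(complex \<times> complex) set \<Rightarrow> real \<Rightarrow> (complex \<times> complex) set" where
  "sphere_part X r = {p \<in> X. norm p = r}"

(* c(\<alpha>,X) = c, a finite real number: lim_{t\<rightarrow>0+} log dist(\<alpha>(t), X(|\<alpha>(t)|)) / log t = c.
   Finiteness of the limit forces the distance to be eventually positive (log 0 = -\<infinity>). *)
definition has_contact :: "(real \<Rightarrow> complex \<times> complex) \<Rightarrow> (complex \<times> complex) set \<Rightarrow> real \<Rightarrow> bool" where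
  "has_contact \<alpha> X c \<longleftrightarrow>
     (\<forall>\<^sub>F t in at_right 0. infdist (\<alpha> t) (sphere_part X (norm (\<alpha> t))) > 0) \<and>
     ((\<lambda>t. ln (infdist (\<alpha> t) (sphere_part X (norm (\<alpha> t)))) / ln t) \<longlongrightarrow> c) (at_right 0)"

definition ram_analytic_unit :: "(real \<Rightarrow> complex) \<Rightarrow> bool" where
  "ram_analytic_unit V \<longleftrightarrow> (\<exists>p q :: nat. p > 0 \<and> q > 0 \<and> coprime p q \<and>
     (\<exists>C :: nat \<Rightarrow> complex. C 0 \<noteq> 0 \<and>
        (\<forall>\<^sub>F t in at_right 0. (\<lambda>n. C n * complex_of_real (t powr (real p / real q)) ^ n) sums V t)))"

definition has_order :: "(complex \<times> complex \<Rightarrow> complex) \<Rightarrow> (real \<Rightarrow> complex \<times> complex) \<Rightarrow> real \<Rightarrow> bool" where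
  "has_order f \<alpha> \<nu> \<longleftrightarrow> (\<exists>V. ram_analytic_unit V \<and>
     (\<forall>\<^sub>F t in at_right 0. f (\<alpha> t) = complex_of_real (t powr \<nu>) * V t))"

end

theory Submission
  imports Defs "HOL-Complex_Analysis.Complex_Analysis"
    "HOL-Computational_Algebra.Fundamental_Theorem_Algebra"
begin

text \<open>
  In the chart, \<open>f(\<Phi>(\<tau>^m, y)) = H(\<tau>, y) \<Prod> (y - \<psi>(\<omega> \<tau>))\<close>, the product ranging over the \<open>m\<close>-th roots of
  unity \<open>\<omega>\<close>. The quotient \<open>H\<close> is continuous, by a Cauchy integral, and \<open>H(0, 0) \<noteq> 0\<close> because both
  \<open>f\<close> and the product have multiplicity exactly \<open>m\<close>. So \<open>|f|\<close> is comparable to the product of the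
  vertical distances to the \<open>m\<close> conjugate branches, while the distance to the section of \<open>X\<close> by the
  sphere is comparable to the smallest of them, \<open>\<delta>\<close>. The distance to the branch that
  differs by \<open>\<omega>\<close> from the nearest one is comparable to \<open>max \<delta> |\<tau>|^\<beta>\<close>, where \<open>\<beta> = \<beta>\<^sub>i\<^sub>+\<^sub>1\<close> for the
  \<open>e\<^sub>i - e\<^sub>i\<^sub>+\<^sub>1\<close> roots with \<open>\<omega>^e\<^sub>i = 1 \<noteq> \<omega>^e\<^sub>i\<^sub>+\<^sub>1\<close>. Adding up the exponents gives the formula for
  \<open>log |f(\<alpha> t)| / log t\<close>, and since \<open>f(\<alpha>(s^n))\<close> is a power series in \<open>s\<close>, this limit is the order.
\<close>

subsection \<open>Holomorphic germs in two variables\<close>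

text \<open>Contact is only a limit of quotients of logarithms, so \<delta> comes without a leading
  coefficient. None is needed: all estimates are two-sided bounds up to constants, which such a
  quotient does not see, and an exact leading term enters only for f along the arc. The substitution
  x = \<tau>^m makes the conjugate branches single-valued. The price is that they all meet at \<tau>
  = 0, where there are no simple zeros to divide by; hence an integral over a circle that avoids
  them. The branch point above the same x usually misses the sphere through the point of the arc. It
  is corrected by moving along a ray of the parameter, where the norm grows at a controlled rate.
  Turning |\<tau>|^\<beta> into t^(\<beta>/m) needs |\<tau>|^m comparable to t. This can fail for c
  = 1, when the arc may be tangent to the line x = 0. But all exponents of \<psi> exceed m, so c = 1
  forces k = 0, and each vertical distance is squeezed between \<delta> and a multiple of t.\<close>

lemma bounded_holomorphic_lipschitz:
  fixes g :: "complex \<Rightarrow> complex"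
  assumes hol: "g holomorphic_on ball 0 R" and bd: "\<And>z. z \<in> ball 0 R \<Longrightarrow> cmod (g z) \<le> M"
    and x: "cmod x < R / 2" and y: "cmod y < R / 2"
  shows "cmod (g x - g y) \<le> 4 * M / R * cmod (x - y)"
proof (rule field_differentiable_bound[where S = "ball 0 (R/2)" and f' = "deriv g"])
  have R: "R > 0"
    using x norm_ge_zero[of x] by linarith
  fix z :: complex assume z: "z \<in> ball 0 (R/2)"
  have sub: "cball z (R/4) \<subseteq> ball 0 R"
  proof
    fix w assume "w \<in> cball z (R/4)"
    then have "cmod (w - z) \<le> R/4"
      by (simp add: dist_norm norm_minus_commute)
    with z norm_triangle_sub[of w z] R show "w \<in> ball 0 R" by simp
  qed
  have "z \<in> ball 0 R" using z R by auto
  then have "(g has_field_derivative deriv g z) (at z)"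
    using hol holomorphic_derivI by blast
  then show "(g has_field_derivative deriv g z) (at z within ball 0 (R/2))"
    by (rule has_field_derivative_at_within)
  \<comment> \<open>Discs of radius R/4 around points of the half disc stay inside the large disc;
    Cauchy's estimate on them is the origin of the constant 4 M / R.\<close>
  have "norm ((deriv ^^ 1) g z) \<le> fact 1 * M / (R/4) ^ 1"
  proof (rule Cauchy_inequality)
    show "g holomorphic_on ball z (R/4)"
      using hol sub ball_subset_cball holomorphic_on_subset by (metis order_trans)
    show "continuous_on (cball z (R/4)) g"
      using hol sub holomorphic_on_imp_continuous_on holomorphic_on_subset by blast
    show "norm (g w) \<le> M" if "norm (z - w) = R/4" for w
      using that sub by (intro bd) (auto simp: dist_norm subset_iff)
  qed (use R in auto)
  then show "norm (deriv g z) \<le> 4 * M / R"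
    by (simp add: field_simps)
qed (use x y in auto)

text \<open>Unordered summability of a complex family is absolute, so convergence at the single
  point (r, r) yields a majorant for the whole closed polydisc of radius r.\<close>

lemma power_series2_bound:
  fixes C :: "nat \<Rightarrow> nat \<Rightarrow> complex"
  assumes sum: "((\<lambda>(i,j). C i j * of_real r ^ i * of_real r ^ j) has_sum S) UNIV" and r: "r > 0"
  shows "(\<lambda>(i,j). cmod (C i j) * r ^ i * r ^ j) summable_on UNIV"
proof -
  have "(\<lambda>ij. norm ((\<lambda>(i,j). C i j * of_real r ^ i * of_real r ^ j) ij)) summable_on UNIV"
    using has_sum_imp_summable[OF sum] summable_on_iff_abs_summable_on_complex by blast
  moreover have "(\<lambda>ij. norm ((\<lambda>(i,j). C i j * of_real r ^ i * of_real r ^ j) ij))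
     = (\<lambda>(i,j). cmod (C i j) * r ^ i * r ^ j)"
    using r by (auto simp: fun_eq_iff norm_mult norm_power)
  ultimately show ?thesis by simp
qed

text \<open>The absolute series at (r, r) is the majorant of a Weierstrass test, and uniform limits
  of polynomials in \<open>\<phi>\<close> and \<open>\<psi>\<close> are holomorphic. Holomorphy in
  two variables is needed only along such one-variable curves: slices, their images under the chart,
  the branch, and a complexified arc.\<close>

lemma power_series2_compose_holomorphic:
  fixes C :: "nat \<Rightarrow> nat \<Rightarrow> complex"
  assumes sum: "\<And>x y. cmod x \<le> r \<Longrightarrow> cmod y \<le> r \<Longrightarrow> ((\<lambda>(i,j). C i j * x ^ i * y ^ j) has_sum f (x, y)) UNIV"
    and r: "r > 0" and S: "open S"
    and hol: "\<phi> holomorphic_on S" "\<psi> holomorphic_on S"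
    and bd: "\<And>z. z \<in> S \<Longrightarrow> cmod (\<phi> z) < r \<and> cmod (\<psi> z) < r"
  shows "(\<lambda>z. f (\<phi> z, \<psi> z)) holomorphic_on S"
proof -
  let ?T = "\<lambda>(i,j) z. C i j * \<phi> z ^ i * \<psi> z ^ j"
  have M: "(\<lambda>(i,j). cmod (C i j) * r ^ i * r ^ j) summable_on UNIV"
    using r by (intro power_series2_bound[OF sum]) auto
  have "(\<lambda>z. f (\<phi> z, \<psi> z)) field_differentiable at z" if z: "z \<in> S" for z
  proof -
    obtain d where d: "d > 0" "cball z d \<subseteq> S"
      using S z open_contains_cball by blast
    have lim: "uniform_limit (cball z d) (\<lambda>X y. \<Sum>ij\<in>X. ?T ij y) (\<lambda>z. f (\<phi> z, \<psi> z)) (finite_subsets_at_top UNIV)"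
    proof (rule Weierstrass_m_test_general'[OF _ _ M])
      fix ij :: "nat \<times> nat" and y assume y: "y \<in> cball z d"
      then have "cmod (\<phi> y) < r" "cmod (\<psi> y) < r" using bd d by auto
      then show "norm (?T ij y) \<le> (case ij of (i,j) \<Rightarrow> cmod (C i j) * r ^ i * r ^ j)"
        using r by (cases ij) (auto simp: norm_mult norm_power intro!: mult_mono power_mono mult_nonneg_nonneg)
    next
      fix y assume "y \<in> cball z d"
      then have "cmod (\<phi> y) < r" "cmod (\<psi> y) < r" using bd d by auto
      then show "((\<lambda>ij. ?T ij y) has_sum f (\<phi> y, \<psi> y)) UNIV"
        using sum[of "\<phi> y" "\<psi> y"] by (simp add: case_prod_unfold)
    qed
    have hX: "(\<lambda>y. \<Sum>ij\<in>X. ?T ij y) holomorphic_on S" for X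
      by (auto simp: case_prod_unfold intro!: holomorphic_intros hol)
    have "(\<lambda>z. f (\<phi> z, \<psi> z)) holomorphic_on ball z d"
    proof (rule holomorphic_uniform_limit[OF _ lim])
      show "\<forall>\<^sub>F X in finite_subsets_at_top UNIV. continuous_on (cball z d) (\<lambda>y. \<Sum>ij\<in>X. ?T ij y) \<and>
        (\<lambda>y. \<Sum>ij\<in>X. ?T ij y) holomorphic_on ball z d"
        using hX d(2) ball_subset_cball[of z d]
        by (intro always_eventually allI conjI)
          (blast intro: holomorphic_on_imp_continuous_on holomorphic_on_subset)+
    qed auto
    then show ?thesis
      using d by (intro holomorphic_on_imp_differentiable_at[of _ "ball z d"]) auto
  qed
  then show ?thesis
    by (simp add: holomorphic_on_def field_differentiable_at_within)
qed

text \<open>One radius serves both the Lipschitz bound and the restriction to holomorphic curves, so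
  that the arguments in the chart need not return to the double series.\<close>

lemma analytic2_germ_local:
  assumes "analytic2_germ f"
  shows "\<exists>r>0. \<exists>L>0. (\<forall>p q. norm p < r \<longrightarrow> norm q < r \<longrightarrow> cmod (f p - f q) \<le> L * norm (p - q)) \<and>
    (\<forall>S \<phi> \<psi>. open S \<longrightarrow> \<phi> holomorphic_on S \<longrightarrow> \<psi> holomorphic_on S \<longrightarrow>
       (\<forall>z\<in>S. cmod (\<phi> z) < r \<and> cmod (\<psi> z) < r) \<longrightarrow> (\<lambda>z. f (\<phi> z, \<psi> z)) holomorphic_on S)"
proof -
  obtain R C where R: "R > 0" and sumR: "\<And>x y. cmod x < R \<and> cmod y < R \<Longrightarrow>
        ((\<lambda>(i,j). C i j * x ^ i * y ^ j) has_sum f (x, y)) UNIV"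
    using assms unfolding analytic2_germ_def by blast
  define r where "r = R / 2"
  have r: "r > 0" using R by (simp add: r_def)
  have sum: "((\<lambda>(i,j). C i j * x ^ i * y ^ j) has_sum f (x, y)) UNIV" if "cmod x \<le> r" "cmod y \<le> r" for x y
    using that R by (intro sumR) (auto simp: r_def)
  have M: "(\<lambda>(i,j). cmod (C i j) * r ^ i * r ^ j) summable_on UNIV"
    using r by (intro power_series2_bound[OF sum]) auto
  define M where "M = 1 + infsum (\<lambda>(i,j). cmod (C i j) * r ^ i * r ^ j) UNIV"
  have Mpos: "M > 0"
    unfolding M_def using r by (intro add_pos_nonneg infsum_nonneg) auto
  have bd: "cmod (f (x,y)) \<le> M" if xy: "cmod x \<le> r" "cmod y \<le> r" for x y
  proof -
    have "cmod (f (x,y)) \<le> infsum (\<lambda>(i,j). cmod (C i j) * r ^ i * r ^ j) UNIV"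
    proof (rule norm_infsum_le[OF sum[OF xy] has_sum_infsum[OF M]])
      show "norm (case ij of (i, j) \<Rightarrow> C i j * x ^ i * y ^ j) \<le> (case ij of (i, j) \<Rightarrow> cmod (C i j) * r ^ i * r ^ j)" for ij
        using xy r by (cases ij) (auto simp: norm_mult norm_power intro!: mult_mono power_mono mult_nonneg_nonneg)
    qed
    then show ?thesis by (simp add: M_def)
  qed
  have hol: "(\<lambda>z. f (\<phi> z, \<psi> z)) holomorphic_on S" if "open S" "\<phi> holomorphic_on S" "\<psi> holomorphic_on S"
    "\<And>z. z \<in> S \<Longrightarrow> cmod (\<phi> z) < r \<and> cmod (\<psi> z) < r" for S \<phi> \<psi>
    using power_series2_compose_holomorphic[OF sum r] that by blast
  have lip: "cmod (f p - f q) \<le> 8 * M / r * norm (p - q)" if pq: "norm p < r/2" "norm q < r/2" for p q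
  proof -
    obtain x y x' y' where p: "p = (x,y)" and q: "q = (x',y')" by (cases p, cases q)
    have n: "cmod x < r/2" "cmod y < r/2" "cmod x' < r/2" "cmod y' < r/2"
      using pq norm_fst_le[of x y] norm_snd_le[of y x] norm_fst_le[of x' y'] norm_snd_le[of y' x']
      unfolding p q by linarith+
    \<comment> \<open>One coordinate is changed at a time; each change costs 4 M / r, hence the
      total 8 M / r.\<close>
    have "cmod (f (x,y) - f (x',y)) \<le> 4 * M / r * cmod (x - x')"
      by (rule bounded_holomorphic_lipschitz[where g = "\<lambda>z. f (z, y)"])
        (use n r in \<open>auto intro!: bd hol[of "ball 0 r" "\<lambda>z. z" "\<lambda>_. y"]\<close>)
    moreover have "cmod (f (x',y) - f (x',y')) \<le> 4 * M / r * cmod (y - y')"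
      by (rule bounded_holomorphic_lipschitz[where g = "\<lambda>z. f (x', z)"])
        (use n r in \<open>auto intro!: bd hol[of "ball 0 r" "\<lambda>_. x'" "\<lambda>z. z"]\<close>)
    moreover have "cmod (f (x,y) - f (x',y')) \<le> cmod (f (x,y) - f (x',y)) + cmod (f (x',y) - f (x',y'))"
      using norm_triangle_ineq[of "f (x,y) - f (x',y)" "f (x',y) - f (x',y')"] by simp
    moreover have "cmod (x - x') \<le> norm (p - q)" "cmod (y - y') \<le> norm (p - q)"
      using norm_fst_le[of "x - x'" "y - y'"] norm_snd_le[of "y - y'" "x - x'"] by (auto simp: p q)
    then have "4 * M / r * cmod (x - x') \<le> 4 * M / r * norm (p - q)"
       "4 * M / r * cmod (y - y') \<le> 4 * M / r * norm (p - q)"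
      using r Mpos by (auto intro!: mult_left_mono divide_right_mono)
    ultimately show ?thesis unfolding p q by simp
  qed
  have pos: "r/2 > 0" "8 * M / r > 0" using r Mpos by auto
  show ?thesis
  proof (rule exI[of _ "r/2"], rule conjI[OF pos(1)], rule exI[of _ "8 * M / r"], rule conjI[OF pos(2)],
      intro conjI allI impI lip)
    fix S \<phi> \<psi>
    assume S: "open S" "\<phi> holomorphic_on S" "\<psi> holomorphic_on S" "\<forall>z\<in>S. cmod (\<phi> z) < r/2 \<and> cmod (\<psi> z) < r/2"
    have "cmod (\<phi> z) < r \<and> cmod (\<psi> z) < r" if "z \<in> S" for z
      using bspec[OF S(4) that] r by linarith
    then show "(\<lambda>z. f (\<phi> z, \<psi> z)) holomorphic_on S" by (rule hol[OF S(1-3)])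
  qed
qed

text \<open>On a line through 0 in a direction where the leading form does not vanish, f is s^m
  times a nonzero constant up to an error s^(m+1) B: the absolute series B at the endpoint dominates
  all higher terms at once.\<close>

lemma germ_mult_lower_bound:
  assumes "germ_mult f m"
  shows "\<exists>p. \<exists>c>0. \<exists>\<epsilon>>0. \<forall>s. 0 < s \<longrightarrow> s < \<epsilon> \<longrightarrow> c * s ^ m \<le> cmod (f (s *\<^sub>R p))"
proof -
  obtain r C i0 j0 where r: "r > 0" and sum: "\<And>x y. cmod x < r \<and> cmod y < r \<Longrightarrow>
        ((\<lambda>(i,j). C i j * x ^ i * y ^ j) has_sum f (x, y)) UNIV"
    and low: "\<And>i j. i + j < m \<Longrightarrow> C i j = 0" and nz: "i0 + j0 = m" "C i0 j0 \<noteq> 0"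
    using assms unfolding germ_mult_def by blast
  \<comment> \<open>\<open>A\<close> is the leading form on the line x = 1. A nonzero value of it at
    \<open>u\<close> selects the direction (1, u), which \<open>\<rho>\<close> scales into the
    polydisc of convergence.\<close>
  define A where "A = (\<Sum>j\<le>m. monom (C (m - j) j) j)"
  have "coeff A j0 = C i0 j0"
    using nz by (auto simp: A_def coeff_sum if_distrib cong: if_cong)
  then have "A \<noteq> 0" using nz by auto
  then obtain u where u: "poly A u \<noteq> 0"
    using poly_all_0_iff_0 by blast
  define \<rho> where "\<rho> = r / (2 * (1 + cmod u))"
  have \<rho>: "\<rho> > 0" using r by (auto simp: \<rho>_def add_pos_nonneg)
  have "r / (2 * (1 + cmod u)) * (1 + cmod u) = r / 2"
    using norm_ge_zero[of u] by (simp add: field_simps add_nonneg_eq_0_iff)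
  then have e: "\<rho> + \<rho> * cmod u = r / 2"
    unfolding \<rho>_def by (simp add: distrib_left)
  have small: "\<rho> < r" "\<rho> * cmod u < r"
    using e r \<rho> mult_nonneg_nonneg[of \<rho> "cmod u"] norm_ge_zero[of u] by linarith+
  define x where "x = complex_of_real \<rho>"
  define y where "y = of_real \<rho> * u"
  have xy: "cmod x < r" "cmod y < r"
    using small \<rho> by (auto simp: x_def y_def norm_mult)
  define D where "D = (\<lambda>(i,j). C i j * x ^ i * y ^ j)"
  have D: "D summable_on UNIV"
    using sum[of x y] xy has_sum_imp_summable unfolding D_def by blast
  then have Dabs: "(\<lambda>ij. cmod (D ij)) summable_on UNIV"
    using summable_on_iff_abs_summable_on_complex by blast
  define B where "B = infsum (\<lambda>ij. cmod (D ij)) UNIV"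
  have B: "B \<ge> 0" unfolding B_def by (intro infsum_nonneg) auto
  let ?I = "{ij::nat \<times> nat. fst ij + snd ij = m}"
  have Ieq: "?I = (\<lambda>j. (m - j, j)) ` {..m}"
    by (auto simp: image_iff)
  then have finI: "finite ?I" by simp
  define P where "P = (\<Sum>ij\<in>?I. D ij)"
  have "P = (\<Sum>j\<le>m. D (m - j, j))"
    unfolding P_def Ieq by (subst sum.reindex) (auto simp: inj_on_def)
  also have "\<dots> = (\<Sum>j\<le>m. of_real \<rho> ^ m * (C (m - j) j * u ^ j))"
  proof (rule sum.cong)
    fix j assume "j \<in> {..m}"
    then have "complex_of_real \<rho> ^ m = of_real \<rho> ^ (m - j) * of_real \<rho> ^ j"
      by (simp flip: power_add)
    then show "D (m - j, j) = of_real \<rho> ^ m * (C (m - j) j * u ^ j)"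
      by (simp add: D_def x_def y_def power_mult_distrib)
  qed simp
  also have "\<dots> = of_real \<rho> ^ m * poly A u"
    by (simp add: A_def poly_sum poly_monom sum_distrib_left)
  finally have P: "P \<noteq> 0" using u \<rho> by simp
  have est: "cmod (f (s *\<^sub>R (x, y)) - s ^ m * P) \<le> s ^ Suc m * B" if s: "0 < s" "s < 1" for s :: real
  proof -
    have "cmod (of_real s * x) \<le> cmod x" "cmod (of_real s * y) \<le> cmod y"
      using s by (auto simp: norm_mult intro!: mult_left_le_one_le)
    then have "((\<lambda>(i,j). C i j * (of_real s * x) ^ i * (of_real s * y) ^ j) has_sum f (of_real s * x, of_real s * y)) UNIV"
      using xy by (intro sum) auto
    moreover have "(\<lambda>(i,j). C i j * (of_real s * x) ^ i * (of_real s * y) ^ j) = (\<lambda>ij. D ij * of_real s ^ (fst ij + snd ij))"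
      by (auto simp: D_def fun_eq_iff power_mult_distrib power_add)
    ultimately have 1: "((\<lambda>ij. D ij * of_real s ^ (fst ij + snd ij)) has_sum f (s *\<^sub>R (x, y))) UNIV"
      by (simp add: scaleR_conv_of_real)
    have 2: "((\<lambda>ij. if ij \<in> ?I then D ij * of_real s ^ m else 0) has_sum s ^ m * P) UNIV"
      by (rule has_sum_finite_neutralI[OF finI])
        (auto simp: P_def sum_distrib_left mult.commute intro!: sum.cong)
    have "((\<lambda>ij. D ij * of_real s ^ (fst ij + snd ij) - (if ij \<in> ?I then D ij * of_real s ^ m else 0))
       has_sum (f (s *\<^sub>R (x, y)) - s ^ m * P)) UNIV"
      using has_sum_add[OF 1 has_sum_uminusI[OF 2]] by simp
    moreover have "((\<lambda>ij. s ^ Suc m * cmod (D ij)) has_sum s ^ Suc m * B) UNIV"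
      unfolding B_def by (intro has_sum_cmult_right has_sum_infsum Dabs)
    ultimately show ?thesis
    proof (rule norm_infsum_le)
      fix ij :: "nat \<times> nat"
      consider "fst ij + snd ij < m" | "fst ij + snd ij = m" | "fst ij + snd ij \<ge> Suc m" by linarith
      then show "cmod (D ij * of_real s ^ (fst ij + snd ij) - (if ij \<in> ?I then D ij * of_real s ^ m else 0))
         \<le> s ^ Suc m * cmod (D ij)"
      proof cases
        case 1
        then have "D ij = 0" using low by (auto simp: D_def case_prod_unfold)
        then show ?thesis by simp
      next
        case 2
        then show ?thesis using s by simp
      next
        case 3
        have "cmod (D ij) * s ^ (fst ij + snd ij) \<le> cmod (D ij) * s ^ Suc m"
          using s 3 by (intro mult_left_mono power_decreasing) auto
        then show ?thesis using 3 s by (simp add: norm_mult norm_power mult_ac)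
      qed
    qed
  qed
  \<comment> \<open>Below the second threshold s B is at most |P| / 2, so half of the main term
    survives; \<open>B + 1\<close> avoids a vanishing denominator.\<close>
  have pos: "cmod P / 2 > 0" "min 1 (cmod P / (2 * (B + 1))) > 0" using P B by auto
  show ?thesis
  proof (rule exI[of _ "(x, y)"], rule exI[of _ "cmod P / 2"], rule conjI[OF pos(1)],
      rule exI[of _ "min 1 (cmod P / (2 * (B + 1)))"], rule conjI[OF pos(2)], intro allI impI)
    fix s :: real assume s: "0 < s" "s < min 1 (cmod P / (2 * (B + 1)))"
    then have "s * (2 * (B + 1)) < cmod P"
      using B by (simp add: field_simps)
    then have "2 * (s * B) \<le> cmod P" using s by (simp add: algebra_simps)
    then have "s ^ m * (2 * (s * B)) \<le> s ^ m * cmod P" using s by (intro mult_left_mono) auto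
    moreover have "cmod (s ^ m * P) \<le> cmod (f (s *\<^sub>R (x, y))) + s ^ Suc m * B"
      using est[of s] s norm_triangle_sub[of "s ^ m * P" "f (s *\<^sub>R (x, y))"] by (simp add: norm_minus_commute)
    moreover have "cmod (s ^ m * P) = s ^ m * cmod P"
      using s by (simp add: norm_mult norm_power)
    ultimately show "cmod P / 2 * s ^ m \<le> cmod (f (s *\<^sub>R (x, y)))"
      by (simp add: algebra_simps)
  qed
qed

subsection \<open>Division by simple branches\<close>

text \<open>Zeros are removed one at a time as removable singularities: the factors already split
  off do not vanish at the next zero a, so the quotient obtained so far does.\<close>

lemma holomorphic_divide_simple_zeros:
  assumes "finite A" "open S" "A \<subseteq> S" "g holomorphic_on S" "\<And>a. a \<in> A \<Longrightarrow> g a = 0"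
  shows "\<exists>h. h holomorphic_on S \<and> (\<forall>z\<in>S. g z = (\<Prod>a\<in>A. z - a) * h z)"
  using assms
proof (induction A rule: finite_induct)
  case empty
  then show ?case by auto
next
  case (insert a A)
  then obtain h where h: "h holomorphic_on S" "\<And>z. z \<in> S \<Longrightarrow> g z = (\<Prod>a\<in>A. z - a) * h z"
    by auto
  have "(\<Prod>b\<in>A. a - b) \<noteq> 0" using insert.hyps by auto
  then have "h a = 0" using h(2)[of a] insert.prems by auto
  define h1 where "h1 = (\<lambda>z. if z = a then deriv h a else (h z - h a) / (z - a))"
  have "h1 holomorphic_on S"
    unfolding h1_def by (rule pole_lemma_open[OF h(1) insert.prems(1)])
  moreover have "h z = (z - a) * h1 z" for z
    using \<open>h a = 0\<close> by (auto simp: h1_def)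
  then have "g z = (\<Prod>b\<in>insert a A. z - b) * h1 z" if "z \<in> S" for z
    using h(2)[OF that] insert.hyps by simp
  ultimately show ?case by blast
qed

lemma holomorphic_divide_power:
  assumes "g holomorphic_on ball 0 r" "r > 0" "\<And>t. cmod t < r \<Longrightarrow> cmod (g t) \<le> C * cmod t ^ n"
  shows "\<exists>h. h holomorphic_on ball 0 r \<and> (\<forall>t\<in>ball 0 r. g t = t ^ n * h t)"
  using assms
proof (induction n arbitrary: g)
  case 0
  then show ?case by auto
next
  case (Suc n)
  have "g 0 = 0" using Suc.prems(3)[of 0] Suc.prems(2) by auto
  define h where "h = (\<lambda>z. if z = 0 then deriv g 0 else (g z - g 0) / (z - 0))"
  have hol: "h holomorphic_on ball 0 r"
    unfolding h_def using Suc.prems(1) by (rule pole_lemma_open) simp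
  have gh: "g z = z * h z" for z
    using \<open>g 0 = 0\<close> by (auto simp: h_def)
  have bd: "cmod (h t) \<le> C * cmod t ^ n" if t: "cmod t < r" "t \<noteq> 0" for t
    using Suc.prems(3)[OF t(1)] t(2) by (simp add: gh norm_mult)
  \<comment> \<open>Division by |t| gives the bound only off 0. At 0 it follows by continuity; it
    still has content when n = 0, where the power of 0 is 1.\<close>
  have bd0: "cmod (h 0) \<le> C * cmod 0 ^ n"
  proof (rule tendsto_le[where F = "at (0::complex)"])
    have "isCont h 0"
      using hol Suc.prems(2) by (intro holomorphic_on_imp_continuous_on[THEN continuous_on_interior]) auto
    then show "((\<lambda>t. cmod (h t)) \<longlongrightarrow> cmod (h 0)) (at 0)"
      by (intro tendsto_norm) (simp add: isCont_def)
    show "((\<lambda>t::complex. C * cmod t ^ n) \<longlongrightarrow> C * cmod 0 ^ n) (at 0)"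
      by (intro tendsto_intros)
    show "\<forall>\<^sub>F t in at 0. cmod (h t) \<le> C * cmod t ^ n"
      using Suc.prems(2) bd unfolding eventually_at by (intro exI[of _ r]) auto
  qed auto
  obtain k where "k holomorphic_on ball 0 r" "\<forall>t\<in>ball 0 r. h t = t ^ n * k t"
    using Suc.IH[OF hol Suc.prems(2)] bd bd0 by blast
  then show ?case by (intro exI[of _ k]) (auto simp: gh)
qed

text \<open>For fixed t \<noteq> 0 the zeros are simple and the quotient by them is holomorphic in
  y. Cauchy's formula expresses it by values on a circle from which all \<open>\<zeta> i t\<close>
  stay away, and that expression remains meaningful and jointly continuous at t = 0, where the zeros
  collide.\<close>

lemma weierstrass_quotient:
  fixes G :: "complex \<Rightarrow> complex \<Rightarrow> complex" and \<zeta> :: "'i \<Rightarrow> complex \<Rightarrow> complex"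
  assumes I: "finite I" and R: "R > 0"
    and contG: "continuous_on (ball 0 R \<times> ball 0 R) (\<lambda>(t,y). G t y)"
    and hol: "\<And>t. cmod t < R \<Longrightarrow> G t holomorphic_on ball 0 R"
    and cont\<zeta>: "\<And>i. i \<in> I \<Longrightarrow> continuous_on (ball 0 R) (\<zeta> i)"
    and \<zeta>0: "\<And>i. i \<in> I \<Longrightarrow> \<zeta> i 0 = 0"
    and zero: "\<And>i t. i \<in> I \<Longrightarrow> cmod t < R \<Longrightarrow> cmod (\<zeta> i t) < R \<Longrightarrow> G t (\<zeta> i t) = 0"
    and inj: "\<And>t. cmod t < R \<Longrightarrow> t \<noteq> 0 \<Longrightarrow> inj_on (\<lambda>i. \<zeta> i t) I"
  shows "\<exists>r>0. \<exists>H. continuous_on (ball 0 r \<times> ball 0 r) H \<and>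
    (\<forall>t y. cmod t < r \<longrightarrow> cmod y < r \<longrightarrow> G t y = (\<Prod>i\<in>I. y - \<zeta> i t) * H (t, y))"
proof -
  define \<rho> where "\<rho> = R / 2"
  have \<rho>: "\<rho> > 0" "\<rho> < R" using R by (auto simp: \<rho>_def)
  have "\<forall>\<^sub>F t in at 0. cmod (\<zeta> i t) < \<rho> / 2" if i: "i \<in> I" for i
  proof -
    have "isCont (\<zeta> i) 0"
      using cont\<zeta>[OF i] R by (intro continuous_on_interior) auto
    then have "((\<lambda>t. cmod (\<zeta> i t)) \<longlongrightarrow> cmod (\<zeta> i 0)) (at 0)"
      by (intro tendsto_norm) (simp add: isCont_def)
    then show ?thesis
      using \<rho> \<zeta>0[OF i] by (intro order_tendstoD(2)) auto
  qed
  then have "\<forall>\<^sub>F t in at 0. \<forall>i\<in>I. cmod (\<zeta> i t) < \<rho> / 2"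
    using I by (simp add: eventually_ball_finite)
  then obtain d where d: "d > 0" "\<And>t i. t \<noteq> 0 \<Longrightarrow> cmod t < d \<Longrightarrow> i \<in> I \<Longrightarrow> cmod (\<zeta> i t) < \<rho> / 2"
    unfolding eventually_at by auto
  \<comment> \<open>For |t|, |y| < r both the zeros and y lie strictly inside the circle |w| =
    \<rho>, so no denominator of the integrand vanishes.\<close>
  define r where "r = min d (\<rho> / 2)"
  have r: "r > 0" "r < \<rho>" "r \<le> d" using d \<rho> by (auto simp: r_def)
  have small: "cmod (\<zeta> i t) < \<rho> / 2" if "cmod t < r" "i \<in> I" for t i
    using d(2)[of t i] \<zeta>0[of i] \<rho> that r by (cases "t = 0") auto
  define w where "w = (\<lambda>\<theta>::real. of_real \<rho> * exp (2 * of_real pi * \<i> * of_real \<theta>))"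
  have cw: "cmod (w \<theta>) = \<rho>" for \<theta>
    using \<rho> by (simp add: w_def norm_mult)
  \<comment> \<open>The Cauchy integrand in the variable \<theta>: dw = 2 \<pi> i w d\<theta>, where
    2 \<pi> i cancels against the factor of Cauchy's formula and w stays in the numerator.\<close>
  define K where "K = (\<lambda>ty \<theta>. G (fst ty) (w \<theta>) / (\<Prod>i\<in>I. w \<theta> - \<zeta> i (fst ty)) * (w \<theta> / (w \<theta> - snd ty)))"
  define H where "H = (\<lambda>ty. integral (cbox 0 1) (K ty))"
  have ne: "w \<theta> \<noteq> \<zeta> i t" "w \<theta> \<noteq> y" if "cmod t < r" "i \<in> I" "cmod y < r" for \<theta> i t y
    using cw[of \<theta>] small[OF that(1,2)] that r \<rho> by auto
  have contH: "continuous_on (ball 0 r \<times> ball 0 r) H"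
    unfolding H_def
  proof (rule integral_continuous_on_param)
    let ?D = "(ball 0 r \<times> ball 0 r) \<times> cbox 0 (1::real)"
    have cw': "continuous_on ?D (\<lambda>p. w (snd p))"
      unfolding w_def by (intro continuous_intros)
    have cG: "continuous_on ?D (\<lambda>p. G (fst (fst p)) (w (snd p)))"
    proof -
      have "continuous_on ?D (\<lambda>p. (fst (fst p), w (snd p)))"
        by (intro continuous_intros cw')
      then have "continuous_on ?D (\<lambda>p. (\<lambda>(t,y). G t y) (fst (fst p), w (snd p)))"
        by (rule continuous_on_compose2[OF contG]) (use cw \<rho> r in auto)
      then show ?thesis by simp
    qed
    have c\<zeta>: "continuous_on ?D (\<lambda>p. \<zeta> i (fst (fst p)))" if "i \<in> I" for i
      by (rule continuous_on_compose2[OF cont\<zeta>[OF that]]) (use \<rho> r in \<open>auto intro!: continuous_intros\<close>)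
    show "continuous_on ?D (\<lambda>(ty, \<theta>). K ty \<theta>)"
      unfolding K_def case_prod_unfold
      by (intro continuous_intros cG c\<zeta> cw') (use ne I cw r in \<open>auto simp: prod_zero_iff\<close>)
  qed
  have eq: "G t y = (\<Prod>i\<in>I. y - \<zeta> i t) * H (t, y)" if t: "cmod t < r" "t \<noteq> 0" and y: "cmod y < r" for t y
  proof -
    have tR: "cmod t < R" using t r \<rho> by simp
    have "\<exists>h. h holomorphic_on ball 0 R \<and> (\<forall>z\<in>ball 0 R. G t z = (\<Prod>a\<in>(\<lambda>i. \<zeta> i t) ` I. z - a) * h z)"
    proof (rule holomorphic_divide_simple_zeros)
      show "(\<lambda>i. \<zeta> i t) ` I \<subseteq> ball 0 R"
        using small[OF t(1)] \<rho> by force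
      show "G t a = 0" if "a \<in> (\<lambda>i. \<zeta> i t) ` I" for a
        using that small[OF t(1)] \<rho> tR by (force intro!: zero)
    qed (use I hol[OF tR] in auto)
    then obtain h where h: "h holomorphic_on ball 0 R"
      "\<And>z. z \<in> ball 0 R \<Longrightarrow> G t z = (\<Prod>i\<in>I. z - \<zeta> i t) * h z"
      using inj[OF tR t(2)] by (auto simp: prod.reindex)
    have "((\<lambda>u. h u/(u-y)) has_contour_integral (2 * of_real pi * \<i> * h y)) (circlepath 0 \<rho>)"
    proof (rule Cauchy_integral_circlepath)
      have "cball 0 \<rho> \<subseteq> ball (0::complex) R" using \<rho> by auto
      then show "continuous_on (cball 0 \<rho>) h" "h holomorphic_on ball 0 \<rho>"
        using h(1) ball_subset_cball[of 0 \<rho>]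
        by (blast intro: holomorphic_on_imp_continuous_on holomorphic_on_subset)+
    qed (use y r in simp)
    then have "((\<lambda>\<theta>. h (circlepath 0 \<rho> \<theta>) / (circlepath 0 \<rho> \<theta> - y) * vector_derivative (circlepath 0 \<rho>) (at \<theta>))
       has_integral (2 * of_real pi * \<i> * h y)) {0..1}"
      by (simp add: has_contour_integral)
    also have "(\<lambda>\<theta>. h (circlepath 0 \<rho> \<theta>) / (circlepath 0 \<rho> \<theta> - y) * vector_derivative (circlepath 0 \<rho>) (at \<theta>))
       = (\<lambda>\<theta>. 2 * of_real pi * \<i> * K (t, y) \<theta>)"
    proof
      fix \<theta>
      have "G t (w \<theta>) = (\<Prod>i\<in>I. w \<theta> - \<zeta> i t) * h (w \<theta>)"
        using cw[of \<theta>] \<rho> by (intro h) auto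
      moreover have "(\<Prod>i\<in>I. w \<theta> - \<zeta> i t) \<noteq> 0"
        using ne[OF t(1) _ y] I by auto
      ultimately have "K (t, y) \<theta> = h (w \<theta>) * (w \<theta> / (w \<theta> - y))"
        by (simp add: K_def)
      moreover have "circlepath 0 \<rho> \<theta> = w \<theta>" "vector_derivative (circlepath 0 \<rho>) (at \<theta>) = 2 * of_real pi * \<i> * w \<theta>"
        unfolding vector_derivative_circlepath by (simp_all add: circlepath w_def mult_ac)
      ultimately show "h (circlepath 0 \<rho> \<theta>) / (circlepath 0 \<rho> \<theta> - y) * vector_derivative (circlepath 0 \<rho>) (at \<theta>)
        = 2 * of_real pi * \<i> * K (t, y) \<theta>"
        by simp
    qed
    finally have "((\<lambda>\<theta>. 2 * of_real pi * \<i> * K (t, y) \<theta>) has_integral 2 * of_real pi * \<i> * h y) {0..1}" .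
    from has_integral_mult_right[OF this, of "inverse (2 * of_real pi * \<i>)"]
    have "(K (t, y) has_integral h y) {0..1}"
      by (simp add: field_simps)
    then have "H (t, y) = h y"
      by (simp add: H_def integral_unique)
    then show ?thesis using h(2)[of y] y r \<rho> by simp
  qed
  \<comment> \<open>Both sides are continuous in t and agree on the punctured disc, hence also at t
    = 0.\<close>
  have eq0: "G 0 y = (\<Prod>i\<in>I. y - \<zeta> i 0) * H (0, y)" if y: "cmod y < r" for y
  proof -
    let ?D = "\<lambda>t. G t y - (\<Prod>i\<in>I. y - \<zeta> i t) * H (t, y)"
    have 1: "continuous_on (ball 0 r) (\<lambda>t. (\<lambda>(t,y). G t y) (t, y))"
      by (rule continuous_on_compose2[OF contG]) (use y r \<rho> in \<open>auto intro!: continuous_intros\<close>)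
    have 2: "continuous_on (ball 0 r) (\<lambda>t. H (t, y))"
      by (rule continuous_on_compose2[OF contH]) (use y r \<rho> in \<open>auto intro!: continuous_intros\<close>)
    have 3: "continuous_on (ball 0 r) (\<zeta> i)" if "i \<in> I" for i
      using cont\<zeta>[OF that] by (rule continuous_on_subset) (use r \<rho> in auto)
    have "continuous_on (ball 0 r) ?D"
      using 1 2 by (intro continuous_intros 3) auto
    then have "(?D \<longlongrightarrow> ?D 0) (at 0)"
      using r continuous_on_interior[of "ball 0 r" ?D 0] by (simp add: isCont_def)
    moreover have "(?D \<longlongrightarrow> 0) (at 0)"
    proof (rule tendsto_eventually)
      show "\<forall>\<^sub>F t in at 0. ?D t = 0"
        unfolding eventually_at using r eq y by (intro exI[of _ r]) auto
    qed
    ultimately have "?D 0 = 0"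
      using tendsto_unique trivial_limit_at by blast
    then show ?thesis by simp
  qed
  show ?thesis
  proof (intro exI[of _ r] exI[of _ H] conjI allI impI r(1) contH)
    show "G t y = (\<Prod>i\<in>I. y - \<zeta> i t) * H (t, y)" if "cmod t < r" "cmod y < r" for t y
      using eq[of t y] eq0[of y] that by (cases "t = 0") auto
  qed
qed

text \<open>If |H 0| were less than c, then |H| < c near 0 by continuity, against \<open>low\<close>
  at a point close enough to 0. There \<open>G t y \<noteq> 0\<close> makes the product positive, so
  that the inequality stays strict after multiplication. Continuity then keeps |H| between positive
  constants.\<close>

lemma weierstrass_comparable:
  fixes G :: "complex \<Rightarrow> complex \<Rightarrow> complex" and \<zeta> :: "'i \<Rightarrow> complex \<Rightarrow> complex"
  assumes I: "finite I" and R: "R > 0"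
    and contG: "continuous_on (ball 0 R \<times> ball 0 R) (\<lambda>(t,y). G t y)"
    and hol: "\<And>t. cmod t < R \<Longrightarrow> G t holomorphic_on ball 0 R"
    and cont\<zeta>: "\<And>i. i \<in> I \<Longrightarrow> continuous_on (ball 0 R) (\<zeta> i)"
    and \<zeta>0: "\<And>i. i \<in> I \<Longrightarrow> \<zeta> i 0 = 0"
    and zero: "\<And>i t. i \<in> I \<Longrightarrow> cmod t < R \<Longrightarrow> cmod (\<zeta> i t) < R \<Longrightarrow> G t (\<zeta> i t) = 0"
    and inj: "\<And>t. cmod t < R \<Longrightarrow> t \<noteq> 0 \<Longrightarrow> inj_on (\<lambda>i. \<zeta> i t) I"
    and c: "c > 0" and low: "\<And>d. d > 0 \<Longrightarrow> \<exists>t y. cmod t < d \<and> cmod y < d \<and> G t y \<noteq> 0 \<and>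
      c * (\<Prod>i\<in>I. cmod (y - \<zeta> i t)) \<le> cmod (G t y)"
  shows "\<exists>r>0. \<exists>A>0. \<exists>B>0. \<forall>t y. cmod t < r \<longrightarrow> cmod y < r \<longrightarrow>
    A * (\<Prod>i\<in>I. cmod (y - \<zeta> i t)) \<le> cmod (G t y) \<and> cmod (G t y) \<le> B * (\<Prod>i\<in>I. cmod (y - \<zeta> i t))"
proof -
  obtain r H where r: "r > 0" and contH: "continuous_on (ball 0 r \<times> ball 0 r) H"
    and GH: "\<And>t y. cmod t < r \<Longrightarrow> cmod y < r \<Longrightarrow> G t y = (\<Prod>i\<in>I. y - \<zeta> i t) * H (t, y)"
    using weierstrass_quotient[OF I R contG hol cont\<zeta> \<zeta>0 zero inj] by auto
  have "isCont H 0"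
    using contH r by (intro continuous_on_interior) (auto simp: interior_open open_Times zero_prod_def)
  then have lim: "((\<lambda>p. cmod (H p)) \<longlongrightarrow> cmod (H 0)) (nhds 0)"
    by (intro tendsto_norm) (simp add: isCont_def flip: tendsto_at_iff_tendsto_nhds)
  have near: "\<exists>d>0. \<forall>t y. cmod t < d \<longrightarrow> cmod y < d \<longrightarrow> P (t, y)" if P: "eventually P (nhds 0)"
    for P :: "complex \<times> complex \<Rightarrow> bool"
  proof -
    obtain e where e: "e > 0" "\<And>p. norm p < e \<Longrightarrow> P p"
      using P unfolding eventually_nhds_metric by auto
    have "norm (t, y) < e" if "cmod t < e/2" "cmod y < e/2" for t y :: complex
      using norm_Pair_le[of t y] that by linarith
    then show ?thesis using e by (intro exI[of _ "e/2"]) auto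
  qed
  have ge: "cmod (H 0) \<ge> c"
  proof (rule ccontr)
    assume "\<not> ?thesis"
    then have "\<forall>\<^sub>F p in nhds 0. cmod (H p) < c" using order_tendstoD(2)[OF lim] by simp
    then obtain d where d: "d > 0" "\<And>t y. cmod t < d \<Longrightarrow> cmod y < d \<Longrightarrow> cmod (H (t, y)) < c"
      using near by blast
    obtain t y where ty: "cmod t < min d r" "cmod y < min d r" "G t y \<noteq> 0" "c * (\<Prod>i\<in>I. cmod (y - \<zeta> i t)) \<le> cmod (G t y)"
      using low[of "min d r"] d(1) r by auto
    have "G t y = (\<Prod>i\<in>I. y - \<zeta> i t) * H (t, y)" using ty by (intro GH) auto
    then have *: "cmod (G t y) = (\<Prod>i\<in>I. cmod (y - \<zeta> i t)) * cmod (H (t, y))"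
      by (simp add: norm_mult prod_norm)
    then have "(\<Prod>i\<in>I. cmod (y - \<zeta> i t)) > 0"
      using ty(3) prod_nonneg[of I "\<lambda>i. cmod (y - \<zeta> i t)"] by (auto simp: less_le)
    moreover have "cmod (H (t, y)) < c" using ty d by auto
    ultimately have "cmod (G t y) < (\<Prod>i\<in>I. cmod (y - \<zeta> i t)) * c"
      unfolding * by (rule mult_strict_left_mono[rotated])
    with ty(4) show False by (simp add: mult.commute)
  qed
  have "\<forall>\<^sub>F p in nhds 0. c / 2 < cmod (H p) \<and> cmod (H p) < cmod (H 0) + 1"
    using ge c by (intro eventually_conj order_tendstoD[OF lim]) auto
  then obtain d where d: "d > 0" "\<And>t y. cmod t < d \<Longrightarrow> cmod y < d \<Longrightarrow>
      c / 2 < cmod (H (t, y)) \<and> cmod (H (t, y)) < cmod (H 0) + 1"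
    using near by blast
  have pos: "min d r > 0" "c / 2 > 0" "cmod (H 0) + 1 > 0" using d r c by (auto simp: add_nonneg_pos)
  show ?thesis
  proof (rule exI[of _ "min d r"], rule conjI[OF pos(1)], rule exI[of _ "c / 2"], rule conjI[OF pos(2)],
      rule exI[of _ "cmod (H 0) + 1"], rule conjI[OF pos(3)], intro allI impI)
    fix t y assume ty: "cmod t < min d r" "cmod y < min d r"
    have "G t y = (\<Prod>i\<in>I. y - \<zeta> i t) * H (t, y)" using ty by (intro GH) auto
    then have *: "cmod (G t y) = (\<Prod>i\<in>I. cmod (y - \<zeta> i t)) * cmod (H (t, y))"
      by (simp add: norm_mult prod_norm)
    have "c / 2 \<le> cmod (H (t, y))" "cmod (H (t, y)) \<le> cmod (H 0) + 1"
      using ty d(2)[of t y] by auto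
    moreover have "(\<Prod>i\<in>I. cmod (y - \<zeta> i t)) \<ge> 0" by (intro prod_nonneg) auto
    ultimately show "c / 2 * (\<Prod>i\<in>I. cmod (y - \<zeta> i t)) \<le> cmod (G t y) \<and>
       cmod (G t y) \<le> (cmod (H 0) + 1) * (\<Prod>i\<in>I. cmod (y - \<zeta> i t))"
      unfolding * by (simp_all only: mult.commute[of _ "cmod (H (t, y))"] mult_right_mono)
  qed
qed

subsection \<open>Power series and roots of unity\<close>

lemma power_series_factor_power:
  fixes a :: "nat \<Rightarrow> complex"
  assumes sum: "\<And>t. cmod t < \<rho> \<Longrightarrow> summable (\<lambda>j. a j * t ^ j)" and \<rho>: "\<rho> > 0"
    and low: "\<And>j. j < N \<Longrightarrow> a j = 0"
  shows "\<exists>\<eta>. \<eta> holomorphic_on ball 0 \<rho> \<and> \<eta> 0 = a N \<and> (\<forall>t. cmod t < \<rho> \<longrightarrow> (\<Sum>j. a j * t ^ j) = t ^ N * \<eta> t)"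
proof -
  define \<eta> where "\<eta> = (\<lambda>t. \<Sum>j. a (j + N) * t ^ j)"
  have s: "(\<lambda>j. a (j + N) * t ^ j) sums \<eta> t" if t: "cmod t < \<rho>" for t
  proof (cases "t = 0")
    case True
    then show ?thesis
      unfolding \<eta>_def by (intro summable_sums) (auto intro!: summable_finite[of "{0}"])
  next
    case False
    have "summable (\<lambda>j. a (j + N) * t ^ (j + N))"
      using sum[OF t] by (subst summable_iff_shift)
    then have "summable (\<lambda>j. a (j + N) * t ^ (j + N) / t ^ N)" by (rule summable_divide)
    then have "summable (\<lambda>j. a (j + N) * t ^ j)" using False by (simp add: power_add)
    then show ?thesis by (simp add: \<eta>_def summable_sums)
  qed
  have "\<eta> holomorphic_on ball 0 \<rho>"
    by (rule power_series_holomorphic[of _ _ "\<lambda>j. a (j + N)"]) (use s in auto)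
  moreover have "\<eta> 0 = a N"
    unfolding \<eta>_def using powser_zero[of "\<lambda>j. a (j + N)"] by simp
  moreover have "(\<Sum>j. a j * t ^ j) = t ^ N * \<eta> t" if t: "cmod t < \<rho>" for t
  proof -
    have "(\<Sum>j. a j * t ^ j) = (\<Sum>j. a (j + N) * t ^ (j + N)) + (\<Sum>j<N. a j * t ^ j)"
      by (rule suminf_split_initial_segment[OF sum[OF t]])
    also have "\<dots> = (\<Sum>j. t ^ N * (a (j + N) * t ^ j))"
      using low by (simp add: power_add mult_ac)
    also have "\<dots> = t ^ N * \<eta> t"
      using s[OF t] by (simp add: sums_iff suminf_mult)
    finally show ?thesis .
  qed
  ultimately show ?thesis by blast
qed

lemma power_series_order_bounds:
  fixes a :: "nat \<Rightarrow> complex"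
  assumes sum: "\<And>t. cmod t < \<rho> \<Longrightarrow> summable (\<lambda>j. a j * t ^ j)" and \<rho>: "\<rho> > 0"
    and low: "\<And>j. j < N \<Longrightarrow> a j = 0"
  shows "\<exists>r>0. \<exists>C>0. \<forall>t. cmod t < r \<longrightarrow> cmod (\<Sum>j. a j * t ^ j) \<le> C * cmod t ^ N"
    and "a N \<noteq> 0 \<Longrightarrow> \<exists>r>0. \<exists>c>0. \<forall>t. cmod t < r \<longrightarrow> c * cmod t ^ N \<le> cmod (\<Sum>j. a j * t ^ j)"
proof -
  obtain \<eta> where \<eta>: "\<eta> holomorphic_on ball 0 \<rho>" "\<eta> 0 = a N"
     "\<And>t. cmod t < \<rho> \<Longrightarrow> (\<Sum>j. a j * t ^ j) = t ^ N * \<eta> t"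
    using power_series_factor_power[of \<rho> a N, OF sum \<rho> low] by auto
  have "isCont \<eta> 0"
    using \<eta>(1) \<rho> by (intro continuous_on_interior holomorphic_on_imp_continuous_on) auto
  then have lim: "((\<lambda>t. cmod (\<eta> t)) \<longlongrightarrow> cmod (a N)) (nhds 0)"
    unfolding \<eta>(2)[symmetric] by (intro tendsto_norm) (simp add: isCont_def flip: tendsto_at_iff_tendsto_nhds)
  have "\<forall>\<^sub>F t in nhds 0. cmod (\<eta> t) < cmod (a N) + 1"
    by (rule order_tendstoD(2)[OF lim]) simp
  then obtain d where d: "d > 0" "\<And>t. cmod t < d \<Longrightarrow> cmod (\<eta> t) < cmod (a N) + 1"
    unfolding eventually_nhds_metric by auto
  have "cmod (\<Sum>j. a j * t ^ j) \<le> (cmod (a N) + 1) * cmod t ^ N" if "cmod t < min d \<rho>" for t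
    using \<eta>(3)[of t] d(2)[of t] that
    by (auto simp: norm_mult norm_power mult.commute[of "cmod t ^ N"] intro!: mult_right_mono)
  then show "\<exists>r>0. \<exists>C>0. \<forall>t. cmod t < r \<longrightarrow> cmod (\<Sum>j. a j * t ^ j) \<le> C * cmod t ^ N"
    using d \<rho> by (intro exI[of _ "min d \<rho>"] exI[of _ "cmod (a N) + 1"] conjI) (auto simp: add_nonneg_pos)
  assume aN: "a N \<noteq> 0"
  have "\<forall>\<^sub>F t in nhds 0. cmod (a N) / 2 < cmod (\<eta> t)"
    by (rule order_tendstoD(1)[OF lim]) (use aN in simp)
  then obtain d where d: "d > 0" "\<And>t. cmod t < d \<Longrightarrow> cmod (a N) / 2 < cmod (\<eta> t)"
    unfolding eventually_nhds_metric by auto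
  have "cmod (a N) / 2 * cmod t ^ N \<le> cmod (\<Sum>j. a j * t ^ j)" if "cmod t < min d \<rho>" for t
  proof -
    have "cmod (a N) / 2 * cmod t ^ N \<le> cmod (\<eta> t) * cmod t ^ N"
      using d(2)[of t] that by (intro mult_right_mono) auto
    then show ?thesis using \<eta>(3)[of t] that by (simp add: norm_mult norm_power mult.commute)
  qed
  then show "\<exists>r>0. \<exists>c>0. \<forall>t. cmod t < r \<longrightarrow> c * cmod t ^ N \<le> cmod (\<Sum>j. a j * t ^ j)"
    using d \<rho> aN by (intro exI[of _ "min d \<rho>"] exI[of _ "cmod (a N) / 2"] conjI) auto
qed

lemma finite_unity_roots: "m > 0 \<Longrightarrow> finite {\<omega>::complex. \<omega> ^ m = 1}"
  by (rule finite_roots_unity) simp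

lemma norm_unity_root: "m > 0 \<Longrightarrow> \<omega> ^ m = 1 \<Longrightarrow> cmod \<omega> = 1"
  by (metis norm_one norm_power power_eq_1_iff norm_ge_zero less_numeral_extra(3))

text \<open>Dividing by y reduces the claim to z^m - 1, which is squarefree because its derivative m
  z^(m-1) has no common zero with it.\<close>

lemma prod_unity_roots:
  fixes x y :: complex
  assumes m: "m > 0"
  shows "x ^ m - y ^ m = (\<Prod>\<omega> | \<omega> ^ m = 1. x - \<omega> * y)"
proof -
  let ?U = "{\<omega>::complex. \<omega> ^ m = 1}"
  define p :: "complex poly" where "p = monom 1 m + [:-1:]"
  have roots: "{z. poly p z = 0} = ?U"
    by (auto simp: p_def poly_monom)
  have deg: "degree p = m"
    unfolding p_def using m by (subst degree_add_eq_left) (auto simp: degree_monom_eq)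
  have lc: "lead_coeff p = 1"
    unfolding deg using m by (simp add: p_def coeff_pCons split: nat.split)
  have "rsquarefree p"
    unfolding rsquarefree_roots
  proof safe
    fix a assume "poly p a = 0" "poly (pderiv p) a = 0"
    then have "a ^ m = 1" "of_nat m * a ^ (m - 1) = 0"
      by (auto simp: p_def poly_monom pderiv_add pderiv_monom pderiv_pCons)
    then show False using m by (auto simp: power_0_left split: if_splits)
  qed
  from complex_poly_decompose_rsquarefree[OF this]
  have p: "p = (\<Prod>z\<in>?U. [:-z, 1:])"
    by (simp add: lc roots)
  have z: "z ^ m - 1 = (\<Prod>\<omega>\<in>?U. z - \<omega>)" for z
    using arg_cong[OF p, of "\<lambda>q. poly q z"] by (simp add: p_def poly_prod poly_monom)
  have card: "card ?U = m" using m by (simp add: card_roots_unity_eq)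
  show ?thesis
  proof (cases "y = 0")
    case True
    then show ?thesis using m card by simp
  next
    case False
    have "x ^ m - y ^ m = y ^ m * ((x / y) ^ m - 1)"
      using False by (simp add: field_simps)
    also have "\<dots> = (\<Prod>\<omega>\<in>?U. y) * (\<Prod>\<omega>\<in>?U. x / y - \<omega>)"
      using card by (simp add: z)
    also have "\<dots> = (\<Prod>\<omega>\<in>?U. y * (x / y - \<omega>))" by (simp add: prod.distrib)
    also have "\<dots> = (\<Prod>\<omega>\<in>?U. x - \<omega> * y)"
      using False by (intro prod.cong) (auto simp: field_simps)
    finally show ?thesis .
  qed
qed

text \<open>In the factorisation of t^m - t'^m take the smallest factor, at \<omega>. If d separates
  the roots of unity, every other factor is at least d |t'| / 2, for otherwise two distinct
  conjugates of t' would be too close. This gives K = (2/d)^(m-1).\<close>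

lemma nearest_unity_root:
  assumes m: "m > 0"
  shows "\<exists>K>0. \<forall>t t'. \<exists>\<omega>. \<omega> ^ m = 1 \<and> cmod (t - \<omega> * t') * cmod t' ^ (m - 1) \<le> K * cmod (t ^ m - t' ^ m)"
proof -
  let ?U = "{\<omega>::complex. \<omega> ^ m = 1}"
  have fin: "finite ?U" using m by (rule finite_unity_roots)
  have ne: "?U \<noteq> {}" by (auto intro: exI[of _ 1])
  \<comment> \<open>The inserted 1 keeps the minimum defined for m = 1, where there are no pairs of
    distinct roots.\<close>
  let ?D = "insert 1 ((\<lambda>(u,v). cmod (u - v)) ` {(u,v). u \<in> ?U \<and> v \<in> ?U \<and> u \<noteq> v})"
  define d where "d = Min ?D"
  have "finite {(u,v). u \<in> ?U \<and> v \<in> ?U \<and> u \<noteq> v}"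
    by (rule finite_subset[of _ "?U \<times> ?U"]) (use fin in auto)
  then have finD: "finite ?D" by simp
  have d0: "d > 0" unfolding d_def using finD by (subst Min_gr_iff) auto
  have d: "d \<le> cmod (u - v)" if "u \<in> ?U" "v \<in> ?U" "u \<noteq> v" for u v
    unfolding d_def using that by (intro Min_le[OF finD]) (auto intro!: image_eqI[of _ _ "(u,v)"])
  have "\<exists>\<omega>. \<omega> ^ m = 1 \<and> cmod (t - \<omega> * t') * cmod t' ^ (m - 1) \<le> (2/d) ^ (m - 1) * cmod (t ^ m - t' ^ m)" for t t'
  proof -
    obtain \<omega> where \<omega>: "\<omega> \<in> ?U" "\<And>\<omega>'. \<omega>' \<in> ?U \<Longrightarrow> cmod (t - \<omega> * t') \<le> cmod (t - \<omega>' * t')"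
      using ex_is_arg_min_if_finite[OF fin ne, of "\<lambda>\<omega>. cmod (t - \<omega> * t')"]
      unfolding is_arg_min_linorder by blast
    have far: "d / 2 * cmod t' \<le> cmod (t - \<omega>' * t')" if \<omega>': "\<omega>' \<in> ?U - {\<omega>}" for \<omega>'
    proof -
      have "d * cmod t' \<le> cmod (\<omega>' - \<omega>) * cmod t'"
        using \<omega>(1) \<omega>' by (intro mult_right_mono d) auto
      also have "\<dots> = cmod ((t - \<omega> * t') - (t - \<omega>' * t'))"
        by (simp add: norm_mult[symmetric] algebra_simps)
      also have "\<dots> \<le> cmod (t - \<omega> * t') + cmod (t - \<omega>' * t')"
        by (rule norm_triangle_ineq4)
      also have "\<dots> \<le> 2 * cmod (t - \<omega>' * t')" using \<omega>(2)[of \<omega>'] \<omega>' by simp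
      finally show ?thesis by simp
    qed
    have "(d / 2 * cmod t') ^ (m - 1) = (\<Prod>\<omega>'\<in>?U - {\<omega>}. d / 2 * cmod t')"
      using \<omega>(1) m by (simp add: card_roots_unity_eq fin)
    also have "\<dots> \<le> (\<Prod>\<omega>'\<in>?U - {\<omega>}. cmod (t - \<omega>' * t'))"
      using far d0 by (intro prod_mono) auto
    finally have "cmod (t - \<omega> * t') * (d / 2 * cmod t') ^ (m - 1) \<le> cmod (t - \<omega> * t') * \<dots>"
      by (intro mult_left_mono) auto
    also have "\<dots> = cmod (\<Prod>\<omega>'\<in>?U. t - \<omega>' * t')"
      using prod.remove[OF fin \<omega>(1), of "\<lambda>\<omega>'. cmod (t - \<omega>' * t')"] by (simp add: prod_norm)
    also have "\<dots> = cmod (t ^ m - t' ^ m)" by (simp add: prod_unity_roots[OF m])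
    finally have "(2/d) ^ (m - 1) * (cmod (t - \<omega> * t') * (d / 2 * cmod t') ^ (m - 1)) \<le> (2/d) ^ (m - 1) * cmod (t ^ m - t' ^ m)"
      using d0 by (intro mult_left_mono) auto
    moreover have "(2/d) ^ (m - 1) * (cmod (t - \<omega> * t') * (d / 2 * cmod t') ^ (m - 1)) = cmod (t - \<omega> * t') * cmod t' ^ (m - 1)"
      using d0 by (simp add: power_mult_distrib power_divide)
    ultimately show ?thesis using \<omega>(1) by (intro exI[of _ \<omega>] conjI) (simp_all only: mem_Collect_eq)
  qed
  then show ?thesis using d0 by (intro exI[of _ "(2/d) ^ (m - 1)"]) auto
qed

text \<open>A bound on the compact disc of radius R/2 gives a Lipschitz constant on half of that
  disc; the sum of both serves as one common constant.\<close>

lemma holomorphic_locally_lipschitz: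
  fixes g :: "complex \<Rightarrow> complex"
  assumes hol: "g holomorphic_on ball 0 R" and R: "R > 0"
  shows "\<exists>M>0. \<forall>t t'. cmod t < R / 4 \<longrightarrow> cmod t' < R / 4 \<longrightarrow>
     cmod (g t) \<le> M \<and> cmod (g t - g t') \<le> M * cmod (t - t')"
proof -
  have sub: "cball 0 (R/2) \<subseteq> ball (0::complex) R" using R by auto
  then have "compact (g ` cball 0 (R/2))"
    using hol by (intro compact_continuous_image) (auto intro: holomorphic_on_imp_continuous_on holomorphic_on_subset)
  then obtain M where M: "M > 0" "\<And>t. cmod t \<le> R/2 \<Longrightarrow> cmod (g t) \<le> M"
    using compact_imp_bounded[THEN bounded_pos[THEN iffD1], of "g ` cball 0 (R/2)"] by auto
  define L where "L = 4 * M / (R/2)"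
  have L: "L > 0" using M R by (simp add: L_def)
  have lip: "cmod (g t - g t') \<le> L * cmod (t - t')" if "cmod t < R / 4" "cmod t' < R / 4" for t t'
    unfolding L_def
    by (rule bounded_holomorphic_lipschitz)
      (use that M sub hol in \<open>auto intro!: holomorphic_on_subset[of g "ball 0 R"]\<close>)
  have "cmod (g t) \<le> M + L \<and> cmod (g t - g t') \<le> (M + L) * cmod (t - t')"
    if "cmod t < R / 4" "cmod t' < R / 4" for t t'
  proof
    have "cmod (g t) \<le> M" using that R by (intro M) auto
    then show "cmod (g t) \<le> M + L" using L by simp
    have "L * cmod (t - t') \<le> (M + L) * cmod (t - t')" using M by (intro mult_right_mono) auto
    then show "cmod (g t - g t') \<le> (M + L) * cmod (t - t')" using lip[OF that] by linarith
  qed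
  then show ?thesis using M L by (intro exI[of _ "M + L"]) auto
qed

lemma diff_mult_power_le:
  fixes x y :: real
  assumes "0 \<le> x" "x \<le> y" "m > 0"
  shows "(y - x) * x ^ (m - 1) \<le> y ^ m - x ^ m"
proof -
  have "y * x ^ (m - 1) \<le> y * y ^ (m - 1)" using assms by (intro mult_left_mono power_mono) auto
  then have "(y - x) * x ^ (m - 1) \<le> y * y ^ (m - 1) - x * x ^ (m - 1)" by (simp add: algebra_simps)
  then show ?thesis using assms by (simp add: power_eq_if)
qed

text \<open>As a multivalued function of x = t^m, \<psi> is Lipschitz because \<psi> = t^m \<eta>
  with \<eta> Lipschitz: in (t^m - t'^m) \<eta>(t) + t'^m (\<eta>(t) - \<eta>(t')) the second term
  is at most a multiple of |t'|^(m-1) |t - t'|, which the nearest conjugate of t' bounds by |t^m -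
  t'^m|. On a common ray no conjugate has to be chosen.\<close>

lemma multigraph_lipschitz:
  fixes a :: "nat \<Rightarrow> complex"
  assumes sum: "\<And>t. cmod t < \<rho> \<Longrightarrow> summable (\<lambda>j. a j * t ^ j)" and \<rho>: "\<rho> > 0" and m: "m > 0"
    and low: "\<And>j. j < m \<Longrightarrow> a j = 0"
  defines "\<psi> \<equiv> \<lambda>t. \<Sum>j. a j * t ^ j"
  shows "\<exists>r>0. \<exists>K>0. (\<forall>t t'. cmod t < r \<longrightarrow> cmod t' < r \<longrightarrow>
       (\<exists>\<omega>. \<omega> ^ m = 1 \<and> cmod (\<psi> t - \<psi> (\<omega> * t')) \<le> K * cmod (t ^ m - t' ^ m))) \<and>
     (\<forall>x y u. 0 \<le> x \<longrightarrow> x \<le> y \<longrightarrow> y < r \<longrightarrow> cmod u = 1 \<longrightarrow>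
         cmod (\<psi> (of_real y * u) - \<psi> (of_real x * u)) \<le> K * (y ^ m - x ^ m))"
proof -
  obtain \<eta> where \<eta>: "\<eta> holomorphic_on ball 0 \<rho>" "\<eta> 0 = a m"
     "\<And>t. cmod t < \<rho> \<Longrightarrow> \<psi> t = t ^ m * \<eta> t"
    using power_series_factor_power[of \<rho> a m, OF sum \<rho> low] unfolding \<psi>_def by auto
  obtain L where L: "L > 0" "\<And>t t'. cmod t < \<rho> / 4 \<Longrightarrow> cmod t' < \<rho> / 4 \<Longrightarrow>
     cmod (\<eta> t) \<le> L \<and> cmod (\<eta> t - \<eta> t') \<le> L * cmod (t - t')"
    using holomorphic_locally_lipschitz[OF \<eta>(1) \<rho>] by blast
  define r where "r = min 1 (\<rho>/4)"
  have r: "r > 0" "r \<le> 1" "r \<le> \<rho>/4" "r < \<rho>" using \<rho> by (auto simp: r_def)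
  have bd: "cmod (\<eta> t) \<le> L" if "cmod t < r" for t
    using L(2)[of t 0] that r by auto
  have lip: "cmod (\<eta> t - \<eta> t') \<le> L * cmod (t - t')" if "cmod t < r" "cmod t' < r" for t t'
    using L(2)[of t t'] that r by auto
  have base: "cmod (\<psi> t - \<psi> t') \<le> L * cmod (t ^ m - t' ^ m) + L * (cmod (t - t') * cmod t' ^ (m - 1))"
    if t: "cmod t < r" "cmod t' < r" for t t'
  proof -
    have "\<psi> t - \<psi> t' = (t ^ m - t' ^ m) * \<eta> t + t' ^ m * (\<eta> t - \<eta> t')"
      using \<eta>(3)[of t] \<eta>(3)[of t'] t r by (simp add: algebra_simps)
    then have "cmod (\<psi> t - \<psi> t') \<le> cmod (t ^ m - t' ^ m) * cmod (\<eta> t) + cmod t' ^ m * cmod (\<eta> t - \<eta> t')"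
      by (metis norm_mult norm_power norm_triangle_ineq)
    also have "cmod (t ^ m - t' ^ m) * cmod (\<eta> t) \<le> cmod (t ^ m - t' ^ m) * L"
      using bd[of t] t r by (intro mult_left_mono) auto
    also have "cmod t' ^ m * cmod (\<eta> t - \<eta> t') \<le> cmod t' ^ (m - 1) * (L * cmod (t - t'))"
      using lip[OF t] t r by (intro mult_mono power_decreasing) auto
    finally show ?thesis by (simp add: mult_ac)
  qed
  obtain K where K: "K > 0" "\<And>t t'. \<exists>\<omega>. \<omega> ^ m = 1 \<and> cmod (t - \<omega> * t') * cmod t' ^ (m - 1) \<le> K * cmod (t ^ m - t' ^ m)"
    using nearest_unity_root[OF m] by blast
  show ?thesis
  proof (rule exI[of _ r], rule conjI[OF r(1)], rule exI[of _ "L + L * (K + 1)"], intro conjI allI impI)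
    fix t t' :: complex assume t: "cmod t < r" "cmod t' < r"
    obtain \<omega> where \<omega>: "\<omega> ^ m = 1" "cmod (t - \<omega> * t') * cmod t' ^ (m - 1) \<le> K * cmod (t ^ m - t' ^ m)"
      using K(2) by blast
    have n: "cmod (\<omega> * t') = cmod t'" using norm_unity_root[OF m \<omega>(1)] by (simp add: norm_mult)
    have "cmod (\<psi> t - \<psi> (\<omega> * t')) \<le> L * cmod (t ^ m - t' ^ m) + L * (cmod (t - \<omega> * t') * cmod t' ^ (m - 1))"
      using base[of t "\<omega> * t'"] t n \<omega>(1) by (simp add: power_mult_distrib)
    also have "L * (cmod (t - \<omega> * t') * cmod t' ^ (m - 1)) \<le> L * (K * cmod (t ^ m - t' ^ m))"
      using \<omega> L by (intro mult_left_mono) auto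
    also have "\<dots> \<le> L * ((K + 1) * cmod (t ^ m - t' ^ m))"
      using L by (intro mult_left_mono mult_right_mono) auto
    finally show "\<exists>\<omega>. \<omega> ^ m = 1 \<and> cmod (\<psi> t - \<psi> (\<omega> * t')) \<le> (L + L * (K + 1)) * cmod (t ^ m - t' ^ m)"
      using \<omega>(1) by (auto simp: algebra_simps)
  next
    fix x y :: real and u :: complex assume x: "0 \<le> x" "x \<le> y" "y < r" "cmod u = 1"
    have "cmod ((of_real y * u) ^ m - (of_real x * u) ^ m) = cmod (of_real (y ^ m - x ^ m) * u ^ m)"
      by (simp add: power_mult_distrib algebra_simps)
    also have "\<dots> = y ^ m - x ^ m"
      using x power_mono[of x y m] by (simp only: norm_mult norm_power norm_of_real) simp
    finally have 1: "cmod ((of_real y * u) ^ m - (of_real x * u) ^ m) = y ^ m - x ^ m" .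
    have "cmod (of_real y * u - of_real x * u) = cmod (of_real (y - x) * u)" by (simp add: algebra_simps)
    also have "\<dots> = y - x" using x by (simp only: norm_mult norm_of_real) simp
    finally have 2: "cmod (of_real y * u - of_real x * u) = y - x" .
    have 3: "(y - x) * x ^ (m - 1) \<le> y ^ m - x ^ m" using x m by (intro diff_mult_power_le)
    have "cmod (\<psi> (of_real y * u) - \<psi> (of_real x * u)) \<le> L * (y ^ m - x ^ m) + L * ((y - x) * x ^ (m - 1))"
      using base[of "of_real y * u" "of_real x * u"] x 1 2 by (simp add: norm_mult)
    also have "L * ((y - x) * x ^ (m - 1)) \<le> L * ((K + 1) * (y ^ m - x ^ m))"
      using 3 K L x power_mono[of x y m] by (intro mult_left_mono order_trans[OF 3]) (auto simp: mult_le_cancel_right1)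
    finally show "cmod (\<psi> (of_real y * u) - \<psi> (of_real x * u)) \<le> (L + L * (K + 1)) * (y ^ m - x ^ m)"
      by (simp add: algebra_simps)
  qed (use r L K in \<open>auto intro!: add_pos_pos mult_pos_pos\<close>)
qed

subsection \<open>The Puiseux characteristic\<close>

lemma puiseux_char_dvd:
  assumes "puiseux_char m a s \<beta> e" "i \<le> j" "j \<le> s"
  shows "e j dvd e i"
  using assms(2,3)
proof (induction j rule: dec_induct)
  case (step j)
  then have "e (Suc j) = gcd (e j) (\<beta> (Suc j))"
    using assms(1) by (auto simp: puiseux_char_def)
  then have "e (Suc j) dvd e j" by simp
  then show ?case using step dvd_trans by auto
qed simp

lemma puiseux_char_pos:
  assumes "puiseux_char m a s \<beta> e" "m > 0" "i \<le> s"
  shows "e i > 0"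
proof -
  have "e i dvd e 0" using assms by (intro puiseux_char_dvd) auto
  then show ?thesis using assms by (auto simp: puiseux_char_def intro: dvd_pos_nat)
qed

lemma puiseux_char_least:
  assumes "puiseux_char m a s \<beta> e" "i < s"
  shows "a (\<beta> (Suc i)) \<noteq> 0" "\<not> e i dvd \<beta> (Suc i)" "\<And>j. j < \<beta> (Suc i) \<Longrightarrow> a j \<noteq> 0 \<Longrightarrow> e i dvd j"
proof -
  have b: "\<exists>j. a j \<noteq> 0 \<and> \<not> e i dvd j" "\<beta> (Suc i) = (LEAST j. a j \<noteq> 0 \<and> \<not> e i dvd j)"
    using assms by (auto simp: puiseux_char_def)
  show "a (\<beta> (Suc i)) \<noteq> 0" "\<not> e i dvd \<beta> (Suc i)"
    using LeastI_ex[OF b(1)] by (auto simp: b(2))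
  show "e i dvd j" if "j < \<beta> (Suc i)" "a j \<noteq> 0" for j
    using that not_less_Least[of j "\<lambda>j. a j \<noteq> 0 \<and> \<not> e i dvd j"] by (auto simp: b(2))
qed

text \<open>An exponent below \<beta>_(i+1) with nonzero coefficient is divisible by e_i, hence by
  e_j; but e_j does not divide \<beta>_(j+1).\<close>

lemma puiseux_char_mono:
  assumes "puiseux_char m a s \<beta> e" "i \<le> j" "j < s"
  shows "\<beta> (Suc i) \<le> \<beta> (Suc j)"
proof (rule ccontr)
  assume "\<not> ?thesis"
  then have "e i dvd \<beta> (Suc j)"
    using assms puiseux_char_least[OF assms(1), of i] puiseux_char_least(1)[OF assms(1), of j] by auto
  moreover have "e j dvd e i" using assms by (intro puiseux_char_dvd) auto
  ultimately show False using puiseux_char_least(2)[OF assms(1,3)] dvd_trans by blast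
qed

lemma unity_root_gcd:
  fixes \<omega> :: "'a :: monoid_mult"
  assumes "\<omega> ^ p = 1" "\<omega> ^ q = 1"
  shows "\<omega> ^ gcd p q = 1"
proof (cases "p = 0")
  case False
  obtain x y where "p * x = q * y + gcd p q" using bezout_nat[OF False] by blast
  then have "(\<omega> ^ p) ^ x = (\<omega> ^ q) ^ y * \<omega> ^ gcd p q"
    by (simp flip: power_mult power_add)
  then show ?thesis using assms by simp
qed (use assms in simp)

text \<open>The groups of e_i-th roots of unity decrease from all m-th roots to the trivial group,
  since e_0 = m and e_s = 1; a nontrivial root leaves the chain at exactly one step.\<close>

lemma puiseux_char_level:
  fixes \<omega> :: complex
  assumes "puiseux_char m a s \<beta> e" "\<omega> ^ m = 1" "\<omega> \<noteq> 1"
  shows "\<exists>i<s. \<omega> ^ e i = 1 \<and> \<omega> ^ e (Suc i) \<noteq> 1"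
proof -
  define n where "n = (LEAST n. \<omega> ^ e n \<noteq> 1)"
  have "\<omega> ^ e s \<noteq> 1" using assms by (simp add: puiseux_char_def)
  then have n: "\<omega> ^ e n \<noteq> 1" "n \<le> s"
    unfolding n_def by (rule LeastI[of "\<lambda>n. \<omega> ^ e n \<noteq> 1"], rule Least_le)
  have "n \<noteq> 0"
  proof
    assume "n = 0"
    with n(1) show False using assms(1,2) by (simp add: puiseux_char_def)
  qed
  then obtain i where i: "n = Suc i" using not0_implies_Suc by blast
  have "\<omega> ^ e i = 1"
    using not_less_Least[of i "\<lambda>n. \<omega> ^ e n \<noteq> 1"] i by (simp add: n_def)
  then show ?thesis using i n by (intro exI[of _ i]) auto
qed

text \<open>a_j (1 - \<omega>^j) are the coefficients of \<psi>(t) - \<psi>(\<omega> t). Below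
  \<beta>_(i+1) all exponents of \<psi> are multiples of e_i; at \<beta>_(i+1) itself,
  \<omega>^\<beta> = 1 would give \<omega>^gcd(e_i, \<beta>) = 1, that is \<omega>^(e_(i+1)) =
  1.\<close>

lemma puiseux_char_conjugate_order:
  fixes \<omega> :: complex
  assumes "puiseux_char m a s \<beta> e" "i < s" "\<omega> ^ e i = 1" "\<omega> ^ e (Suc i) \<noteq> 1"
  shows "\<And>j. j < \<beta> (Suc i) \<Longrightarrow> a j * (1 - \<omega> ^ j) = 0" "a (\<beta> (Suc i)) * (1 - \<omega> ^ \<beta> (Suc i)) \<noteq> 0"
proof -
  show "a j * (1 - \<omega> ^ j) = 0" if j: "j < \<beta> (Suc i)" for j
  proof (cases "a j = 0")
    case False
    then obtain l where "j = e i * l" using puiseux_char_least(3)[OF assms(1,2) j] by blast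
    then show ?thesis using assms(3) by (simp add: power_mult)
  qed simp
  have "e (Suc i) = gcd (e i) (\<beta> (Suc i))" using assms(1,2) by (auto simp: puiseux_char_def)
  then have "\<omega> ^ \<beta> (Suc i) \<noteq> 1" using unity_root_gcd[of \<omega> "e i" "\<beta> (Suc i)"] assms(3,4) by auto
  then show "a (\<beta> (Suc i)) * (1 - \<omega> ^ \<beta> (Suc i)) \<noteq> 0"
    using puiseux_char_least(1)[OF assms(1,2)] by simp
qed

text \<open>Telescopes along the chain of groups: passing from the e_i-th to the e_(i+1)-th roots
  removes e_i - e_(i+1) elements, all with the same value D i, and e_k elements with value c
  remain.\<close>

lemma puiseux_char_sum:
  fixes d :: "complex \<Rightarrow> real"
  assumes pc: "puiseux_char m a s \<beta> e" and m: "m > 0" and k: "k \<le> s"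
    and c: "\<And>\<omega>. \<omega> ^ e k = 1 \<Longrightarrow> d \<omega> = c"
    and D: "\<And>i \<omega>. i < k \<Longrightarrow> \<omega> ^ e i = 1 \<Longrightarrow> \<omega> ^ e (Suc i) \<noteq> 1 \<Longrightarrow> d \<omega> = D i"
  shows "(\<Sum>\<omega> | \<omega> ^ m = 1. d \<omega>) = real (e k) * c + (\<Sum>i<k. (real (e i) - real (e (Suc i))) * D i)"
proof -
  let ?U = "\<lambda>i. {\<omega>::complex. \<omega> ^ e i = 1}"
  have fin: "finite (?U i)" "card (?U i) = e i" if "i \<le> s" for i
    using puiseux_char_pos[OF pc m that] by (auto simp: card_roots_unity_eq finite_unity_roots)
  have "(\<Sum>\<omega>\<in>?U 0. d \<omega>) = (\<Sum>\<omega>\<in>?U n. d \<omega>) + (\<Sum>i<n. (real (e i) - real (e (Suc i))) * D i)" if "n \<le> k" for n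
    using that
  proof (induction n)
    case (Suc n)
    have le: "n \<le> s" "Suc n \<le> s" "n < k" using Suc k by auto
    obtain l where "e n = e (Suc n) * l" using puiseux_char_dvd[OF pc, of n "Suc n"] le by auto
    then have sub: "?U (Suc n) \<subseteq> ?U n" by (auto simp: power_mult)
    have "(\<Sum>\<omega>\<in>?U n. d \<omega>) = (\<Sum>\<omega>\<in>?U n - ?U (Suc n). d \<omega>) + (\<Sum>\<omega>\<in>?U (Suc n). d \<omega>)"
      using fin(1)[OF le(1)] sub by (rule sum.subset_diff[rotated])
    also have "(\<Sum>\<omega>\<in>?U n - ?U (Suc n). d \<omega>) = (\<Sum>\<omega>\<in>?U n - ?U (Suc n). D n)"
      using D[OF le(3)] by (intro sum.cong) auto
    also have "\<dots> = real (card (?U n) - card (?U (Suc n))) * D n"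
      using sub fin(1)[OF le(2)] by (simp add: card_Diff_subset)
    also have "\<dots> = (real (e n) - real (e (Suc n))) * D n"
      using fin le card_mono[OF fin(1)[OF le(1)] sub] by (simp add: of_nat_diff)
    finally show ?case using Suc by simp
  qed simp
  from this[of k] have "(\<Sum>\<omega>\<in>?U 0. d \<omega>) = (\<Sum>\<omega>\<in>?U k. d \<omega>) + (\<Sum>i<k. (real (e i) - real (e (Suc i))) * D i)" by simp
  moreover have "(\<Sum>\<omega>\<in>?U k. d \<omega>) = (\<Sum>\<omega>\<in>?U k. c)" using c by (intro sum.cong) auto
  then have "(\<Sum>\<omega>\<in>?U k. d \<omega>) = real (e k) * c" using fin(2)[OF k] by simp
  moreover have "e 0 = m" using pc by (simp add: puiseux_char_def)
  ultimately show ?thesis by simp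
qed

subsection \<open>Logarithmic order\<close>

text \<open>This is the shape of \<open>has_contact\<close>, for an arbitrary function. Eventual
  positivity is included because the logarithm says nothing about a function that vanishes.\<close>

definition log_order :: "(real \<Rightarrow> real) \<Rightarrow> real \<Rightarrow> bool" where
  "log_order u c \<longleftrightarrow> (\<forall>\<^sub>F t in at_right 0. u t > 0) \<and> ((\<lambda>t. ln (u t) / ln t) \<longlongrightarrow> c) (at_right 0)"

lemma log_orderD: "log_order u c \<Longrightarrow> \<forall>\<^sub>F t in at_right 0. u t > 0"
  by (simp add: log_order_def)

lemma eventually_at_right_unit_interval: "\<forall>\<^sub>F t::real in at_right 0. 0 < t \<and> t < 1"
  unfolding eventually_at_right_field by (intro exI[of _ 1]) auto

lemma const_div_ln_tendsto_0: "((\<lambda>t. C / ln t) \<longlongrightarrow> (0::real)) (at_right 0)"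
  by (rule tendsto_divide_0[OF tendsto_const]) (rule filterlim_at_bot_imp_at_infinity[OF ln_at_0])

text \<open>Constant factors contribute ln A / ln t, which tends to 0. Since ln t < 0, the upper
  bound on v gives the lower bound on the quotient and conversely.\<close>

lemma log_order_squeeze:
  assumes u: "log_order u c" and w: "log_order w c" and AB: "A > 0" "B > 0"
    and le: "\<forall>\<^sub>F t in at_right 0. A * u t \<le> v t \<and> v t \<le> B * w t"
  shows "log_order v c"
proof -
  have ev: "\<forall>\<^sub>F t in at_right 0. u t > 0 \<and> w t > 0 \<and> A * u t \<le> v t \<and> v t \<le> B * w t \<and> 0 < t \<and> t < 1"
    using log_orderD[OF u] log_orderD[OF w] le eventually_at_right_unit_interval by eventually_elim auto
  have pos: "\<forall>\<^sub>F t in at_right 0. v t > 0"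
    using ev
  proof eventually_elim
    case (elim t)
    then have "0 < A * u t" using AB by simp
    then show ?case using elim by linarith
  qed
  have "((\<lambda>t. ln (v t) / ln t) \<longlongrightarrow> c) (at_right 0)"
  proof (rule tendsto_sandwich)
    show "\<forall>\<^sub>F t in at_right 0. ln B / ln t + ln (w t) / ln t \<le> ln (v t) / ln t"
      using ev pos
    proof eventually_elim
      case (elim t)
      then have "ln (v t) \<le> ln (B * w t)" by simp
      also have "\<dots> = ln B + ln (w t)" using elim AB by (simp add: ln_mult)
      finally show ?case using elim by (simp add: add_divide_distrib[symmetric] divide_right_mono_neg)
    qed
    show "\<forall>\<^sub>F t in at_right 0. ln (v t) / ln t \<le> ln A / ln t + ln (u t) / ln t"
      using ev pos
    proof eventually_elim
      case (elim t)
      then have "ln (A * u t) \<le> ln (v t)" using AB by simp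
      moreover have "ln (A * u t) = ln A + ln (u t)" using elim AB by (simp add: ln_mult)
      ultimately show ?case using elim by (simp add: add_divide_distrib[symmetric] divide_right_mono_neg)
    qed
    show "((\<lambda>t. ln B / ln t + ln (w t) / ln t) \<longlongrightarrow> c) (at_right 0)"
      using tendsto_add[OF const_div_ln_tendsto_0, of "\<lambda>t. ln (w t) / ln t" c] w by (simp add: log_order_def)
    show "((\<lambda>t. ln A / ln t + ln (u t) / ln t) \<longlongrightarrow> c) (at_right 0)"
      using tendsto_add[OF const_div_ln_tendsto_0, of "\<lambda>t. ln (u t) / ln t" c] u by (simp add: log_order_def)
  qed
  with pos show ?thesis by (simp add: log_order_def)
qed

lemma log_order_ident: "log_order (\<lambda>t. t) 1"
proof -
  have "\<forall>\<^sub>F t::real in at_right 0. ln t / ln t = 1"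
    using eventually_at_right_unit_interval by eventually_elim auto
  then show ?thesis
    using eventually_at_right_unit_interval
    by (auto simp: log_order_def tendsto_eventually elim: eventually_mono)
qed

text \<open>A maximum of functions turns into a minimum of exponents because ln t is
  negative.\<close>

lemma log_order_max:
  assumes "log_order u c" "log_order v d"
  shows "log_order (\<lambda>t. max (u t) (v t)) (min c d)"
proof -
  have ev: "\<forall>\<^sub>F t in at_right 0. u t > 0 \<and> v t > 0 \<and> 0 < t \<and> t < 1"
    using assms[THEN log_orderD] eventually_at_right_unit_interval by eventually_elim auto
  have "((\<lambda>t. min (ln (u t) / ln t) (ln (v t) / ln t)) \<longlongrightarrow> min c d) (at_right 0)"
    using assms by (intro tendsto_min) (auto simp: log_order_def)
  moreover have "\<forall>\<^sub>F t in at_right 0. min (ln (u t) / ln t) (ln (v t) / ln t) = ln (max (u t) (v t)) / ln t"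
    using ev
  proof eventually_elim
    case (elim t)
    then have t: "ln t < 0" by simp
    show ?case
    proof (cases "u t \<le> v t")
      case True
      then have "ln (v t) / ln t \<le> ln (u t) / ln t" using t elim by (intro divide_right_mono_neg) auto
      then show ?thesis using True by (simp add: min_absorb2 max_absorb2)
    next
      case False
      then have "ln (u t) / ln t \<le> ln (v t) / ln t" using t elim by (intro divide_right_mono_neg) auto
      then show ?thesis using False by (simp add: min_absorb1 max_absorb1)
    qed
  qed
  ultimately have "((\<lambda>t. ln (max (u t) (v t)) / ln t) \<longlongrightarrow> min c d) (at_right 0)"
    by (rule Lim_transform_eventually)
  then show ?thesis using ev by (auto simp: log_order_def less_max_iff_disj elim: eventually_mono)
qed

lemma log_order_power:
  assumes "log_order u c"
  shows "log_order (\<lambda>t. u t ^ n) (real n * c)"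
proof -
  have "((\<lambda>t. real n * (ln (u t) / ln t)) \<longlongrightarrow> real n * c) (at_right 0)"
    using assms by (intro tendsto_intros) (auto simp: log_order_def)
  moreover have "\<forall>\<^sub>F t in at_right 0. real n * (ln (u t) / ln t) = ln (u t ^ n) / ln t"
    using assms unfolding log_order_def by (auto simp: ln_realpow elim: eventually_mono)
  ultimately have "((\<lambda>t. ln (u t ^ n) / ln t) \<longlongrightarrow> real n * c) (at_right 0)"
    by (rule Lim_transform_eventually)
  then show ?thesis using assms by (auto simp: log_order_def elim: eventually_mono)
qed

lemma log_order_root:
  assumes "log_order (\<lambda>t. u t ^ n) c" "n > 0" "\<And>t. u t \<ge> 0"
  shows "log_order u (c / real n)"
proof -
  have ev: "\<forall>\<^sub>F t in at_right 0. u t > 0"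
    using assms(1) unfolding log_order_def
    by (auto elim!: eventually_mono simp: zero_less_power_eq) (metis assms(2,3) less_le power_0_left less_irrefl)+
  have "((\<lambda>t. ln (u t ^ n) / ln t / real n) \<longlongrightarrow> c / real n) (at_right 0)"
    using assms by (intro tendsto_intros) (auto simp: log_order_def)
  moreover have "\<forall>\<^sub>F t in at_right 0. ln (u t ^ n) / ln t / real n = ln (u t) / ln t"
    using ev by eventually_elim (use assms(2) in \<open>auto simp: ln_realpow\<close>)
  ultimately have "((\<lambda>t. ln (u t) / ln t) \<longlongrightarrow> c / real n) (at_right 0)"
    by (rule Lim_transform_eventually)
  then show ?thesis using ev by (simp add: log_order_def)
qed

lemma log_order_prod:
  assumes "finite I" "\<And>i. i \<in> I \<Longrightarrow> log_order (u i) (c i)"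
  shows "log_order (\<lambda>t. \<Prod>i\<in>I. u i t) (\<Sum>i\<in>I. c i)"
proof -
  have ev: "\<forall>\<^sub>F t in at_right 0. \<forall>i\<in>I. u i t > 0"
    using assms by (intro eventually_ball_finite) (auto simp: log_order_def)
  have "((\<lambda>t. \<Sum>i\<in>I. ln (u i t) / ln t) \<longlongrightarrow> (\<Sum>i\<in>I. c i)) (at_right 0)"
    using assms(2) by (intro tendsto_sum) (auto simp: log_order_def)
  moreover have "\<forall>\<^sub>F t in at_right 0. (\<Sum>i\<in>I. ln (u i t) / ln t) = ln (\<Prod>i\<in>I. u i t) / ln t"
    using ev by eventually_elim (subst ln_prod, use assms(1) in \<open>auto simp: sum_divide_distrib\<close>)
  ultimately have "((\<lambda>t. ln (\<Prod>i\<in>I. u i t) / ln t) \<longlongrightarrow> (\<Sum>i\<in>I. c i)) (at_right 0)"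
    by (rule Lim_transform_eventually)
  then show ?thesis using ev by (auto simp: log_order_def intro: prod_pos elim!: eventually_mono)
qed

lemma log_order_unique:
  assumes "log_order u c" "log_order u d"
  shows "c = d"
  using assms tendsto_unique[OF trivial_limit_at_right_real] unfolding log_order_def by blast

text \<open>A strictly larger exponent beats every constant, however small \<epsilon> is, because ln
  \<epsilon> / ln t tends to 0 while the exponents keep a positive gap.\<close>

lemma log_order_less:
  assumes u: "log_order u c" and v: "log_order v d" and less: "d < c" and \<epsilon>: "\<epsilon> > 0"
  shows "\<forall>\<^sub>F t in at_right 0. u t \<le> \<epsilon> * v t"
proof -
  have "((\<lambda>t. ln (u t) / ln t - ln (v t) / ln t - ln \<epsilon> / ln t) \<longlongrightarrow> c - d - 0) (at_right 0)"
    using u v by (intro tendsto_diff const_div_ln_tendsto_0) (auto simp: log_order_def)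
  then have "\<forall>\<^sub>F t in at_right 0. 0 < ln (u t) / ln t - ln (v t) / ln t - ln \<epsilon> / ln t"
    using less by (intro order_tendstoD(1)) auto
  moreover have "\<forall>\<^sub>F t in at_right 0. u t > 0" "\<forall>\<^sub>F t in at_right 0. v t > 0"
    using u v by (auto simp: log_order_def)
  ultimately show ?thesis using eventually_at_right_unit_interval
  proof eventually_elim
    case (elim t)
    then have "0 < (ln (u t) - ln (v t) - ln \<epsilon>) / ln t" by (simp add: diff_divide_distrib)
    moreover have "ln t < 0" using elim by simp
    ultimately have "ln (u t) - ln (v t) - ln \<epsilon> < 0" by (simp add: zero_less_divide_iff)
    then have "ln (u t) < ln (\<epsilon> * v t)" using elim \<epsilon> by (simp add: ln_mult)
    then show ?case using elim \<epsilon> by simp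
  qed
qed

subsection \<open>Distance to a parametrised curve\<close>

lemma norm_Pair_ge: "cmod x \<le> norm (x, y :: complex)" "cmod y \<le> norm (x :: complex, y)"
  by (simp_all add: norm_fst_le norm_snd_le)

text \<open>Three radii are needed: \<open>\<rho>\<close>, for the parameter, depends on the radius \<open>r\<close> of the chart, and \<open>\<sigma>\<close>, for
  points of the curve, depends on \<open>\<rho>\<close>.\<close>

locale curve_chart =
  fixes \<Phi> \<Theta> :: "complex \<times> complex \<Rightarrow> complex \<times> complex" and \<psi> :: "complex \<Rightarrow> complex"
    and m :: nat and X :: "(complex \<times> complex) set" and r \<rho> \<sigma> L K :: real
  assumes m: "m > 0" and r: "0 < r" and \<rho>: "0 < \<rho>" "\<rho> \<le> 1" and \<sigma>: "0 < \<sigma>" and L: "L > 0" and K: "K > 0"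
    and \<Phi>0: "\<Phi> 0 = 0" and \<Theta>0: "\<Theta> 0 = 0"
    and \<Phi>_lip: "\<And>p q. norm p < r \<Longrightarrow> norm q < r \<Longrightarrow> norm (\<Phi> p - \<Phi> q) \<le> L * norm (p - q)"
    and \<Theta>_lip: "\<And>p q. norm p < r \<Longrightarrow> norm q < r \<Longrightarrow> norm (\<Theta> p - \<Theta> q) \<le> L * norm (p - q)"
    and \<Theta>\<Phi>: "\<And>p. norm p < r \<Longrightarrow> \<Theta> (\<Phi> p) = p"
    and \<Phi>\<Theta>: "\<And>p. norm p < r \<Longrightarrow> \<Phi> (\<Theta> p) = p"
    and \<psi>_bound: "\<And>t. cmod t < \<rho> \<Longrightarrow> cmod (\<psi> t) \<le> K * cmod t ^ Suc m"
    and \<psi>_lip: "\<And>t t'. cmod t < \<rho> \<Longrightarrow> cmod t' < \<rho> \<Longrightarrow>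
       \<exists>\<omega>. \<omega> ^ m = 1 \<and> cmod (\<psi> t - \<psi> (\<omega> * t')) \<le> K * cmod (t ^ m - t' ^ m)"
    and \<psi>_radial: "\<And>x y u. 0 \<le> x \<Longrightarrow> x \<le> y \<Longrightarrow> y < \<rho> \<Longrightarrow> cmod u = 1 \<Longrightarrow>
         cmod (\<psi> (of_real y * u) - \<psi> (of_real x * u)) \<le> K * (y ^ m - x ^ m)"
    and hol: "(\<lambda>t. fst (\<Phi> (t ^ m, \<psi> t))) holomorphic_on ball 0 \<rho>"
       "(\<lambda>t. snd (\<Phi> (t ^ m, \<psi> t))) holomorphic_on ball 0 \<rho>"
    and curve_in: "\<And>t. cmod t < \<rho> \<Longrightarrow> \<Phi> (t ^ m, \<psi> t) \<in> X"
    and in_curve: "\<And>q. q \<in> X \<Longrightarrow> norm q < \<sigma> \<Longrightarrow> \<exists>t. cmod t < \<rho> \<and> \<Theta> q = (t ^ m, \<psi> t)"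
    and dom_small: "\<And>t. cmod t < \<rho> \<Longrightarrow> norm (\<Phi> (t ^ m, \<psi> t)) < r \<and> norm (t ^ m, \<psi> t) < r"
begin

definition \<gamma> :: "complex \<Rightarrow> complex \<times> complex" where "\<gamma> t = \<Phi> (t ^ m, \<psi> t)"

lemma \<Theta>_norm: "norm p < r \<Longrightarrow> norm (\<Theta> p) \<le> L * norm p"
  using \<Theta>_lip[of p 0] r \<Theta>0 by simp

lemma \<Phi>_norm: "norm p < r \<Longrightarrow> norm (\<Phi> p) \<le> L * norm p"
  using \<Phi>_lip[of p 0] r \<Phi>0 by simp

lemma norm_param_le:
  assumes t: "cmod t < \<rho>"
  shows "norm (t ^ m, \<psi> t) \<le> (1 + K) * cmod t ^ m"
proof -
  have "cmod (\<psi> t) \<le> K * cmod t ^ Suc m" using t by (rule \<psi>_bound)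
  also have "\<dots> \<le> K * cmod t ^ m" using K t \<rho> by (intro mult_left_mono power_decreasing) auto
  finally show ?thesis using norm_Pair_le[of "t ^ m" "\<psi> t"] by (simp add: norm_power algebra_simps)
qed

text \<open>Only |\<tau>|^m, the modulus of the first chart coordinate, enters, so the bound holds
  for whichever m-th root has been chosen.\<close>

lemma root_small:
  assumes p: "norm p < r" "norm p < d ^ m / L" and \<Theta>: "\<Theta> p = (\<tau> ^ m, y)" and d: "d > 0"
  shows "cmod \<tau> < d"
proof -
  have "cmod \<tau> ^ m \<le> norm (\<Theta> p)" unfolding \<Theta> using norm_Pair_ge(1)[of "\<tau> ^ m" y] by (simp add: norm_power)
  also have "\<dots> \<le> L * norm p" by (rule \<Theta>_norm[OF p(1)])
  also have "\<dots> < d ^ m" using p(2) L by (simp add: field_simps)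
  finally show ?thesis using d power_less_imp_less_base[of "cmod \<tau>" m d] by simp
qed

text \<open>With \<Theta> q = (t^m, \<psi> t), the height y is within |y - \<psi>(t)| + |\<psi>(t) -
  \<psi>(\<omega> \<tau>)| of a branch over the first coordinate of \<Theta> p. Both terms are
  controlled by |\<Theta> p - \<Theta> q|, the second by the Lipschitz property of the multigraph.
  The point q may lie on any sphere.\<close>

lemma dist_lower:
  "\<exists>r1>0. \<exists>\<kappa>>0. \<forall>p q \<tau> y \<delta>. norm p < r1 \<longrightarrow> norm q < r1 \<longrightarrow> q \<in> X \<longrightarrow> \<Theta> p = (\<tau> ^ m, y) \<longrightarrow>
     (\<forall>\<omega>. \<omega> ^ m = 1 \<longrightarrow> \<delta> \<le> cmod (y - \<psi> (\<omega> * \<tau>))) \<longrightarrow> \<kappa> * \<delta> \<le> norm (p - q)"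
proof -
  define r1 where "r1 = Min {r, \<sigma>, \<rho> ^ m / L}"
  have r1: "r1 > 0" "r1 \<le> r" "r1 \<le> \<sigma>" "r1 \<le> \<rho> ^ m / L" using r \<rho> \<sigma> L by (auto simp: r1_def)
  have main: "\<delta> \<le> (1 + K) * L * norm (p - q)" if p: "norm p < r1" and q: "norm q < r1" "q \<in> X" and \<Theta>: "\<Theta> p = (\<tau> ^ m, y)"
     and \<delta>: "\<And>\<omega>. \<omega> ^ m = 1 \<Longrightarrow> \<delta> \<le> cmod (y - \<psi> (\<omega> * \<tau>))" for p q \<tau> y \<delta>
  proof -
    have \<tau>: "cmod \<tau> < \<rho>" using p \<rho> r1 by (intro root_small[OF _ _ \<Theta>]) auto
    obtain t where t: "cmod t < \<rho>" "\<Theta> q = (t ^ m, \<psi> t)" using in_curve[of q] q r1 by auto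
    obtain \<omega> where \<omega>: "\<omega> ^ m = 1" "cmod (\<psi> t - \<psi> (\<omega> * \<tau>)) \<le> K * cmod (t ^ m - \<tau> ^ m)"
      using \<psi>_lip[OF t(1) \<tau>] by blast
    have n: "norm (\<Theta> p - \<Theta> q) \<le> L * norm (p - q)" using p q r1 by (intro \<Theta>_lip) auto
    have n1: "cmod (t ^ m - \<tau> ^ m) \<le> norm (\<Theta> p - \<Theta> q)" "cmod (y - \<psi> t) \<le> norm (\<Theta> p - \<Theta> q)"
      using norm_Pair_ge(1)[of "\<tau> ^ m - t ^ m" "y - \<psi> t"] norm_Pair_ge(2)[of "y - \<psi> t" "\<tau> ^ m - t ^ m"]
      by (auto simp: \<Theta> t norm_minus_commute)
    have "\<delta> \<le> cmod (y - \<psi> (\<omega> * \<tau>))" using \<delta> \<omega> by blast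
    also have "\<dots> \<le> cmod (y - \<psi> t) + cmod (\<psi> t - \<psi> (\<omega> * \<tau>))"
      using norm_triangle_ineq[of "y - \<psi> t" "\<psi> t - \<psi> (\<omega> * \<tau>)"] by simp
    also have "\<dots> \<le> norm (\<Theta> p - \<Theta> q) + K * norm (\<Theta> p - \<Theta> q)"
      using n1 \<omega>(2) K by (intro add_mono order_trans[OF \<omega>(2)] mult_left_mono) auto
    also have "\<dots> = (1 + K) * norm (\<Theta> p - \<Theta> q)" by (simp add: algebra_simps)
    also have "\<dots> \<le> (1 + K) * (L * norm (p - q))" using n K by (intro mult_left_mono) auto
    finally show ?thesis by (simp add: mult.assoc)
  qed
  define \<kappa> where "\<kappa> = 1 / ((1 + K) * L)"
  have pos: "(1 + K) * L > 0" using K L by simp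
  have \<kappa>: "\<kappa> > 0" using pos by (simp add: \<kappa>_def)
  have "\<kappa> * \<delta> \<le> norm (p - q)" if "norm p < r1" "norm q < r1" "q \<in> X" "\<Theta> p = (\<tau> ^ m, y)"
     "\<forall>\<omega>. \<omega> ^ m = 1 \<longrightarrow> \<delta> \<le> cmod (y - \<psi> (\<omega> * \<tau>))" for p q \<tau> y \<delta>
  proof -
    have "\<delta> \<le> (1 + K) * L * norm (p - q)" using that by (intro main) auto
    then show ?thesis using pos by (simp add: \<kappa>_def pos_divide_le_eq mult.commute)
  qed
  then show ?thesis
    by (intro exI[of _ r1] conjI[OF r1(1)] exI[of _ \<kappa>] conjI[OF \<kappa>] allI impI)
qed

text \<open>Both coordinates of \<gamma> are O(|t|^m), since \<Phi> is Lipschitz and fixes 0, so t^m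
  can be divided out of each.\<close>

lemma \<gamma>_factor:
  "\<exists>h1 h2. h1 holomorphic_on ball 0 \<rho> \<and> h2 holomorphic_on ball 0 \<rho> \<and>
     (\<forall>t. cmod t < \<rho> \<longrightarrow> \<gamma> t = (t ^ m * h1 t, t ^ m * h2 t))"
proof -
  have bd: "norm (\<gamma> t) \<le> L * (1 + K) * cmod t ^ m" if "cmod t < \<rho>" for t
  proof -
    have "norm (\<gamma> t) \<le> L * norm (t ^ m, \<psi> t)"
      unfolding \<gamma>_def using dom_small[OF that] by (intro \<Phi>_norm) auto
    also have "\<dots> \<le> L * ((1 + K) * cmod t ^ m)" using L norm_param_le[OF that] by (intro mult_left_mono) auto
    finally show ?thesis by (simp add: mult.assoc)
  qed
  have bd1: "cmod (fst (\<gamma> t)) \<le> L * (1 + K) * cmod t ^ m" if "cmod t < \<rho>" for t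
    using bd[OF that] norm_Pair_ge(1)[of "fst (\<gamma> t)" "snd (\<gamma> t)"] by simp
  have bd2: "cmod (snd (\<gamma> t)) \<le> L * (1 + K) * cmod t ^ m" if "cmod t < \<rho>" for t
    using bd[OF that] norm_Pair_ge(2)[of "snd (\<gamma> t)" "fst (\<gamma> t)"] by simp
  obtain h1 where h1: "h1 holomorphic_on ball 0 \<rho>" "\<forall>t\<in>ball 0 \<rho>. fst (\<gamma> t) = t ^ m * h1 t"
    using holomorphic_divide_power[of "\<lambda>t. fst (\<gamma> t)" \<rho> "L * (1 + K)" m] hol bd1 \<rho> by (auto simp: \<gamma>_def)
  obtain h2 where h2: "h2 holomorphic_on ball 0 \<rho>" "\<forall>t\<in>ball 0 \<rho>. snd (\<gamma> t) = t ^ m * h2 t"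
    using holomorphic_divide_power[of "\<lambda>t. snd (\<gamma> t)" \<rho> "L * (1 + K)" m] hol bd2 \<rho> by (auto simp: \<gamma>_def)
  show ?thesis using h1 h2 by (intro exI[of _ h1] exI[of _ h2]) (auto simp: prod_eq_iff)
qed

lemma \<gamma>_lower: "cmod t < \<rho> \<Longrightarrow> cmod t ^ m \<le> L * norm (\<gamma> t)"
  using \<Theta>_norm[of "\<gamma> t"] dom_small[of t] \<Theta>\<Phi>[of "(t ^ m, \<psi> t)"] norm_Pair_ge(1)[of "t ^ m" "\<psi> t"]
  by (simp add: \<gamma>_def norm_power)

text \<open>Writing \<open>\<gamma> t = t^m \<eta>(t)\<close> with \<open>\<eta>\<close> Lipschitz and bounded away from \<open>0\<close>, the
  growth of \<open>|t|^m\<close> along a ray dominates the variation of \<open>|\<eta>|\<close>.\<close>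

lemma radial_growth:
  "\<exists>r2>0. r2 \<le> \<rho> \<and> (\<exists>c>0. \<forall>x y u. 0 \<le> x \<longrightarrow> x \<le> y \<longrightarrow> y < r2 \<longrightarrow> cmod u = 1 \<longrightarrow>
      c * (y ^ m - x ^ m) \<le> norm (\<gamma> (of_real y * u)) - norm (\<gamma> (of_real x * u)))"
proof -
  obtain h1 h2 where h: "h1 holomorphic_on ball 0 \<rho>" "h2 holomorphic_on ball 0 \<rho>"
     "\<And>t. cmod t < \<rho> \<Longrightarrow> \<gamma> t = (t ^ m * h1 t, t ^ m * h2 t)"
    using \<gamma>_factor by auto
  define \<eta> where "\<eta> t = (h1 t, h2 t)" for t
  obtain M1 where M1: "M1 > 0" "\<And>t t'. cmod t < \<rho> / 4 \<Longrightarrow> cmod t' < \<rho> / 4 \<Longrightarrow>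
     cmod (h1 t - h1 t') \<le> M1 * cmod (t - t')"
    using holomorphic_locally_lipschitz[OF h(1) \<rho>(1)] by blast
  obtain M2 where M2: "M2 > 0" "\<And>t t'. cmod t < \<rho> / 4 \<Longrightarrow> cmod t' < \<rho> / 4 \<Longrightarrow>
     cmod (h2 t - h2 t') \<le> M2 * cmod (t - t')"
    using holomorphic_locally_lipschitz[OF h(2) \<rho>(1)] by blast
  define M where "M = M1 + M2"
  have M: "M > 0" using M1 M2 by (simp add: M_def)
  have lip: "norm (\<eta> t - \<eta> t') \<le> M * cmod (t - t')" if "cmod t < \<rho> / 4" "cmod t' < \<rho> / 4" for t t'
    using norm_Pair_le[of "h1 t - h1 t'" "h2 t - h2 t'"] M1(2)[OF that] M2(2)[OF that]
    by (simp add: \<eta>_def M_def algebra_simps)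
  have n\<gamma>: "norm (\<gamma> t) = cmod t ^ m * norm (\<eta> t)" if "cmod t < \<rho>" for t
  proof -
    have "norm (\<gamma> t) = sqrt ((cmod t ^ m)\<^sup>2 * ((cmod (h1 t))\<^sup>2 + (cmod (h2 t))\<^sup>2))"
      by (simp add: h(3)[OF that] norm_Pair norm_mult norm_power power_mult_distrib algebra_simps)
    then show ?thesis by (simp add: \<eta>_def norm_Pair real_sqrt_mult)
  qed
  have low: "1 / L \<le> norm (\<eta> t)" if "cmod t < \<rho>" "t \<noteq> 0" for t
  proof -
    have "cmod t ^ m * 1 \<le> cmod t ^ m * (L * norm (\<eta> t))"
      using \<gamma>_lower[OF that(1)] n\<gamma>[OF that(1)] by (simp add: mult_ac)
    then have "1 \<le> L * norm (\<eta> t)" using that(2) by (subst (asm) mult_le_cancel_left_pos) auto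
    then show ?thesis using L by (simp add: field_simps)
  qed
  \<comment> \<open>Below 1 / (2 L M) the variation of |\<eta>| costs at most half of the gain,
    which is at least (y^m - x^m) / L.\<close>
  define r2 where "r2 = min (\<rho> / 4) (1 / (2 * L * M))"
  have r2: "r2 > 0" "r2 \<le> \<rho> / 4" "r2 < \<rho>" using \<rho> L M by (auto simp: r2_def)
  have "1 / (2 * L) * (y ^ m - x ^ m) \<le> norm (\<gamma> (of_real y * u)) - norm (\<gamma> (of_real x * u))"
    if x: "0 \<le> x" "x \<le> y" "y < r2" "cmod u = 1" for x y u
  proof (cases "y = 0")
    case True
    then show ?thesis using x by simp
  next
    case False
    define n where "n z = norm (\<eta> (of_real z * u))" for z
    have c: "cmod (of_real z * u) = z" if "0 \<le> z" for z using x(4) that by (simp add: norm_mult)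
    have "cmod (of_real y * u - of_real x * u) = cmod (of_real (y - x) * u)" by (simp add: algebra_simps)
    also have "\<dots> = y - x" using x by (intro c) simp
    finally have yx: "cmod (of_real y * u - of_real x * u) = y - x" .
    have "n x \<le> n y + norm (\<eta> (of_real y * u) - \<eta> (of_real x * u))"
      using norm_triangle_sub[of "\<eta> (of_real x * u)" "\<eta> (of_real y * u)"] by (simp add: n_def norm_minus_commute)
    also have "norm (\<eta> (of_real y * u) - \<eta> (of_real x * u)) \<le> M * (y - x)"
      using lip[of "of_real y * u" "of_real x * u"] x r2 c[of x] c[of y] yx by simp
    finally have "x ^ m * n x \<le> x ^ m * (n y + M * (y - x))" using x by (intro mult_left_mono) auto
    \<comment> \<open>The variation of \<eta> is weighted by x^m, although x^(m-1) would do for a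
      comparison with y^m - x^m; the spare factor x makes the loss small.\<close>
    moreover have "x ^ m * (y - x) \<le> x * (y ^ m - x ^ m)"
    proof -
      have "x * ((y - x) * x ^ (m - 1)) \<le> x * (y ^ m - x ^ m)"
        using x m by (intro mult_left_mono diff_mult_power_le) auto
      then show ?thesis using m by (simp add: power_eq_if[of x m] mult_ac)
    qed
    then have "M * (x ^ m * (y - x)) \<le> M * (x * (y ^ m - x ^ m))" using M by (intro mult_left_mono) auto
    moreover have "M * x * (y ^ m - x ^ m) \<le> 1 / (2 * L) * (y ^ m - x ^ m)"
    proof (rule mult_right_mono)
      have "x \<le> 1 / (2 * L * M)" using x by (simp add: r2_def)
      then show "M * x \<le> 1 / (2 * L)" using M L by (simp add: field_simps)
    qed (use x power_mono[of x y m] in auto)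
    moreover have "1 / L * (y ^ m - x ^ m) \<le> n y * (y ^ m - x ^ m)"
      unfolding n_def
      by (intro mult_right_mono low) (use x r2 c[of y] False power_mono[of x y m] in auto)
    moreover have "norm (\<gamma> (of_real y * u)) = y ^ m * n y" "norm (\<gamma> (of_real x * u)) = x ^ m * n x"
      unfolding n_def using n\<gamma>[of "of_real y * u"] n\<gamma>[of "of_real x * u"] c[of x] c[of y] x r2 by auto
    moreover have "1 / L * (y ^ m - x ^ m) = 2 * (1 / (2 * L) * (y ^ m - x ^ m))"
      using L by (simp add: field_simps)
    moreover have "n y * (y ^ m - x ^ m) = y ^ m * n y - x ^ m * n y"
      "x ^ m * (n y + M * (y - x)) = x ^ m * n y + M * (x ^ m * (y - x))"
      "M * (x * (y ^ m - x ^ m)) = M * x * (y ^ m - x ^ m)"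
      by (simp_all add: algebra_simps)
    ultimately show ?thesis by linarith
  qed
  then show ?thesis
    using r2 L by (intro exI[of _ r2] conjI exI[of _ "1 / (2 * L)"] allI impI) auto
qed

text \<open>The point \<gamma>(\<tau>) is close to p but in general has a different norm. Moving
  along the ray of \<tau> reaches the norm of p, and the growth of |\<gamma>| along rays bounds the
  displacement by the discrepancy of norms, which is at most |p - \<gamma>(\<tau>)|.\<close>

lemma dist_upper:
  "\<exists>r1>0. \<exists>C>0. \<forall>p \<tau> y. norm p < r1 \<longrightarrow> \<Theta> p = (\<tau> ^ m, y) \<longrightarrow>
     (\<exists>q\<in>X. norm q = norm p \<and> norm (p - q) \<le> C * cmod (y - \<psi> \<tau>))"
proof -
  obtain r2 c where r2: "r2 > 0" "r2 \<le> \<rho>" and c: "c > 0" and grow: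
     "\<And>x y u. 0 \<le> x \<Longrightarrow> x \<le> y \<Longrightarrow> y < r2 \<Longrightarrow> cmod u = 1 \<Longrightarrow>
      c * (y ^ m - x ^ m) \<le> norm (\<gamma> (of_real y * u)) - norm (\<gamma> (of_real x * u))"
    using radial_growth by blast
  define d where "d = r2 / 2"
  have d: "d > 0" "d < r2" "d < \<rho>" using r2 by (auto simp: d_def)
  \<comment> \<open>r / L keeps \<Theta> p in the domain of \<Phi>, d^m / L gives |\<tau>| < d, and
    c d^m ensures that the ray reaches the norm of p before its parameter exceeds d.\<close>
  define r1 where "r1 = Min {r, r / L, d ^ m / L, c * d ^ m}"
  have r1: "r1 > 0" "r1 \<le> r" "r1 \<le> r / L" "r1 \<le> d ^ m / L" "r1 \<le> c * d ^ m" using r L d c by (auto simp: r1_def)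
  have move: "norm (\<gamma> (of_real y * u) - \<gamma> (of_real x * u)) \<le> L * (1 + K) * (y ^ m - x ^ m)"
    if x: "0 \<le> x" "x \<le> y" "y < r2" "cmod u = 1" for x y u
  proof -
    have n: "cmod (of_real x * u) < \<rho>" "cmod (of_real y * u) < \<rho>" using x r2 by (auto simp: norm_mult)
    have "norm (\<gamma> (of_real y * u) - \<gamma> (of_real x * u)) \<le>
       L * norm (((of_real y * u) ^ m, \<psi> (of_real y * u)) - ((of_real x * u) ^ m, \<psi> (of_real x * u)))"
      unfolding \<gamma>_def using dom_small n by (intro \<Phi>_lip) auto
    also have "\<dots> \<le> L * (cmod ((of_real y * u) ^ m - (of_real x * u) ^ m) + cmod (\<psi> (of_real y * u) - \<psi> (of_real x * u)))"
      unfolding diff_Pair using L by (intro mult_left_mono norm_Pair_le) auto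
    also have "(of_real y * u) ^ m - (of_real x * u) ^ m = of_real (y ^ m - x ^ m) * u ^ m"
      by (simp add: power_mult_distrib algebra_simps)
    also have "cmod \<dots> = y ^ m - x ^ m"
      using x power_mono[of x y m] by (simp only: norm_mult norm_power norm_of_real) simp
    also have "L * (y ^ m - x ^ m + cmod (\<psi> (of_real y * u) - \<psi> (of_real x * u))) \<le> L * (y ^ m - x ^ m + K * (y ^ m - x ^ m))"
      using L x r2 by (intro mult_left_mono add_left_mono \<psi>_radial) auto
    finally show ?thesis by (simp add: algebra_simps)
  qed
  have "\<exists>q\<in>X. norm q = norm p \<and> norm (p - q) \<le> (1 + L * (1 + K) / c) * L * cmod (y - \<psi> \<tau>)"
    if p: "norm p < r1" and \<Theta>: "\<Theta> p = (\<tau> ^ m, y)" for p \<tau> y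
  proof -
    have \<tau>: "cmod \<tau> < d" using p r1 d by (intro root_small[OF _ _ \<Theta>]) auto
    \<comment> \<open>At \<tau> = 0 every direction is admissible; 1 is an arbitrary choice.\<close>
    define u where "u = (if \<tau> = 0 then 1 else \<tau> / of_real (cmod \<tau>))"
    have u: "cmod u = 1" "\<tau> = of_real (cmod \<tau>) * u" by (auto simp: u_def norm_divide)
    define N where "N x = norm (\<gamma> (of_real x * u))" for x :: real
    have cont: "continuous_on {0..d} N"
    proof -
      have "continuous_on (ball 0 \<rho>) \<gamma>"
        using hol[THEN holomorphic_on_imp_continuous_on] continuous_on_Pair[of "ball 0 \<rho>" "\<lambda>t. fst (\<Phi> (t ^ m, \<psi> t))" "\<lambda>t. snd (\<Phi> (t ^ m, \<psi> t))"]
        by (simp add: \<gamma>_def[abs_def])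
      then have "continuous_on {0..d} (\<lambda>x. \<gamma> (of_real x * u))"
        by (rule continuous_on_compose2) (use d u in \<open>auto intro!: continuous_intros simp: norm_mult\<close>)
      then show ?thesis unfolding N_def by (intro continuous_intros)
    qed
    have "\<psi> 0 = 0" using \<psi>_bound[of 0] \<rho> m by simp
    then have N0: "N 0 = 0" using m \<Phi>0 by (simp add: N_def \<gamma>_def power_0_left zero_prod_def)
    have "N d \<ge> c * d ^ m"
      using grow[of 0 d u] d u N0 m by (simp add: N_def power_0_left)
    then have "\<exists>x\<ge>0. x \<le> d \<and> N x = norm p"
      using p r1 d N0 by (intro IVT') (auto intro: cont)
    then obtain x where x: "0 \<le> x" "x \<le> d" "N x = norm p" by blast
    define q where "q = \<gamma> (of_real x * u)"
    have qX: "q \<in> X" unfolding q_def \<gamma>_def using x d u by (intro curve_in) (auto simp: norm_mult)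
    have close: "norm (p - \<gamma> \<tau>) \<le> L * cmod (y - \<psi> \<tau>)"
    proof -
      have "norm (\<Theta> p) \<le> L * norm p" using p r1 by (intro \<Theta>_norm) auto
      also have "\<dots> < L * r1" using p L by simp
      also have "\<dots> \<le> r" using r1(3) L by (simp add: field_simps)
      finally have "norm (\<Phi> (\<Theta> p) - \<gamma> \<tau>) \<le> L * norm (\<Theta> p - (\<tau> ^ m, \<psi> \<tau>))"
        unfolding \<gamma>_def using dom_small[of \<tau>] \<tau> d by (intro \<Phi>_lip) auto
      then show ?thesis using \<Phi>\<Theta>[of p] p r1 by (simp add: \<Theta> norm_Pair)
    qed
    have N\<tau>: "N (cmod \<tau>) = norm (\<gamma> \<tau>)" unfolding N_def using u(2) by simp
    have "norm (q - \<gamma> \<tau>) \<le> L * (1 + K) * \<bar>x ^ m - cmod \<tau> ^ m\<bar> \<and> c * \<bar>x ^ m - cmod \<tau> ^ m\<bar> \<le> \<bar>N x - N (cmod \<tau>)\<bar>"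
    proof (cases "x \<le> cmod \<tau>")
      case True
      then have "x ^ m \<le> cmod \<tau> ^ m" using x by (intro power_mono) auto
      then show ?thesis
        using move[OF x(1) True _ u(1)] grow[OF x(1) True _ u(1)] \<tau> d u(2)
        by (auto simp: q_def N_def norm_minus_commute abs_if)
    next
      case False
      then have le: "cmod \<tau> \<le> x" by simp
      then have "cmod \<tau> ^ m \<le> x ^ m" by (intro power_mono) auto
      then show ?thesis
        using move[OF norm_ge_zero le _ u(1)] grow[OF norm_ge_zero le _ u(1)] x d u(2)
        by (auto simp: q_def N_def abs_if)
    qed
    moreover have "\<bar>N x - N (cmod \<tau>)\<bar> \<le> norm (p - \<gamma> \<tau>)"
      unfolding x(3) N\<tau> by (rule norm_triangle_ineq3)
    ultimately have *: "norm (q - \<gamma> \<tau>) \<le> L * (1 + K) * \<bar>x ^ m - cmod \<tau> ^ m\<bar>"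
      "\<bar>x ^ m - cmod \<tau> ^ m\<bar> \<le> norm (p - \<gamma> \<tau>) / c"
      using c by (auto simp: field_simps)
    have "norm (q - \<gamma> \<tau>) \<le> L * (1 + K) * (norm (p - \<gamma> \<tau>) / c)"
      using *(2) L K by (intro order_trans[OF *(1)] mult_left_mono) auto
    moreover have "norm (p - q) \<le> norm (p - \<gamma> \<tau>) + norm (q - \<gamma> \<tau>)"
      using norm_triangle_ineq4[of "p - \<gamma> \<tau>" "q - \<gamma> \<tau>"] by simp
    ultimately have "norm (p - q) \<le> (1 + L * (1 + K) / c) * norm (p - \<gamma> \<tau>)"
      by (simp add: algebra_simps)
    also have "\<dots> \<le> (1 + L * (1 + K) / c) * (L * cmod (y - \<psi> \<tau>))"
      using close L K c by (intro mult_left_mono) auto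
    finally show ?thesis
      using qX x(3) by (intro bexI[of _ q]) (auto simp: q_def N_def mult.assoc)
  qed
  moreover have C: "(1 + L * (1 + K) / c) * L > 0" using L K c by (intro mult_pos_pos add_pos_pos) auto
  ultimately show ?thesis
    by (intro exI[of _ r1] conjI[OF r1(1)] exI[of _ "(1 + L * (1 + K) / c) * L"] conjI[OF C] allI impI)
qed

end

subsection \<open>Conjugate branches\<close>

lemma analytic2_pair_local:
  assumes "analytic2_germ (fst \<circ> \<Phi>)" "analytic2_germ (snd \<circ> \<Phi>)"
  shows "\<exists>r>0. \<exists>L>0. (\<forall>p q. norm p < r \<longrightarrow> norm q < r \<longrightarrow> norm (\<Phi> p - \<Phi> q) \<le> L * norm (p - q)) \<and>
    (\<forall>S \<phi> \<psi>. open S \<longrightarrow> \<phi> holomorphic_on S \<longrightarrow> \<psi> holomorphic_on S \<longrightarrow>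
       (\<forall>z\<in>S. cmod (\<phi> z) < r \<and> cmod (\<psi> z) < r) \<longrightarrow>
       (\<lambda>z. fst (\<Phi> (\<phi> z, \<psi> z))) holomorphic_on S \<and> (\<lambda>z. snd (\<Phi> (\<phi> z, \<psi> z))) holomorphic_on S)"
proof -
  obtain r1 L1 where 1: "r1 > 0" "L1 > 0"
    "\<And>p q. norm p < r1 \<Longrightarrow> norm q < r1 \<Longrightarrow> cmod ((fst \<circ> \<Phi>) p - (fst \<circ> \<Phi>) q) \<le> L1 * norm (p - q)"
    "\<And>S \<phi> \<psi>. open S \<Longrightarrow> \<phi> holomorphic_on S \<Longrightarrow> \<psi> holomorphic_on S \<Longrightarrow>
       (\<forall>z\<in>S. cmod (\<phi> z) < r1 \<and> cmod (\<psi> z) < r1) \<Longrightarrow> (\<lambda>z. (fst \<circ> \<Phi>) (\<phi> z, \<psi> z)) holomorphic_on S"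
    using analytic2_germ_local[OF assms(1)] by auto
  obtain r2 L2 where 2: "r2 > 0" "L2 > 0"
    "\<And>p q. norm p < r2 \<Longrightarrow> norm q < r2 \<Longrightarrow> cmod ((snd \<circ> \<Phi>) p - (snd \<circ> \<Phi>) q) \<le> L2 * norm (p - q)"
    "\<And>S \<phi> \<psi>. open S \<Longrightarrow> \<phi> holomorphic_on S \<Longrightarrow> \<psi> holomorphic_on S \<Longrightarrow>
       (\<forall>z\<in>S. cmod (\<phi> z) < r2 \<and> cmod (\<psi> z) < r2) \<Longrightarrow> (\<lambda>z. (snd \<circ> \<Phi>) (\<phi> z, \<psi> z)) holomorphic_on S"
    using analytic2_germ_local[OF assms(2)] by auto
  have r: "min r1 r2 > 0" and L: "L1 + L2 > 0" using 1 2 by auto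
  show ?thesis
  proof (rule exI[of _ "min r1 r2"], rule conjI[OF r], rule exI[of _ "L1 + L2"], rule conjI[OF L], intro conjI allI impI)
    fix p q :: "complex \<times> complex" assume pq: "norm p < min r1 r2" "norm q < min r1 r2"
    have "norm (\<Phi> p - \<Phi> q) \<le> cmod (fst (\<Phi> p - \<Phi> q)) + cmod (snd (\<Phi> p - \<Phi> q))"
      using norm_Pair_le[of "fst (\<Phi> p - \<Phi> q)" "snd (\<Phi> p - \<Phi> q)"] by (simp only: prod.collapse)
    also have "\<dots> \<le> L1 * norm (p - q) + L2 * norm (p - q)"
      using 1(3)[of p q] 2(3)[of p q] pq by (intro add_mono) auto
    finally show "norm (\<Phi> p - \<Phi> q) \<le> (L1 + L2) * norm (p - q)" by (simp add: algebra_simps)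
  next
    fix S \<phi> \<psi>
    assume S: "open S" "\<phi> holomorphic_on S" "\<psi> holomorphic_on S" "\<forall>z\<in>S. cmod (\<phi> z) < min r1 r2 \<and> cmod (\<psi> z) < min r1 r2"
    show "(\<lambda>z. fst (\<Phi> (\<phi> z, \<psi> z))) holomorphic_on S"
      using 1(4)[OF S(1-3)] S(4) by auto
    show "(\<lambda>z. snd (\<Phi> (\<phi> z, \<psi> z))) holomorphic_on S"
      using 2(4)[OF S(1-3)] S(4) by auto
  qed
qed

lemma biholo_germ_local:
  assumes "biholo_germ \<Phi>"
  shows "\<exists>\<Theta>. \<exists>r>0. \<exists>L>0. \<Phi> 0 = 0 \<and> \<Theta> 0 = 0 \<and>
    (\<forall>p q. norm p < r \<longrightarrow> norm q < r \<longrightarrow> norm (\<Phi> p - \<Phi> q) \<le> L * norm (p - q)) \<and>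
    (\<forall>p q. norm p < r \<longrightarrow> norm q < r \<longrightarrow> norm (\<Theta> p - \<Theta> q) \<le> L * norm (p - q)) \<and>
    (\<forall>p. norm p < r \<longrightarrow> \<Theta> (\<Phi> p) = p \<and> \<Phi> (\<Theta> p) = p) \<and>
    (\<forall>S \<phi> \<psi>. open S \<longrightarrow> \<phi> holomorphic_on S \<longrightarrow> \<psi> holomorphic_on S \<longrightarrow>
       (\<forall>z\<in>S. cmod (\<phi> z) < r \<and> cmod (\<psi> z) < r) \<longrightarrow>
       (\<lambda>z. fst (\<Phi> (\<phi> z, \<psi> z))) holomorphic_on S \<and> (\<lambda>z. snd (\<Phi> (\<phi> z, \<psi> z))) holomorphic_on S)"
proof -
  obtain \<Theta> where an: "analytic2_germ (fst \<circ> \<Phi>)" "analytic2_germ (snd \<circ> \<Phi>)"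
    "analytic2_germ (fst \<circ> \<Theta>)" "analytic2_germ (snd \<circ> \<Theta>)" and 0: "\<Phi> 0 = 0" "\<Theta> 0 = 0" and
    inv: "\<forall>\<^sub>F p in nhds 0. \<Theta> (\<Phi> p) = p" "\<forall>\<^sub>F p in nhds 0. \<Phi> (\<Theta> p) = p"
    using assms unfolding biholo_germ_def by auto
  have "\<forall>\<^sub>F p in nhds 0. \<Theta> (\<Phi> p) = p \<and> \<Phi> (\<Theta> p) = p" using inv by eventually_elim auto
  then obtain r0 where r0: "r0 > 0" "\<And>p. norm p < r0 \<Longrightarrow> \<Theta> (\<Phi> p) = p \<and> \<Phi> (\<Theta> p) = p"
    unfolding eventually_nhds_metric by auto
  obtain r1 L1 where 1: "r1 > 0" "L1 > 0"
    "\<And>p q. norm p < r1 \<Longrightarrow> norm q < r1 \<Longrightarrow> norm (\<Phi> p - \<Phi> q) \<le> L1 * norm (p - q)"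
    "\<And>S \<phi> \<psi>. open S \<Longrightarrow> \<phi> holomorphic_on S \<Longrightarrow> \<psi> holomorphic_on S \<Longrightarrow>
       (\<forall>z\<in>S. cmod (\<phi> z) < r1 \<and> cmod (\<psi> z) < r1) \<Longrightarrow>
       (\<lambda>z. fst (\<Phi> (\<phi> z, \<psi> z))) holomorphic_on S \<and> (\<lambda>z. snd (\<Phi> (\<phi> z, \<psi> z))) holomorphic_on S"
    using analytic2_pair_local[OF an(1,2)] by auto
  obtain r2 L2 where 2: "r2 > 0" "L2 > 0"
    "\<And>p q. norm p < r2 \<Longrightarrow> norm q < r2 \<Longrightarrow> norm (\<Theta> p - \<Theta> q) \<le> L2 * norm (p - q)"
    using analytic2_pair_local[OF an(3,4)] by auto
  define r where "r = Min {r0, r1, r2}"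
  define L where "L = max L1 L2"
  have r: "r > 0" "r \<le> r0" "r \<le> r1" "r \<le> r2" using r0 1 2 by (auto simp: r_def)
  have L: "L > 0" "L1 \<le> L" "L2 \<le> L" using 1 2 by (auto simp: L_def)
  show ?thesis
  proof (rule exI[of _ \<Theta>], rule exI[of _ r], rule conjI[OF r(1)], rule exI[of _ L], rule conjI[OF L(1)], intro conjI allI impI 0)
    fix p q :: "complex \<times> complex" assume pq: "norm p < r" "norm q < r"
    show "norm (\<Phi> p - \<Phi> q) \<le> L * norm (p - q)"
      using 1(3)[of p q] pq r mult_right_mono[OF L(2) norm_ge_zero[of "p - q"]] by linarith
    show "norm (\<Theta> p - \<Theta> q) \<le> L * norm (p - q)"
      using 2(3)[of p q] pq r mult_right_mono[OF L(3) norm_ge_zero[of "p - q"]] by linarith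
  next
    fix p :: "complex \<times> complex" assume "norm p < r"
    then show "\<Theta> (\<Phi> p) = p" "\<Phi> (\<Theta> p) = p" using r0(2)[of p] r by auto
  next
    fix S \<phi> \<psi>
    assume S: "open S" "\<phi> holomorphic_on S" "\<psi> holomorphic_on S" "\<forall>z\<in>S. cmod (\<phi> z) < r \<and> cmod (\<psi> z) < r"
    have *: "\<forall>z\<in>S. cmod (\<phi> z) < r1 \<and> cmod (\<psi> z) < r1" using S(4) r by force
    show "(\<lambda>z. fst (\<Phi> (\<phi> z, \<psi> z))) holomorphic_on S" "(\<lambda>z. snd (\<Phi> (\<phi> z, \<psi> z))) holomorphic_on S"
      using 1(4)[OF S(1-3) *] by auto
  qed
qed

text \<open>\<psi>(t) - \<psi>(\<omega> t) is itself a power series in t, and its order is exactly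
  \<beta>_(i+1).\<close>

lemma conjugate_difference_bounds:
  assumes sum: "\<And>t. cmod t < \<rho> \<Longrightarrow> summable (\<lambda>j. a j * t ^ j)" and \<rho>: "\<rho> > 0" and m: "m > 0"
    and pc: "puiseux_char m a s \<beta> e" and i: "i < s" and \<omega>: "\<omega> ^ m = 1" "\<omega> ^ e i = 1" "\<omega> ^ e (Suc i) \<noteq> 1"
  defines "\<psi> \<equiv> \<lambda>t. \<Sum>j. a j * t ^ j"
  shows "\<exists>r>0. \<exists>c>0. \<exists>C>0. \<forall>t. cmod t < r \<longrightarrow> c * cmod t ^ \<beta> (Suc i) \<le> cmod (\<psi> t - \<psi> (\<omega> * t)) \<and>
     cmod (\<psi> t - \<psi> (\<omega> * t)) \<le> C * cmod t ^ \<beta> (Suc i)"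
proof -
  let ?b = "\<lambda>j. a j * (1 - \<omega> ^ j)"
  have n: "cmod (\<omega> * t) = cmod t" for t using norm_unity_root[OF m \<omega>(1)] by (simp add: norm_mult)
  have eq: "(\<lambda>j. ?b j * t ^ j) = (\<lambda>j. a j * t ^ j - a j * (\<omega> * t) ^ j)" for t
    by (auto simp: algebra_simps power_mult_distrib)
  have s: "summable (\<lambda>j. ?b j * t ^ j)" and e: "(\<Sum>j. ?b j * t ^ j) = \<psi> t - \<psi> (\<omega> * t)" if "cmod t < \<rho>" for t
    unfolding eq \<psi>_def using that n[of t] by (auto intro!: summable_diff suminf_diff[symmetric] sum)
  note o = puiseux_char_conjugate_order[OF pc i \<omega>(2,3)]
  obtain r1 C where 1: "r1 > 0" "C > 0" "\<And>t. cmod t < r1 \<Longrightarrow> cmod (\<Sum>j. ?b j * t ^ j) \<le> C * cmod t ^ \<beta> (Suc i)"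
    using power_series_order_bounds(1)[of \<rho> ?b "\<beta> (Suc i)", OF s \<rho> o(1)] by auto
  obtain r2 c where 2: "r2 > 0" "c > 0" "\<And>t. cmod t < r2 \<Longrightarrow> c * cmod t ^ \<beta> (Suc i) \<le> cmod (\<Sum>j. ?b j * t ^ j)"
    using power_series_order_bounds(2)[of \<rho> ?b "\<beta> (Suc i)", OF s \<rho> o] by auto
  define r where "r = Min {r1, r2, \<rho>}"
  have r: "r > 0" "r \<le> r1" "r \<le> r2" "r \<le> \<rho>" using 1 2 \<rho> by (auto simp: r_def)
  have "c * cmod t ^ \<beta> (Suc i) \<le> cmod (\<psi> t - \<psi> (\<omega> * t)) \<and> cmod (\<psi> t - \<psi> (\<omega> * t)) \<le> C * cmod t ^ \<beta> (Suc i)"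
    if "cmod t < r" for t
    using 1(3)[of t] 2(3)[of t] e[of t] that r by auto
  then show ?thesis using r(1) 1(2) 2(2) by blast
qed

text \<open>Replacing t by \<omega> t, which has the same modulus, reduces a pair \<omega>,
  \<omega>' to the pair 1, \<omega>'/\<omega>. Only finitely many differences remain, each of exact
  order at 0 and so nonzero on a punctured disc. This supplies the simple zeros for the
  division.\<close>

lemma conjugates_distinct:
  assumes sum: "\<And>t. cmod t < \<rho> \<Longrightarrow> summable (\<lambda>j. a j * t ^ j)" and \<rho>: "\<rho> > 0" and m: "m > 0"
    and pc: "puiseux_char m a s \<beta> e"
  defines "\<psi> \<equiv> \<lambda>t. \<Sum>j. a j * t ^ j"
  shows "\<exists>r>0. \<forall>t. cmod t < r \<longrightarrow> t \<noteq> 0 \<longrightarrow> inj_on (\<lambda>\<omega>. \<psi> (\<omega> * t)) {\<omega>. \<omega> ^ m = 1}"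
proof -
  let ?U = "{\<omega>::complex. \<omega> ^ m = 1}"
  have "\<exists>r>0. \<forall>t. cmod t < r \<longrightarrow> t \<noteq> 0 \<longrightarrow> \<psi> t \<noteq> \<psi> (\<omega> * t)" if \<omega>: "\<omega> \<in> ?U - {1}" for \<omega>
  proof -
    obtain i where i: "i < s" "\<omega> ^ e i = 1" "\<omega> ^ e (Suc i) \<noteq> 1"
      using puiseux_char_level[OF pc, of \<omega>] \<omega> by auto
    obtain r c C where r: "r > 0" "c > 0" "\<And>t. cmod t < r \<Longrightarrow> c * cmod t ^ \<beta> (Suc i) \<le> cmod (\<psi> t - \<psi> (\<omega> * t)) \<and>
     cmod (\<psi> t - \<psi> (\<omega> * t)) \<le> C * cmod t ^ \<beta> (Suc i)"
      using conjugate_difference_bounds[of \<rho> a, OF sum \<rho> m pc i(1) _ i(2,3)] \<omega> unfolding \<psi>_def by auto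
    have "\<psi> t \<noteq> \<psi> (\<omega> * t)" if "cmod t < r" "t \<noteq> 0" for t
    proof -
      have "c * cmod t ^ \<beta> (Suc i) > 0" using r that by simp
      then show ?thesis using r(3)[OF that(1)] by auto
    qed
    then show ?thesis using r(1) by blast
  qed
  then obtain R where R: "\<And>\<omega>. \<omega> \<in> ?U - {1} \<Longrightarrow> R \<omega> > 0 \<and> (\<forall>t. cmod t < R \<omega> \<longrightarrow> t \<noteq> 0 \<longrightarrow> \<psi> t \<noteq> \<psi> (\<omega> * t))"
    by metis
  define r where "r = Min (insert 1 (R ` (?U - {1})))"
  have fin: "finite (insert 1 (R ` (?U - {1})))" using finite_unity_roots[OF m] by simp
  have r: "r > 0" "\<And>\<omega>. \<omega> \<in> ?U - {1} \<Longrightarrow> r \<le> R \<omega>"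
    unfolding r_def using fin R by (auto simp: Min_gr_iff)
  have "inj_on (\<lambda>\<omega>. \<psi> (\<omega> * t)) ?U" if t: "cmod t < r" "t \<noteq> 0" for t
  proof (rule inj_onI, rule ccontr)
    fix \<omega> \<omega>' assume w: "\<omega> \<in> ?U" "\<omega>' \<in> ?U" "\<psi> (\<omega> * t) = \<psi> (\<omega>' * t)" "\<omega> \<noteq> \<omega>'"
    have nz: "\<omega> \<noteq> 0" using w(1) m by (auto simp: power_0_left)
    have q: "\<omega>' / \<omega> \<in> ?U - {1}" using w nz by (auto simp: power_divide)
    have "cmod (\<omega> * t) = cmod t" using norm_unity_root[OF m] w(1) by (simp add: norm_mult)
    then have "\<psi> (\<omega> * t) \<noteq> \<psi> (\<omega>' / \<omega> * (\<omega> * t))"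
      using R[OF q, THEN conjunct2, rule_format, of "\<omega> * t"] r(2)[OF q] t nz by simp
    then show False using w(3) nz by (simp add: mult.assoc)
  qed
  then show ?thesis using r(1) by blast
qed

subsection \<open>The chart of a Puiseux parametrisation\<close>

text \<open>Since \<open>\<Phi>\<close> is arbitrary away from \<open>0\<close>, parameters far from \<open>0\<close> may be mapped to zeros of \<open>f\<close> near \<open>0\<close>. So
  only the vanishing of \<open>f\<close> on the branch is taken from the parametrisation; that there are no other zeros
  follows from the multiplicity.\<close>

lemma puiseux_chart:
  assumes gm: "germ_mult f m" and pp: "puiseux_param f \<Phi> m a" and pc: "puiseux_char m a s \<beta> e"
  defines "\<psi> \<equiv> \<lambda>t. \<Sum>j. a j * t ^ j"
  shows "\<exists>\<Theta> r \<rho> \<sigma> L K A B. curve_chart \<Phi> \<Theta> \<psi> m {p. f p = 0} r \<rho> \<sigma> L K \<and> A > 0 \<and> B > 0 \<and>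
    (\<forall>\<tau> y. cmod \<tau> < \<rho> \<longrightarrow> cmod y < \<rho> \<longrightarrow>
       A * (\<Prod>\<omega> | \<omega> ^ m = 1. cmod (y - \<psi> (\<omega> * \<tau>))) \<le> cmod (f (\<Phi> (\<tau> ^ m, y))) \<and>
       cmod (f (\<Phi> (\<tau> ^ m, y))) \<le> B * (\<Prod>\<omega> | \<omega> ^ m = 1. cmod (y - \<psi> (\<omega> * \<tau>))))"
proof -
  let ?U = "{\<omega>::complex. \<omega> ^ m = 1}"
  obtain \<rho>0 where bi: "biholo_germ \<Phi>" and m: "m > 0" and low: "\<And>j. j \<le> m \<Longrightarrow> a j = 0"
    and \<rho>0: "\<rho>0 > 0" and sum: "\<And>t. cmod t < \<rho>0 \<Longrightarrow> summable (\<lambda>j. a j * t ^ j)"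
    and ge: "germ_eq {p. f p = 0} ((\<lambda>t. \<Phi> (t ^ m, \<psi> t)) ` ball 0 \<rho>0)"
    using pp unfolding puiseux_param_def \<psi>_def by auto
  obtain U where U: "open U" "0 \<in> U" "{p. f p = 0} \<inter> U = ((\<lambda>t. \<Phi> (t ^ m, \<psi> t)) ` ball 0 \<rho>0) \<inter> U"
    using ge unfolding germ_eq_def by blast
  obtain u where u: "u > 0" "\<And>p. norm p < u \<Longrightarrow> p \<in> U"
    using U(1,2) unfolding open_dist by (metis dist_0_norm dist_commute)
  obtain \<Theta> r L where r: "r > 0" and L: "L > 0" and \<Phi>0: "\<Phi> 0 = 0" and \<Theta>0: "\<Theta> 0 = 0"
    and \<Phi>_lip: "\<And>p q. norm p < r \<Longrightarrow> norm q < r \<Longrightarrow> norm (\<Phi> p - \<Phi> q) \<le> L * norm (p - q)"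
    and \<Theta>_lip: "\<And>p q. norm p < r \<Longrightarrow> norm q < r \<Longrightarrow> norm (\<Theta> p - \<Theta> q) \<le> L * norm (p - q)"
    and inv: "\<And>p. norm p < r \<Longrightarrow> \<Theta> (\<Phi> p) = p \<and> \<Phi> (\<Theta> p) = p"
    and \<Phi>_hol: "\<And>S \<phi> \<psi>. open S \<Longrightarrow> \<phi> holomorphic_on S \<Longrightarrow> \<psi> holomorphic_on S \<Longrightarrow>
       (\<forall>z\<in>S. cmod (\<phi> z) < r \<and> cmod (\<psi> z) < r) \<Longrightarrow>
       (\<lambda>z. fst (\<Phi> (\<phi> z, \<psi> z))) holomorphic_on S \<and> (\<lambda>z. snd (\<Phi> (\<phi> z, \<psi> z))) holomorphic_on S"
    using biholo_germ_local[OF bi] by auto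
  have an: "analytic2_germ f" using gm unfolding germ_mult_def analytic2_germ_def by blast
  obtain rf Lf where rf: "rf > 0" and Lf: "Lf > 0"
    and f_lip: "\<And>p q. norm p < rf \<Longrightarrow> norm q < rf \<Longrightarrow> cmod (f p - f q) \<le> Lf * norm (p - q)"
    and f_hol: "\<And>S \<phi> \<psi>. open S \<Longrightarrow> \<phi> holomorphic_on S \<Longrightarrow> \<psi> holomorphic_on S \<Longrightarrow>
       (\<forall>z\<in>S. cmod (\<phi> z) < rf \<and> cmod (\<psi> z) < rf) \<Longrightarrow> (\<lambda>z. f (\<phi> z, \<psi> z)) holomorphic_on S"
    using analytic2_germ_local[OF an] by auto
  have low': "\<And>j. j < m \<Longrightarrow> a j = 0" "\<And>j. j < Suc m \<Longrightarrow> a j = 0" using low by auto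
  obtain rm Km where rm: "rm > 0" and Km: "Km > 0" and graph: "\<And>t t'. cmod t < rm \<Longrightarrow> cmod t' < rm \<Longrightarrow>
       (\<exists>\<omega>. \<omega> ^ m = 1 \<and> cmod (\<psi> t - \<psi> (\<omega> * t')) \<le> Km * cmod (t ^ m - t' ^ m))"
    and radial: "\<And>x y u. 0 \<le> x \<Longrightarrow> x \<le> y \<Longrightarrow> y < rm \<Longrightarrow> cmod u = 1 \<Longrightarrow>
         cmod (\<psi> (of_real y * u) - \<psi> (of_real x * u)) \<le> Km * (y ^ m - x ^ m)"
    using multigraph_lipschitz[of \<rho>0 a m, OF sum \<rho>0 m low'(1)] unfolding \<psi>_def by auto
  obtain rb Kb where rb: "rb > 0" and Kb: "Kb > 0" and ord: "\<And>t. cmod t < rb \<Longrightarrow> cmod (\<psi> t) \<le> Kb * cmod t ^ Suc m"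
    using power_series_order_bounds(1)[of \<rho>0 a "Suc m", OF sum \<rho>0 low'(2)] unfolding \<psi>_def by auto
  obtain rd where rd: "rd > 0" and inj: "\<And>t. cmod t < rd \<Longrightarrow> t \<noteq> 0 \<Longrightarrow> inj_on (\<lambda>\<omega>. \<psi> (\<omega> * t)) ?U"
    using conjugates_distinct[of \<rho>0 a m, OF sum \<rho>0 m pc] unfolding \<psi>_def by auto
  have \<psi>_hol: "\<psi> holomorphic_on ball 0 \<rho>0"
    unfolding \<psi>_def by (rule power_series_holomorphic[of _ _ a]) (use sum in \<open>auto intro: summable_sums\<close>)
  define K where "K = max Km Kb"
  have K: "K > 0" "Km \<le> K" "Kb \<le> K" using Km Kb by (auto simp: K_def)
  \<comment> \<open>On this ball \<Phi>, being L-Lipschitz, maps into the domain of the estimates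
    for f, into the neighbourhood where the zero set is the parametrised branch, and into the
    chart.\<close>
  define w where "w = min r (Min {rf, u, r} / L)"
  have w: "w > 0" "w \<le> r" using r rf u L by (auto simp: w_def)
  have wL: "norm (\<Phi> p) < rf \<and> norm (\<Phi> p) < u \<and> norm (\<Phi> p) < r" if "norm p < w" for p
  proof -
    have "norm (\<Phi> p) \<le> L * norm p" using \<Phi>_lip[of p 0] that w r \<Phi>0 by simp
    also have "\<dots> < Min {rf, u, r}" using that L by (simp add: w_def field_simps)
    finally show ?thesis by simp
  qed
  \<comment> \<open>The last entry brings both (t^m, \<psi> t) and (t^m, y) into the ball of radius
    w: their norms are below (1 + K) R and 2 R.\<close>
  define R where "R = Min {1, \<rho>0, rm, rb, rd, w / (2 * (1 + K))}"
  have R: "R > 0" "R \<le> 1" "R \<le> \<rho>0" "R \<le> rm" "R \<le> rb" "R \<le> rd" "R \<le> w / (2 * (1 + K))"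
    using \<rho>0 rm rb rd w K by (auto simp: R_def)
  have R2: "2 * (1 + K) * R \<le> w" using R(7) K by (simp add: field_simps)
  have pow_le: "cmod t ^ m \<le> cmod t" if "cmod t < R" for t
    using power_decreasing[of 1 m "cmod t"] that R m by simp
  have \<psi>_bound: "cmod (\<psi> t) \<le> K * cmod t ^ Suc m" if "cmod t < R" for t
  proof -
    have "cmod (\<psi> t) \<le> Kb * cmod t ^ Suc m" using that R by (intro ord) auto
    also have "\<dots> \<le> K * cmod t ^ Suc m" using K by (intro mult_right_mono) auto
    finally show ?thesis .
  qed
  have \<psi>_bound': "cmod (\<psi> t) \<le> K * cmod t ^ m" if "cmod t < R" for t
  proof -
    have "K * cmod t ^ Suc m \<le> K * cmod t ^ m" using K that R by (intro mult_left_mono power_decreasing) auto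
    then show ?thesis using \<psi>_bound[OF that] by linarith
  qed
  have F1: "norm (t ^ m, \<psi> t) < w" if t: "cmod t < R" for t
  proof -
    have "norm (t ^ m, \<psi> t) \<le> (1 + K) * cmod t ^ m"
      using norm_Pair_le[of "t ^ m" "\<psi> t"] \<psi>_bound'[OF t] by (simp add: norm_power algebra_simps)
    also have "\<dots> \<le> (1 + K) * cmod t" using K pow_le[OF t] by (intro mult_left_mono) auto
    also have "\<dots> < (1 + K) * R" using t K by simp
    also have "\<dots> \<le> 2 * (1 + K) * R" using R(1) K by (intro mult_right_mono) auto
    finally show ?thesis using R2 by simp
  qed
  have F2: "norm (t ^ m, y) < w" if t: "cmod t < R" "cmod y < R" for t y
  proof -
    have "norm (t ^ m, y) \<le> cmod t + cmod y"
      using norm_Pair_le[of "t ^ m" y] pow_le[OF t(1)] by (simp add: norm_power)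
    also have "\<dots> < 2 * R" using t by simp
    also have "\<dots> \<le> 2 * (1 + K) * R" using R(1) K by (intro mult_right_mono) auto
    finally show ?thesis using R2 by simp
  qed
  have zero: "f (\<Phi> (t ^ m, \<psi> t)) = 0" if t: "cmod t < R" for t
  proof -
    have "\<Phi> (t ^ m, \<psi> t) \<in> U" using wL[OF F1[OF t]] by (intro u) auto
    moreover have "\<Phi> (t ^ m, \<psi> t) \<in> (\<lambda>t. \<Phi> (t ^ m, \<psi> t)) ` ball 0 \<rho>0" using t R by auto
    ultimately have "\<Phi> (t ^ m, \<psi> t) \<in> {p. f p = 0}" using U(3) by blast
    then show ?thesis by simp
  qed
  have unit: "cmod (\<omega> * t) = cmod t" if "\<omega> \<in> ?U" for \<omega> t
    using norm_unity_root[OF m] that by (simp add: norm_mult)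

  \<comment> \<open>After the pullback by \<tau> \<mapsto> \<tau>^m the conjugates are the
    single-valued functions \<psi>(\<omega> \<tau>), as the division requires.\<close>
  define G where "G = (\<lambda>\<tau> y. f (\<Phi> (\<tau> ^ m, y)))"
  have contG: "continuous_on (ball 0 R \<times> ball 0 R) (\<lambda>(\<tau>, y). G \<tau> y)"
  proof -
    have "(Lf * L)-lipschitz_on {p. norm p < w} (\<lambda>p. f (\<Phi> p))"
    proof (rule lipschitz_onI)
      fix p q :: "complex \<times> complex" assume pq: "p \<in> {p. norm p < w}" "q \<in> {p. norm p < w}"
      have "cmod (f (\<Phi> p) - f (\<Phi> q)) \<le> Lf * norm (\<Phi> p - \<Phi> q)" using wL[of p] wL[of q] pq by (intro f_lip) auto
      also have "\<dots> \<le> Lf * (L * norm (p - q))" using pq w Lf by (intro mult_left_mono \<Phi>_lip) auto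
      finally show "dist (f (\<Phi> p)) (f (\<Phi> q)) \<le> Lf * L * dist p q" by (simp add: dist_norm mult.assoc)
    qed (use Lf L in simp)
    then have "continuous_on {p. norm p < w} (\<lambda>p. f (\<Phi> p))" by (rule lipschitz_on_continuous_on)
    then have "continuous_on (ball 0 R \<times> ball 0 R) (\<lambda>q. f (\<Phi> (fst q ^ m, snd q)))"
      by (rule continuous_on_compose2) (use F2 in \<open>auto intro!: continuous_intros\<close>)
    then show ?thesis by (simp add: G_def case_prod_unfold)
  qed
  have holG: "G \<tau> holomorphic_on ball 0 R" if \<tau>: "cmod \<tau> < R" for \<tau>
  proof -
    have 1: "norm (\<tau> ^ m, y) < w" if "y \<in> ball 0 R" for y :: complex using F2[OF \<tau>] that by simp
    have 2: "\<forall>y\<in>ball 0 R. cmod (\<tau> ^ m) < r \<and> cmod y < r"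
    proof
      fix y :: complex assume "y \<in> ball 0 R"
      then show "cmod (\<tau> ^ m) < r \<and> cmod y < r"
        using 1[of y] norm_Pair_ge(1)[of "\<tau> ^ m" y] norm_Pair_ge(2)[of y "\<tau> ^ m"] w by simp
    qed
    have "(\<lambda>y. f (fst (\<Phi> (\<tau> ^ m, y)), snd (\<Phi> (\<tau> ^ m, y)))) holomorphic_on ball 0 R"
    proof (rule f_hol)
      show "(\<lambda>y. fst (\<Phi> (\<tau> ^ m, y))) holomorphic_on ball 0 R" "(\<lambda>y. snd (\<Phi> (\<tau> ^ m, y))) holomorphic_on ball 0 R"
        using \<Phi>_hol[of "ball 0 R" "\<lambda>_. \<tau> ^ m" "\<lambda>y. y"] 2 by auto
      have "cmod (fst (\<Phi> (\<tau> ^ m, y))) < rf \<and> cmod (snd (\<Phi> (\<tau> ^ m, y))) < rf" if "y \<in> ball 0 R" for y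
        using wL[OF 1[OF that]] norm_Pair_ge(1)[of "fst (\<Phi> (\<tau> ^ m, y))" "snd (\<Phi> (\<tau> ^ m, y))"]
          norm_Pair_ge(2)[of "snd (\<Phi> (\<tau> ^ m, y))" "fst (\<Phi> (\<tau> ^ m, y))"] by simp
      then show "\<forall>y\<in>ball 0 R. cmod (fst (\<Phi> (\<tau> ^ m, y))) < rf \<and> cmod (snd (\<Phi> (\<tau> ^ m, y))) < rf" by blast
    qed simp
    then show ?thesis by (simp add: G_def)
  qed
  have cont\<zeta>: "continuous_on (ball 0 R) (\<lambda>\<tau>. \<psi> (\<omega> * \<tau>))" if "\<omega> \<in> ?U" for \<omega>
    by (rule continuous_on_compose2[OF holomorphic_on_imp_continuous_on[OF \<psi>_hol]])
      (use unit[OF that] R in \<open>auto intro!: continuous_intros\<close>)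
  have \<zeta>0: "\<psi> (\<omega> * 0) = 0" for \<omega> using \<psi>_bound[of 0] R by simp
  have zero\<zeta>: "G \<tau> (\<psi> (\<omega> * \<tau>)) = 0" if "\<omega> \<in> ?U" "cmod \<tau> < R" for \<omega> \<tau>
    using zero[of "\<omega> * \<tau>"] unit[OF that(1)] that by (simp add: G_def power_mult_distrib)
  have inj\<zeta>: "inj_on (\<lambda>\<omega>. \<psi> (\<omega> * \<tau>)) ?U" if "cmod \<tau> < R" "\<tau> \<noteq> 0" for \<tau>
    using that R by (intro inj) auto
  have root: "\<exists>\<tau>. \<tau> ^ m = x \<and> cmod \<tau> < d" if "cmod x < d ^ m" "d > 0" for x d
  proof -
    obtain \<tau> where "\<tau> ^ m = x" using exists_complex_root[of m x] m by auto
    then show ?thesis using that power_less_imp_less_base[of "cmod \<tau>" m d] by (auto simp: norm_power)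
  qed

  obtain p0 c \<epsilon> where c: "c > 0" and \<epsilon>: "\<epsilon> > 0" and
    mult: "\<And>s. 0 < s \<Longrightarrow> s < \<epsilon> \<Longrightarrow> c * s ^ m \<le> cmod (f (s *\<^sub>R p0))"
    using germ_mult_lower_bound[OF gm] by blast
  \<comment> \<open>Chosen so that s Q bounds the point s p0 and also, \<Theta> being L-Lipschitz,
    its chart coordinates.\<close>
  define Q where "Q = (1 + norm p0) * (1 + L)"
  have Q: "Q > 0" "norm p0 \<le> Q" "L * norm p0 \<le> Q"
    using L by (auto simp: Q_def algebra_simps add_pos_nonneg intro!: add_pos_nonneg mult_pos_pos)
  \<comment> \<open>Over s p0 each vertical distance is at most (1 + K) Q s, because \<psi>(\<omega>
    \<tau>) = O(|\<tau>|^m) = O(|x|). The m factors give the order s^m of the lower bound for f, and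
    c' is the ratio of the two constants.\<close>
  define c' where "c' = c / ((1 + K) * Q) ^ m"
  have c': "c' > 0" using c K Q by (simp add: c'_def)
  have lowG: "\<exists>\<tau> y. cmod \<tau> < d \<and> cmod y < d \<and> G \<tau> y \<noteq> 0 \<and>
      c' * (\<Prod>\<omega>\<in>?U. cmod (y - \<psi> (\<omega> * \<tau>))) \<le> cmod (G \<tau> y)" if d: "d > 0" for d
  proof -
    define D where "D = min d R"
    have D: "D > 0" "D \<le> d" "D \<le> R" using d R by (auto simp: D_def)
    \<comment> \<open>s Q < D bounds y, s Q < D^m bounds every root \<tau> of x, and s Q < r keeps
      the point in the chart; halving makes these strict.\<close>
    define s where "s = Min {\<epsilon>, r / Q, D / Q, D ^ m / Q} / 2"
    have "Min {\<epsilon>, r / Q, D / Q, D ^ m / Q} > 0" using \<epsilon> r D Q by simp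
    then have "s > 0" "s < Min {\<epsilon>, r / Q, D / Q, D ^ m / Q}" unfolding s_def by linarith+
    then have s: "s > 0" "s < \<epsilon>" "s * Q < r" "s * Q < D" "s * Q < D ^ m"
      using Q by (auto simp: field_simps)
    define q where "q = s *\<^sub>R p0"
    have nq: "norm q \<le> s * Q" "L * norm q \<le> s * Q"
      using s(1) Q mult_left_mono[OF Q(2), of s] mult_left_mono[OF Q(3), of s] by (auto simp: q_def mult_ac)
    have qr: "norm q < r" using nq s by linarith
    obtain x y where xy: "\<Theta> q = (x, y)" by (cases "\<Theta> q")
    have n: "norm (x, y) \<le> s * Q" using \<Theta>_lip[of q 0] qr r \<Theta>0 nq xy by simp
    then have x: "cmod x \<le> s * Q" and y: "cmod y \<le> s * Q"
      using norm_Pair_ge(1)[of x y] norm_Pair_ge(2)[of y x] by linarith+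
    obtain \<tau> where \<tau>: "\<tau> ^ m = x" "cmod \<tau> < D" using root[of x D] x s D by auto
    have G: "G \<tau> y = f q" using inv[OF qr] by (simp add: G_def \<tau> flip: xy)
    have fq: "c * s ^ m \<le> cmod (f q)" unfolding q_def using s by (intro mult) auto
    have "(\<Prod>\<omega>\<in>?U. cmod (y - \<psi> (\<omega> * \<tau>))) \<le> (\<Prod>\<omega>\<in>?U. (1 + K) * Q * s)"
    proof (intro prod_mono conjI)
      fix \<omega> assume \<omega>: "\<omega> \<in> ?U"
      have "cmod (\<psi> (\<omega> * \<tau>)) \<le> K * cmod (\<omega> * \<tau>) ^ m" using unit[OF \<omega>] \<tau> D by (intro \<psi>_bound') auto
      also have "cmod (\<omega> * \<tau>) ^ m = cmod x" using unit[OF \<omega>] \<tau>(1) by (metis norm_power)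
      also have "K * cmod x \<le> K * (s * Q)" using x K by (intro mult_left_mono) auto
      finally show "cmod (y - \<psi> (\<omega> * \<tau>)) \<le> (1 + K) * Q * s"
        using y norm_triangle_ineq4[of y "\<psi> (\<omega> * \<tau>)"] by (simp add: algebra_simps)
    qed auto
    also have "\<dots> = ((1 + K) * Q) ^ m * s ^ m"
      using m by (simp add: card_roots_unity_eq power_mult_distrib)
    finally have "c' * (\<Prod>\<omega>\<in>?U. cmod (y - \<psi> (\<omega> * \<tau>))) \<le> c' * (((1 + K) * Q) ^ m * s ^ m)"
      using c' by (intro mult_left_mono) auto
    also have "\<dots> = c * s ^ m" using K Q by (simp add: c'_def)
    finally have "c' * (\<Prod>\<omega>\<in>?U. cmod (y - \<psi> (\<omega> * \<tau>))) \<le> cmod (G \<tau> y)" using fq G by simp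
    moreover have "c * s ^ m > 0" using c s by simp
    then have "G \<tau> y \<noteq> 0" using fq G by auto
    ultimately show ?thesis using \<tau> y s D by (intro exI[of _ \<tau>] exI[of _ y]) auto
  qed
  obtain r3 A B where r3: "r3 > 0" and A: "A > 0" and B: "B > 0" and
    AG: "\<And>t y. cmod t < r3 \<Longrightarrow> cmod y < r3 \<Longrightarrow> A * (\<Prod>\<omega>\<in>?U. cmod (y - \<psi> (\<omega> * t))) \<le> cmod (G t y)" and
    BG: "\<And>t y. cmod t < r3 \<Longrightarrow> cmod y < r3 \<Longrightarrow> cmod (G t y) \<le> B * (\<Prod>\<omega>\<in>?U. cmod (y - \<psi> (\<omega> * t)))"
    using weierstrass_comparable[where G = G and I = ?U and R = R and c = c' and \<zeta> = "\<lambda>\<omega> \<tau>. \<psi> (\<omega> * \<tau>)",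
      OF finite_unity_roots[OF m] R(1) contG holG cont\<zeta> \<zeta>0 zero\<zeta> inj\<zeta> c' lowG] by auto
  define \<rho> where "\<rho> = min R r3"
  have \<rho>: "\<rho> > 0" "\<rho> \<le> R" "\<rho> \<le> r3" using R r3 by (auto simp: \<rho>_def)
  \<comment> \<open>For |q| < \<sigma> the chart coordinates satisfy |x| < \<rho>^m, so that the
    roots of x lie below \<rho>, and |y| < \<rho>.\<close>
  define \<sigma> where "\<sigma> = Min {r, \<rho> ^ m / L, \<rho> / L}"
  have \<sigma>: "\<sigma> > 0" using r \<rho> L by (simp add: \<sigma>_def)
  have "curve_chart \<Phi> \<Theta> \<psi> m {p. f p = 0} r \<rho> \<sigma> L K"
  proof
    show "m > 0" "0 < r" "0 < \<rho>" "\<rho> \<le> 1" "0 < \<sigma>" "L > 0" "K > 0" "\<Phi> 0 = 0" "\<Theta> 0 = 0"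
      using m r \<rho> R \<sigma> L K \<Phi>0 \<Theta>0 by auto
    show "norm (\<Phi> p - \<Phi> q) \<le> L * norm (p - q)" "norm (\<Theta> p - \<Theta> q) \<le> L * norm (p - q)"
      if "norm p < r" "norm q < r" for p q using \<Phi>_lip \<Theta>_lip that by auto
    show "\<Theta> (\<Phi> p) = p" "\<Phi> (\<Theta> p) = p" if "norm p < r" for p using inv that by auto
    show "cmod (\<psi> t) \<le> K * cmod t ^ Suc m" if "cmod t < \<rho>" for t using \<psi>_bound that \<rho> by auto
    show "\<exists>\<omega>. \<omega> ^ m = 1 \<and> cmod (\<psi> t - \<psi> (\<omega> * t')) \<le> K * cmod (t ^ m - t' ^ m)" if t: "cmod t < \<rho>" "cmod t' < \<rho>" for t t'
    proof -
      obtain \<omega> where "\<omega> ^ m = 1" "cmod (\<psi> t - \<psi> (\<omega> * t')) \<le> Km * cmod (t ^ m - t' ^ m)"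
        using graph[of t t'] t \<rho> R by auto
      moreover have "Km * cmod (t ^ m - t' ^ m) \<le> K * cmod (t ^ m - t' ^ m)" using K by (intro mult_right_mono) auto
      ultimately show ?thesis by (intro exI[of _ \<omega>]) auto
    qed
    show "cmod (\<psi> (of_real y * u) - \<psi> (of_real x * u)) \<le> K * (y ^ m - x ^ m)"
      if "0 \<le> x" "x \<le> y" "y < \<rho>" "cmod u = 1" for x y u
    proof -
      have "cmod (\<psi> (of_real y * u) - \<psi> (of_real x * u)) \<le> Km * (y ^ m - x ^ m)"
        using that \<rho> R by (intro radial) auto
      also have "\<dots> \<le> K * (y ^ m - x ^ m)" using K that power_mono[of x y m] by (intro mult_right_mono) auto
      finally show ?thesis .
    qed
    have "\<forall>t\<in>ball 0 \<rho>. cmod (t ^ m) < r \<and> cmod (\<psi> t) < r"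
    proof
      fix t :: complex assume "t \<in> ball 0 \<rho>"
      then have "norm (t ^ m, \<psi> t) < r" using F1[of t] \<rho> w by auto
      then show "cmod (t ^ m) < r \<and> cmod (\<psi> t) < r"
        using norm_Pair_ge(1)[of "t ^ m" "\<psi> t"] norm_Pair_ge(2)[of "\<psi> t" "t ^ m"] by linarith
    qed
    moreover have "(\<lambda>t::complex. t ^ m) holomorphic_on ball 0 \<rho>" by (intro holomorphic_intros)
    moreover have "\<psi> holomorphic_on ball 0 \<rho>"
      using \<psi>_hol by (rule holomorphic_on_subset) (use \<rho> R in auto)
    ultimately show "(\<lambda>t. fst (\<Phi> (t ^ m, \<psi> t))) holomorphic_on ball 0 \<rho>"
       "(\<lambda>t. snd (\<Phi> (t ^ m, \<psi> t))) holomorphic_on ball 0 \<rho>"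
      using \<Phi>_hol[of "ball 0 \<rho>" "\<lambda>t. t ^ m" \<psi>] by auto
    show "\<Phi> (t ^ m, \<psi> t) \<in> {p. f p = 0}" if "cmod t < \<rho>" for t using zero that \<rho> by simp
    show "norm (\<Phi> (t ^ m, \<psi> t)) < r \<and> norm (t ^ m, \<psi> t) < r" if "cmod t < \<rho>" for t
      using wL[OF F1[of t]] F1[of t] that \<rho> w by auto
    show "\<exists>t. cmod t < \<rho> \<and> \<Theta> q = (t ^ m, \<psi> t)" if q: "q \<in> {p. f p = 0}" "norm q < \<sigma>" for q
    proof -
      have qr: "norm q < r" and qL: "L * norm q < \<rho> ^ m" "L * norm q < \<rho>"
        using q(2) L by (auto simp: \<sigma>_def field_simps)
      obtain x y where xy: "\<Theta> q = (x, y)" by (cases "\<Theta> q")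
      have n: "norm (x, y) \<le> L * norm q" using \<Theta>_lip[of q 0] qr r \<Theta>0 xy by simp
      have x: "cmod x < \<rho> ^ m" and y: "cmod y < \<rho>"
        using n qL norm_Pair_ge(1)[of x y] norm_Pair_ge(2)[of y x] by linarith+
      obtain \<tau> where \<tau>: "\<tau> ^ m = x" "cmod \<tau> < \<rho>" using root[OF x \<rho>(1)] by auto
      have "G \<tau> y = f q" using inv[OF qr] by (simp add: G_def \<tau> flip: xy)
      \<comment> \<open>By the lower comparison a zero of f makes the product vanish. Hence y =
        \<psi>(\<omega> \<tau>) for some \<omega>, and \<omega> \<tau> is the parameter
        sought.\<close>
      then have "A * (\<Prod>\<omega>\<in>?U. cmod (y - \<psi> (\<omega> * \<tau>))) \<le> 0" using AG[of \<tau> y] \<tau> y \<rho> q(1) by simp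
      moreover have "(\<Prod>\<omega>\<in>?U. cmod (y - \<psi> (\<omega> * \<tau>))) \<ge> 0" by (intro prod_nonneg) auto
      ultimately have "(\<Prod>\<omega>\<in>?U. cmod (y - \<psi> (\<omega> * \<tau>))) = 0" using A by (simp add: mult_le_0_iff)
      then obtain \<omega> where \<omega>: "\<omega> \<in> ?U" "y = \<psi> (\<omega> * \<tau>)" using finite_unity_roots[OF m] by auto
      show ?thesis
        using \<omega> \<tau> xy unit[OF \<omega>(1)] by (intro exI[of _ "\<omega> * \<tau>"]) (auto simp: power_mult_distrib)
    qed
  qed
  moreover have "\<forall>\<tau> y. cmod \<tau> < \<rho> \<longrightarrow> cmod y < \<rho> \<longrightarrow>
       A * (\<Prod>\<omega> | \<omega> ^ m = 1. cmod (y - \<psi> (\<omega> * \<tau>))) \<le> cmod (f (\<Phi> (\<tau> ^ m, y))) \<and>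
       cmod (f (\<Phi> (\<tau> ^ m, y))) \<le> B * (\<Prod>\<omega> | \<omega> ^ m = 1. cmod (y - \<psi> (\<omega> * \<tau>)))"
  proof (intro allI impI)
    fix \<tau> y assume "cmod \<tau> < \<rho>" "cmod y < \<rho>"
    then show "A * (\<Prod>\<omega>\<in>?U. cmod (y - \<psi> (\<omega> * \<tau>))) \<le> cmod (f (\<Phi> (\<tau> ^ m, y))) \<and>
       cmod (f (\<Phi> (\<tau> ^ m, y))) \<le> B * (\<Prod>\<omega>\<in>?U. cmod (y - \<psi> (\<omega> * \<tau>)))"
      using AG[of \<tau> y] BG[of \<tau> y] \<rho> by (simp add: G_def)
  qed
  ultimately show ?thesis
    by (intro exI[of _ \<Theta>] exI[of _ r] exI[of _ \<rho>] exI[of _ \<sigma>] exI[of _ L] exI[of _ K] exI[of _ A] exI[of _ B]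
        conjI A B)
qed

subsection \<open>Order along an arc\<close>

text \<open>After t = s^n the coordinates of the arc are real power series; they extend to a complex
  disc, and f composed with the extension is holomorphic there.\<close>

lemma arc_power_series:
  assumes an: "analytic2_germ f" and arc: "analytic_arc \<alpha>"
  shows "\<exists>n>0. \<exists>\<rho>>0. \<exists>D. (\<forall>z. cmod z < \<rho> \<longrightarrow> summable (\<lambda>j. D j * z ^ j)) \<and>
    (\<forall>s. 0 \<le> s \<longrightarrow> s < \<rho> \<longrightarrow> f (\<alpha> (s ^ n)) = (\<Sum>j. D j * of_real s ^ j))"
proof -
  obtain n \<epsilon> C where n: "n > 0" and \<epsilon>: "\<epsilon> > 0" and C: "\<And>t. 0 \<le> t \<Longrightarrow> t < \<epsilon> \<Longrightarrow> (\<lambda>j. t ^ j *\<^sub>R C j) sums \<alpha> (t ^ n)"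
    and \<alpha>0: "\<alpha> 0 = 0"
    using arc unfolding analytic_arc_def real_analytic_right_def by blast
  obtain r where r: "r > 0"
    and f_hol: "\<And>S \<phi> \<psi>. open S \<Longrightarrow> \<phi> holomorphic_on S \<Longrightarrow> \<psi> holomorphic_on S \<Longrightarrow>
       (\<forall>z\<in>S. cmod (\<phi> z) < r \<and> cmod (\<psi> z) < r) \<Longrightarrow> (\<lambda>z. f (\<phi> z, \<psi> z)) holomorphic_on S"
    using analytic2_germ_local[OF an] by blast
  have ext: "\<exists>\<phi>. \<phi> holomorphic_on ball 0 (\<epsilon>/2) \<and> (\<forall>t. 0 \<le> t \<longrightarrow> t < \<epsilon>/2 \<longrightarrow> \<phi> (of_real t) = \<pi> (\<alpha> (t ^ n)))"
    if \<pi>: "bounded_linear \<pi>" for \<pi> :: "complex \<times> complex \<Rightarrow> complex"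
  proof -
    have S: "(\<lambda>j. \<pi> (C j) * of_real t ^ j) sums \<pi> (\<alpha> (t ^ n))" if "0 \<le> t" "t < \<epsilon>" for t
      using bounded_linear.sums[OF \<pi> C[OF that]]
      by (simp add: linear_scale[OF bounded_linear.linear[OF \<pi>]] scaleR_conv_of_real mult.commute)
    define \<phi> where "\<phi> z = (\<Sum>j. \<pi> (C j) * z ^ j)" for z
    \<comment> \<open>Convergence at one real point gives convergence on the open complex disc of
      that radius; this is why \<epsilon> is halved.\<close>
    have "summable (\<lambda>j. \<pi> (C j) * of_real (\<epsilon>/2) ^ j)" using S[of "\<epsilon>/2"] \<epsilon> sums_summable by force
    then have "summable (\<lambda>j. \<pi> (C j) * z ^ j)" if "cmod z < \<epsilon>/2" for z
      by (rule powser_inside) (use that \<epsilon> in auto)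
    then have "\<phi> holomorphic_on ball 0 (\<epsilon>/2)"
      by (intro power_series_holomorphic[of _ _ "\<lambda>j. \<pi> (C j)"]) (auto simp: \<phi>_def intro: summable_sums)
    moreover have "\<phi> (of_real t) = \<pi> (\<alpha> (t ^ n))" if "0 \<le> t" "t < \<epsilon>/2" for t
      using S[of t] that \<epsilon> by (simp add: \<phi>_def sums_iff)
    ultimately show ?thesis by blast
  qed
  obtain \<phi> where \<phi>: "\<phi> holomorphic_on ball 0 (\<epsilon>/2)" "\<And>t. 0 \<le> t \<Longrightarrow> t < \<epsilon>/2 \<Longrightarrow> \<phi> (of_real t) = fst (\<alpha> (t ^ n))"
    using ext[OF bounded_linear_fst] by blast
  obtain \<xi> where \<xi>: "\<xi> holomorphic_on ball 0 (\<epsilon>/2)" "\<And>t. 0 \<le> t \<Longrightarrow> t < \<epsilon>/2 \<Longrightarrow> \<xi> (of_real t) = snd (\<alpha> (t ^ n))"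
    using ext[OF bounded_linear_snd] by blast
  have small: "\<exists>d>0. \<forall>z. cmod z < d \<longrightarrow> cmod (g z) < r" if g: "g holomorphic_on ball 0 (\<epsilon>/2)" "g 0 = 0" for g
  proof -
    have "isCont g 0"
      using g(1) \<epsilon> by (intro continuous_on_interior[OF holomorphic_on_imp_continuous_on]) auto
    then obtain d where "d > 0" "\<And>z. dist z 0 < d \<Longrightarrow> dist (g z) (g 0) < r"
      using r unfolding continuous_at_eps_delta by blast
    then show ?thesis using g(2) by auto
  qed
  have "\<phi> 0 = 0" using \<phi>(2)[of 0] \<epsilon> n \<alpha>0 by (simp add: power_0_left)
  then obtain d1 where d1: "d1 > 0" "\<And>z. cmod z < d1 \<Longrightarrow> cmod (\<phi> z) < r" using small[OF \<phi>(1)] by blast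
  have "\<xi> 0 = 0" using \<xi>(2)[of 0] \<epsilon> n \<alpha>0 by (simp add: power_0_left)
  then obtain d2 where d2: "d2 > 0" "\<And>z. cmod z < d2 \<Longrightarrow> cmod (\<xi> z) < r" using small[OF \<xi>(1)] by blast
  define \<rho> where "\<rho> = Min {\<epsilon>/2, d1, d2}"
  have \<rho>: "\<rho> > 0" "\<rho> \<le> \<epsilon>/2" "\<rho> \<le> d1" "\<rho> \<le> d2" using \<epsilon> d1 d2 by (auto simp: \<rho>_def)
  define F where "F z = f (\<phi> z, \<xi> z)" for z
  have "F holomorphic_on ball 0 \<rho>"
    unfolding F_def
  proof (rule f_hol)
    show "\<phi> holomorphic_on ball 0 \<rho>" "\<xi> holomorphic_on ball 0 \<rho>"
      using \<phi>(1) \<xi>(1) \<rho>(2) by (auto elim!: holomorphic_on_subset)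
  qed (use d1 d2 \<rho> in auto)
  then have ps: "(\<lambda>j. (deriv ^^ j) F 0 / fact j * z ^ j) sums F z" if "cmod z < \<rho>" for z
    using holomorphic_power_series[of F 0 \<rho> z] that by simp
  have "f (\<alpha> (s ^ n)) = (\<Sum>j. (deriv ^^ j) F 0 / fact j * of_real s ^ j)" if "0 \<le> s" "s < \<rho>" for s
    using ps[of "of_real s"] \<phi>(2)[of s] \<xi>(2)[of s] that \<rho> by (simp add: F_def sums_iff)
  then show ?thesis
    using n \<rho>(1) ps[THEN sums_summable]
    by (intro exI[of _ n] conjI exI[of _ \<rho>] exI[of _ "\<lambda>j. (deriv ^^ j) F 0 / fact j"]) auto
qed

lemma log_order_powr: "log_order (\<lambda>t. t powr x) x"
proof -
  have "\<forall>\<^sub>F t::real in at_right 0. ln (t powr x) / ln t = x"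
    using eventually_at_right_unit_interval by eventually_elim (auto simp: ln_powr)
  moreover have "\<forall>\<^sub>F t::real in at_right 0. t powr x > 0"
    using eventually_at_right_unit_interval by eventually_elim auto
  ultimately show ?thesis
    by (auto simp: log_order_def tendsto_eventually)
qed

text \<open>The leading exponent N of the power series gives f(\<alpha> t) = t^(N/n) V(t) with V a
  unit. That expression has logarithmic order N/n, so uniqueness of the limit identifies the real
  number \<nu> with N/n.\<close>

lemma has_order_if_log_order:
  assumes an: "analytic2_germ f" and arc: "analytic_arc \<alpha>" and lo: "log_order (\<lambda>t. cmod (f (\<alpha> t))) \<nu>"
  shows "has_order f \<alpha> \<nu>"
proof -
  obtain n \<rho> D where n: "n > 0" and \<rho>: "\<rho> > 0" and D: "\<And>z. cmod z < \<rho> \<Longrightarrow> summable (\<lambda>j. D j * z ^ j)"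
    and fD: "\<And>s. 0 \<le> s \<Longrightarrow> s < \<rho> \<Longrightarrow> f (\<alpha> (s ^ n)) = (\<Sum>j. D j * of_real s ^ j)"
    using arc_power_series[OF an arc] by auto
  define x where "x = 1 / real n"
  have x: "x > 0" using n by (simp add: x_def)
  have pw: "(t powr x) ^ n = t" if "t > 0" for t
    using that n by (simp add: x_def powr_realpow[symmetric] powr_powr)
  have lim: "((\<lambda>t. t powr x) \<longlongrightarrow> 0) (at_right 0)"
  proof -
    have "((\<lambda>t::real. t powr x) \<longlongrightarrow> 0 powr x) (at_right 0)"
      using x eventually_at_right_unit_interval
      by (intro tendsto_powr'[OF tendsto_ident_at tendsto_const]) (auto elim: eventually_mono)
    then show ?thesis by simp
  qed
  have ev: "\<forall>\<^sub>F t in at_right 0. 0 < t \<and> t powr x < \<rho>"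
    using order_tendstoD(2)[OF lim \<rho>] eventually_at_right_unit_interval by eventually_elim auto
  have f_eq: "f (\<alpha> t) = (\<Sum>j. D j * of_real (t powr x) ^ j)" if "0 < t" "t powr x < \<rho>" for t
    using fD[of "t powr x"] pw[OF that(1)] that by simp
  \<comment> \<open>Otherwise f would vanish along the arc, against the positivity contained in
    \<open>log_order\<close>.\<close>
  have "\<exists>j. D j \<noteq> 0"
  proof (rule ccontr)
    assume "\<nexists>j. D j \<noteq> 0"
    then have D0: "D j = 0" for j by simp
    have "\<forall>\<^sub>F t in at_right 0. f (\<alpha> t) = 0" using ev by eventually_elim (simp add: f_eq D0)
    moreover have "\<forall>\<^sub>F t in at_right 0. cmod (f (\<alpha> t)) > 0" using lo by (rule log_orderD)
    ultimately have "\<forall>\<^sub>F t in at_right (0::real). False" by eventually_elim simp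
    then show False by simp
  qed
  define N where "N = (LEAST j. D j \<noteq> 0)"
  have DN1: "D N \<noteq> 0" unfolding N_def by (rule LeastI_ex) fact
  have DN2: "D j = 0" if "j < N" for j
    using not_less_Least[of j "\<lambda>j. D j \<noteq> 0"] that by (simp add: N_def)
  obtain \<eta> where \<eta>: "\<eta> holomorphic_on ball 0 \<rho>" "\<eta> 0 = D N"
     "\<And>t. cmod t < \<rho> \<Longrightarrow> (\<Sum>j. D j * t ^ j) = t ^ N * \<eta> t"
    using power_series_factor_power[of \<rho> D N, OF D \<rho> DN2] by auto
  \<comment> \<open>A power series in t^(1/n): the ramification exponent is 1/n, coprime as it
    stands, so N/n need not be in lowest terms.\<close>
  define V where "V t = \<eta> (of_real (t powr x))" for t
  have "ram_analytic_unit V"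
    unfolding ram_analytic_unit_def
  proof (rule exI[of _ 1], rule exI[of _ n], intro conjI exI[of _ "\<lambda>j. (deriv ^^ j) \<eta> 0 / fact j"])
    show "\<forall>\<^sub>F t in at_right 0. (\<lambda>j. (deriv ^^ j) \<eta> 0 / fact j * of_real (t powr (real 1 / real n)) ^ j) sums V t"
      using ev
    proof eventually_elim
      case (elim t)
      then show ?case
        using holomorphic_power_series[OF \<eta>(1), of "of_real (t powr x)"] by (simp add: V_def x_def)
    qed
  qed (use n \<eta>(2) DN1 in auto)
  moreover have eq: "\<forall>\<^sub>F t in at_right 0. f (\<alpha> t) = of_real (t powr (real N / real n)) * V t"
    using ev
  proof eventually_elim
    case (elim t)
    then have "f (\<alpha> t) = of_real (t powr x) ^ N * V t"
      using \<eta>(3)[of "of_real (t powr x)"] f_eq[of t] by (simp add: V_def)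
    moreover have "(t powr x) ^ N = t powr (real N / real n)"
      using elim by (simp add: x_def powr_powr flip: powr_realpow)
    ultimately show ?case by (simp flip: of_real_power)
  qed
  moreover have "\<nu> = real N / real n"
  proof (rule log_order_unique[OF lo])
    have "isCont \<eta> 0"
      using \<eta>(1) \<rho> by (intro continuous_on_interior[OF holomorphic_on_imp_continuous_on]) auto
    then have "(V \<longlongrightarrow> \<eta> 0) (at_right 0)"
      unfolding V_def using tendsto_of_real[OF lim, where 'a = complex]
      by (intro isCont_tendsto_compose[of 0 \<eta>]) auto
    then have limV: "((\<lambda>t. cmod (V t)) \<longlongrightarrow> cmod (D N)) (at_right 0)"
      using tendsto_norm \<eta>(2) by metis
    have "\<forall>\<^sub>F t in at_right 0. cmod (D N) / 2 < cmod (V t) \<and> cmod (V t) < 2 * cmod (D N)"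
      using DN1 by (intro eventually_conj order_tendstoD[OF limV]) auto
    then have bds: "\<forall>\<^sub>F t in at_right 0. cmod (D N) / 2 * t powr (real N / real n) \<le> cmod (f (\<alpha> t)) \<and>
       cmod (f (\<alpha> t)) \<le> 2 * cmod (D N) * t powr (real N / real n)"
      using eq
    proof eventually_elim
      case (elim t)
      have "cmod (f (\<alpha> t)) = cmod (V t) * t powr (real N / real n)"
        using elim by (simp add: norm_mult)
      moreover have "cmod (D N) / 2 * t powr (real N / real n) \<le> cmod (V t) * t powr (real N / real n)"
        "cmod (V t) * t powr (real N / real n) \<le> 2 * cmod (D N) * t powr (real N / real n)"
        using elim by (intro mult_right_mono; simp)+
      ultimately show ?case by simp
    qed
    show "log_order (\<lambda>t. cmod (f (\<alpha> t))) (real N / real n)"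
      by (rule log_order_squeeze[OF log_order_powr log_order_powr _ _ bds]) (use DN1 in auto)
  qed
  ultimately show ?thesis unfolding has_order_def by blast
qed

subsection \<open>Contact and order\<close>

text \<open>Multiplication by the minimising root of unity permutes the conjugates, so it can be
  absorbed into \<tau>; the nearest branch then belongs to \<omega> = 1.\<close>

lemma nearest_conjugate:
  fixes \<psi> :: "complex \<Rightarrow> complex"
  assumes m: "m > 0"
  shows "\<exists>\<tau>. \<tau> ^ m = x \<and> (\<forall>\<omega>. \<omega> ^ m = 1 \<longrightarrow> cmod (y - \<psi> \<tau>) \<le> cmod (y - \<psi> (\<omega> * \<tau>)))"
proof -
  obtain \<tau>0 where \<tau>0: "\<tau>0 ^ m = x" using exists_complex_root[of m x] m by auto
  have "{\<omega>::complex. \<omega> ^ m = 1} \<noteq> {}" by (auto intro: exI[of _ 1])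
  then obtain \<omega>0 where \<omega>0: "\<omega>0 ^ m = 1" "\<And>\<omega>. \<omega> ^ m = 1 \<Longrightarrow> cmod (y - \<psi> (\<omega>0 * \<tau>0)) \<le> cmod (y - \<psi> (\<omega> * \<tau>0))"
    using ex_is_arg_min_if_finite[OF finite_unity_roots[OF m], of "\<lambda>\<omega>. cmod (y - \<psi> (\<omega> * \<tau>0))"]
    unfolding is_arg_min_linorder by blast
  have "cmod (y - \<psi> (\<omega>0 * \<tau>0)) \<le> cmod (y - \<psi> (\<omega> * (\<omega>0 * \<tau>0)))" if "\<omega> ^ m = 1" for \<omega>
    using \<omega>0(2)[of "\<omega> * \<omega>0"] that \<omega>0(1) by (simp add: power_mult_distrib mult.assoc)
  then show ?thesis using \<tau>0 \<omega>0(1) by (intro exI[of _ "\<omega>0 * \<tau>0"]) (auto simp: power_mult_distrib)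
qed

context curve_chart
begin

text \<open>The distance between \<open>\<alpha> t\<close> and the section of the curve by the sphere through \<open>\<alpha> t\<close> is
  comparable to the vertical distance, in the chart, to the nearest branch.\<close>

lemma log_order_nearest_branch:
  assumes contact: "has_contact \<alpha> X c"
    and arc: "\<forall>\<^sub>F t in at_right 0. norm (\<alpha> t) \<le> b * t"
    and \<Theta>: "\<And>t. \<Theta> (\<alpha> t) = (\<tau> t ^ m, y t)"
    and near: "\<And>t \<omega>. \<omega> ^ m = 1 \<Longrightarrow> cmod (y t - \<psi> (\<tau> t)) \<le> cmod (y t - \<psi> (\<omega> * \<tau> t))"
  shows "log_order (\<lambda>t. cmod (y t - \<psi> (\<tau> t))) c"
proof -
  obtain r1 \<kappa> where r1: "r1 > 0" and \<kappa>: "\<kappa> > 0" and lower: "\<And>p q \<tau> y \<delta>. norm p < r1 \<Longrightarrow> norm q < r1 \<Longrightarrow> q \<in> X \<Longrightarrow>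
     \<Theta> p = (\<tau> ^ m, y) \<Longrightarrow> (\<forall>\<omega>. \<omega> ^ m = 1 \<longrightarrow> \<delta> \<le> cmod (y - \<psi> (\<omega> * \<tau>))) \<Longrightarrow> \<kappa> * \<delta> \<le> norm (p - q)"
    using dist_lower by auto
  obtain r2 C where r2: "r2 > 0" and C: "C > 0" and upper: "\<And>p \<tau> y. norm p < r2 \<Longrightarrow> \<Theta> p = (\<tau> ^ m, y) \<Longrightarrow>
     (\<exists>q\<in>X. norm q = norm p \<and> norm (p - q) \<le> C * cmod (y - \<psi> \<tau>))"
    using dist_upper by auto
  define D where "D t = infdist (\<alpha> t) (sphere_part X (norm (\<alpha> t)))" for t
  have "((\<lambda>t. b * t) \<longlongrightarrow> b * 0) (at_right 0)" by (intro tendsto_intros)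
  then have "\<forall>\<^sub>F t in at_right 0. b * t < min r1 r2" using r1 r2 by (intro order_tendstoD(2)) auto
  then have bds: "\<forall>\<^sub>F t in at_right 0. 1 / C * D t \<le> cmod (y t - \<psi> (\<tau> t)) \<and> cmod (y t - \<psi> (\<tau> t)) \<le> 1 / \<kappa> * D t"
    using arc
  proof eventually_elim
    case (elim t)
    obtain q where q: "q \<in> X" "norm q = norm (\<alpha> t)" "norm (\<alpha> t - q) \<le> C * cmod (y t - \<psi> (\<tau> t))"
      using upper[of "\<alpha> t", OF _ \<Theta>] elim by auto
    \<comment> \<open>The section is therefore nonempty, and \<open>infdist\<close> is a genuine
      infimum rather than its default value 0.\<close>
    have qs: "q \<in> sphere_part X (norm (\<alpha> t))" using q by (simp add: sphere_part_def)
    have "D t \<le> C * cmod (y t - \<psi> (\<tau> t))"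
      using infdist_le[OF qs, of "\<alpha> t"] q(3) by (simp add: D_def dist_norm)
    moreover have "\<kappa> * cmod (y t - \<psi> (\<tau> t)) \<le> D t"
    proof -
      have "\<kappa> * cmod (y t - \<psi> (\<tau> t)) \<le> dist (\<alpha> t) p" if "p \<in> sphere_part X (norm (\<alpha> t))" for p
        unfolding dist_norm using that elim near by (intro lower[OF _ _ _ \<Theta>]) (auto simp: sphere_part_def)
      then show ?thesis
        using qs by (auto simp: D_def infdist_def intro!: cINF_greatest)
    qed
    ultimately show ?case using C \<kappa> by (simp add: field_simps)
  qed
  have D: "log_order D c" using contact by (simp add: has_contact_def log_order_def D_def)
  show ?thesis by (rule log_order_squeeze[OF D D _ _ bds]) (use C \<kappa> in auto)
qed

end

theorem mainTheorem2:
  fixes f :: "complex \<times> complex \<Rightarrow> complex"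
    and \<Phi> :: "complex \<times> complex \<Rightarrow> complex \<times> complex"
    and m s k :: nat and a :: "nat \<Rightarrow> complex" and \<beta> e :: "nat \<Rightarrow> nat"
    and \<gamma> \<alpha> :: "real \<Rightarrow> complex \<times> complex" and \<epsilon> c :: real
  assumes "irreducible_germ f"
    and "germ_mult f m"
    and "puiseux_param f \<Phi> m a"
    and "puiseux_char m a s \<beta> e"
    and "half_branch_map \<gamma> \<epsilon>"
    and "arc_parameterizes \<alpha> (\<gamma> ` {0..<\<epsilon>})"
    and "has_contact \<alpha> {p. f p = 0} c"
    and "k \<le> s"
    and "real (\<beta> k) \<le> real m * c"
    and "k < s \<longrightarrow> real m * c < real (\<beta> (Suc k))"
  shows "has_order f \<alpha>
           (real (e k) * c + (\<Sum>i<k. (real (e i) - real (e (Suc i))) * real (\<beta> (Suc i)) / real m))"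
proof -
  note pc = \<open>puiseux_char m a s \<beta> e\<close>
  let ?U = "{\<omega>::complex. \<omega> ^ m = 1}"
  define \<psi> where "\<psi> = (\<lambda>t. \<Sum>j. a j * t ^ j)"
  obtain \<Theta> r \<rho> \<sigma> L K A B where chart: "curve_chart \<Phi> \<Theta> \<psi> m {p. f p = 0} r \<rho> \<sigma> L K"
    and AB: "A > 0" "B > 0" and
    prod: "\<And>\<tau> y. cmod \<tau> < \<rho> \<Longrightarrow> cmod y < \<rho> \<Longrightarrow>
       A * (\<Prod>\<omega>\<in>?U. cmod (y - \<psi> (\<omega> * \<tau>))) \<le> cmod (f (\<Phi> (\<tau> ^ m, y))) \<and>
       cmod (f (\<Phi> (\<tau> ^ m, y))) \<le> B * (\<Prod>\<omega>\<in>?U. cmod (y - \<psi> (\<omega> * \<tau>)))"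
    using puiseux_chart[OF assms(2-4)] unfolding \<psi>_def by auto
  interpret curve_chart \<Phi> \<Theta> \<psi> m "{p. f p = 0}" r \<rho> \<sigma> L K by (rule chart)
  obtain \<rho>0 where \<rho>0: "\<rho>0 > 0" and sum: "\<And>t. cmod t < \<rho>0 \<Longrightarrow> summable (\<lambda>j. a j * t ^ j)"
    and a0: "\<And>j. j \<le> m \<Longrightarrow> a j = 0"
    using assms(3) unfolding puiseux_param_def by auto
  have arc: "analytic_arc \<alpha>" using assms(6) by (simp add: arc_parameterizes_def)
  obtain a1 b where a1: "0 < a1" "a1 < b" and ab: "\<forall>\<^sub>F t in at_right 0. a1 * t \<le> norm (\<alpha> t) \<and> norm (\<alpha> t) \<le> b * t"
    using arc unfolding analytic_arc_def by blast
  have b: "b > 0" using a1 by simp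
  have unit: "cmod (\<omega> * t) = cmod t" if "\<omega> \<in> ?U" for \<omega> t
    using norm_unity_root[OF m] that by (simp add: norm_mult)

  \<comment> \<open>The root is chosen separately for each t. The resulting function may be
    discontinuous, but only estimates at a single t are made with it.\<close>
  have "\<forall>t. \<exists>\<tau>. \<tau> ^ m = fst (\<Theta> (\<alpha> t)) \<and>
      (\<forall>\<omega>. \<omega> ^ m = 1 \<longrightarrow> cmod (snd (\<Theta> (\<alpha> t)) - \<psi> \<tau>) \<le> cmod (snd (\<Theta> (\<alpha> t)) - \<psi> (\<omega> * \<tau>)))"
    by (intro allI nearest_conjugate[OF m])
  from choice[OF this] obtain \<tau> where \<tau>: "\<forall>t. \<tau> t ^ m = fst (\<Theta> (\<alpha> t)) \<and>
      (\<forall>\<omega>. \<omega> ^ m = 1 \<longrightarrow> cmod (snd (\<Theta> (\<alpha> t)) - \<psi> (\<tau> t)) \<le> cmod (snd (\<Theta> (\<alpha> t)) - \<psi> (\<omega> * \<tau> t)))" ..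
  define y where "y t = snd (\<Theta> (\<alpha> t))" for t
  have \<Theta>\<alpha>: "\<Theta> (\<alpha> t) = (\<tau> t ^ m, y t)" for t by (simp add: \<tau> y_def)
  have near: "cmod (y t - \<psi> (\<tau> t)) \<le> cmod (y t - \<psi> (\<omega> * \<tau> t))" if "\<omega> ^ m = 1" for t \<omega>
    using \<tau> that by (simp add: y_def)
  define \<delta> where "\<delta> t = cmod (y t - \<psi> (\<tau> t))" for t
  define v where "v \<omega> t = cmod (y t - \<psi> (\<omega> * \<tau> t))" for \<omega> t
  have \<delta>: "log_order \<delta> c"
    unfolding \<delta>_def
    by (rule log_order_nearest_branch[OF assms(7) _ \<Theta>\<alpha> near]) (use ab in \<open>auto elim: eventually_mono\<close>)

  have small: "\<forall>\<^sub>F t in at_right 0. b * t < d" if "d > 0" for d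
  proof -
    have "((\<lambda>t. b * t) \<longlongrightarrow> b * 0) (at_right 0)" by (intro tendsto_intros)
    then show ?thesis using that by (intro order_tendstoD(2)) auto
  qed
  have \<tau>_small: "\<forall>\<^sub>F t in at_right 0. cmod (\<tau> t) < d" if d: "d > 0" for d
  proof -
    have "min r (d ^ m / L) > 0" using r d L by simp
    from small[OF this] ab show ?thesis
      by eventually_elim (use d in \<open>auto intro!: root_small[OF _ _ \<Theta>\<alpha>]\<close>)
  qed
  have norm_\<Theta>\<alpha>: "\<forall>\<^sub>F t in at_right 0. norm (\<tau> t ^ m, y t) \<le> L * b * t"
    using small[OF r] ab
  proof eventually_elim
    case (elim t)
    have "norm (\<Theta> (\<alpha> t)) \<le> L * norm (\<alpha> t)" using elim by (intro \<Theta>_norm) auto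
    also have "\<dots> \<le> L * (b * t)" using elim L by (intro mult_left_mono) auto
    finally show ?case by (simp add: \<Theta>\<alpha>)
  qed
  have y_small: "\<forall>\<^sub>F t in at_right 0. cmod (y t) < \<rho>"
  proof -
    have "\<rho> / L > 0" using \<rho> L by simp
    from small[OF this] norm_\<Theta>\<alpha> show ?thesis
    proof eventually_elim
      case (elim t)
      have "cmod (y t) \<le> L * b * t" using elim(2) norm_Pair_ge(2)[of "y t" "\<tau> t ^ m"] by linarith
      also have "\<dots> < \<rho>" using elim(1) L by (simp add: field_simps)
      finally show ?case .
    qed
  qed
  have f_prod: "\<forall>\<^sub>F t in at_right 0. A * (\<Prod>\<omega>\<in>?U. v \<omega> t) \<le> cmod (f (\<alpha> t)) \<and> cmod (f (\<alpha> t)) \<le> B * (\<Prod>\<omega>\<in>?U. v \<omega> t)"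
    using small[OF r] ab \<tau>_small[OF \<rho>(1)] y_small
  proof eventually_elim
    case (elim t)
    have "\<Phi> (\<tau> t ^ m, y t) = \<alpha> t" using \<Phi>\<Theta>[of "\<alpha> t"] elim by (simp add: \<Theta>\<alpha>)
    then show ?case using prod[OF elim(3,4)] by (simp add: v_def)
  qed
  have \<psi>\<tau>: "\<forall>\<^sub>F t in at_right 0. \<forall>\<omega>\<in>?U. cmod (\<psi> (\<omega> * \<tau> t)) \<le> K * cmod (\<tau> t) ^ m"
    using \<tau>_small[OF \<rho>(1)]
  proof eventually_elim
    case (elim t)
    show ?case
    proof
      fix \<omega> assume \<omega>: "\<omega> \<in> ?U"
      have "cmod (\<psi> (\<omega> * \<tau> t)) \<le> K * cmod (\<tau> t) ^ Suc m" using \<psi>_bound[of "\<omega> * \<tau> t"] unit[OF \<omega>] elim by simp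
      also have "\<dots> \<le> K * cmod (\<tau> t) ^ m" using K elim \<rho> by (intro mult_left_mono power_decreasing) auto
      finally show "cmod (\<psi> (\<omega> * \<tau> t)) \<le> K * cmod (\<tau> t) ^ m" .
    qed
  qed
  \<comment> \<open>L b t bounds |y| and |\<tau>|^m, and each branch value is at most K
    |\<tau>|^m.\<close>
  define C1 where "C1 = (1 + K) * (L * b)"
  have C1: "C1 > 0" using K L b by (simp add: C1_def)
  have v_upper: "\<forall>\<^sub>F t in at_right 0. \<forall>\<omega>\<in>?U. v \<omega> t \<le> C1 * t"
    using norm_\<Theta>\<alpha> \<psi>\<tau>
  proof eventually_elim
    case (elim t)
    show ?case
    proof
      fix \<omega> assume \<omega>: "\<omega> \<in> ?U"
      have "v \<omega> t \<le> cmod (y t) + cmod (\<psi> (\<omega> * \<tau> t))" unfolding v_def by (rule norm_triangle_ineq4)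
      also have "cmod (\<psi> (\<omega> * \<tau> t)) \<le> K * (L * b * t)"
      proof -
        have "cmod (\<tau> t) ^ m \<le> L * b * t" using elim(1) norm_Pair_ge(1)[of "\<tau> t ^ m" "y t"] by (simp add: norm_power)
        then have "K * cmod (\<tau> t) ^ m \<le> K * (L * b * t)" using K by (intro mult_left_mono) auto
        then show ?thesis using elim(2) \<omega> by force
      qed
      finally show "v \<omega> t \<le> C1 * t"
        using elim(1) norm_Pair_ge(2)[of "y t" "\<tau> t ^ m"] by (simp add: C1_def algebra_simps)
    qed
  qed
  have v1: "v 1 t = \<delta> t" for t by (simp add: v_def \<delta>_def)
  have v_lower: "\<delta> t \<le> v \<omega> t" if "\<omega> \<in> ?U" for \<omega> t using near that by (simp add: v_def \<delta>_def)

  \<comment> \<open>\<delta> is at most C1 t, whereas c < 1 would make \<delta> at least 2 C1 t near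
    0.\<close>
  have c1: "c \<ge> 1"
  proof (rule ccontr)
    assume "\<not> c \<ge> 1"
    then have "\<forall>\<^sub>F t in at_right 0. t \<le> 1 / (2 * C1) * \<delta> t"
      using C1 by (intro log_order_less[OF log_order_ident \<delta>]) auto
    then have "\<forall>\<^sub>F t::real in at_right 0. False"
      using v_upper eventually_at_right_unit_interval
    proof eventually_elim
      case (elim t)
      then have "v 1 t \<le> C1 * t" by simp
      moreover have "2 * (C1 * t) \<le> \<delta> t" using elim(1) C1 by (simp add: field_simps)
      moreover have "C1 * t > 0" using C1 elim by simp
      ultimately show False using v1[of t] by linarith
    qed
    then show False by simp
  qed
  have \<beta>1: "\<beta> (Suc i) > m" if "i < s" for i
    using puiseux_char_least(1)[OF pc that] a0[of "\<beta> (Suc i)"] by (meson not_le)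

  have ord_conj: "log_order (v \<omega>) (min c (real (\<beta> (Suc i)) / real m))"
    if c: "c > 1" and i: "i < s" and \<omega>: "\<omega> \<in> ?U" "\<omega> ^ e i = 1" "\<omega> ^ e (Suc i) \<noteq> 1" for \<omega> i
  proof -
    \<comment> \<open>Since c > 1, \<delta> is o(t). With the share a1 / (2 L), replacing y by
      \<psi>(\<tau>) = O(|\<tau>|^m) uses up only half of the lower bound a1 t for the norm of
      \<alpha> t; the other half shows that |\<tau>|^m is at least a multiple of t.\<close>
    have \<delta>_small: "\<forall>\<^sub>F t in at_right 0. \<delta> t \<le> a1 / (2 * L) * t"
      using c a1 L by (intro log_order_less[OF \<delta> log_order_ident]) auto
    have "r / L > 0" using r L by simp
    from \<delta>_small \<psi>\<tau> norm_\<Theta>\<alpha> ab small[OF r] small[OF this]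
    have bds: "\<forall>\<^sub>F t in at_right 0. a1 / (2 * L * (1 + K)) * t \<le> cmod (\<tau> t) ^ m \<and> cmod (\<tau> t) ^ m \<le> L * b * t"
    proof eventually_elim
      case (elim t)
      have "norm (\<tau> t ^ m, y t) < r" using elim(3,6) L by (simp add: field_simps)
      then have "norm (\<Phi> (\<Theta> (\<alpha> t))) \<le> L * norm (\<tau> t ^ m, y t)" unfolding \<Theta>\<alpha> by (rule \<Phi>_norm)
      then have "a1 * t \<le> L * norm (\<tau> t ^ m, y t)" using \<Phi>\<Theta>[of "\<alpha> t"] elim(4,5) by simp
      also have "\<dots> \<le> L * (cmod (\<tau> t) ^ m + cmod (y t))"
        using norm_Pair_le[of "\<tau> t ^ m" "y t"] L by (intro mult_left_mono) (auto simp: norm_power)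
      also have "\<dots> \<le> L * (cmod (\<tau> t) ^ m + (a1 / (2 * L) * t + K * cmod (\<tau> t) ^ m))"
      proof (intro mult_left_mono add_left_mono)
        have "cmod (y t) \<le> \<delta> t + cmod (\<psi> (\<tau> t))"
          using norm_triangle_sub[of "y t" "\<psi> (\<tau> t)"] by (simp add: \<delta>_def)
        then show "cmod (y t) \<le> a1 / (2 * L) * t + K * cmod (\<tau> t) ^ m"
          using elim(1) bspec[OF elim(2), of 1] by simp
      qed (use L in auto)
      also have "\<dots> = L * (1 + K) * cmod (\<tau> t) ^ m + a1 * t / 2" using L by (simp add: field_simps)
      finally have "a1 * t / 2 \<le> L * (1 + K) * cmod (\<tau> t) ^ m" by simp
      then have "a1 * t \<le> cmod (\<tau> t) ^ m * (2 * L * (1 + K))" by (simp add: algebra_simps)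
      moreover have "2 * L * (1 + K) > 0" using L K by simp
      ultimately have "a1 / (2 * L * (1 + K)) * t \<le> cmod (\<tau> t) ^ m" by (simp add: pos_divide_le_eq)
      then show ?case using elim(3) norm_Pair_ge(1)[of "\<tau> t ^ m" "y t"] by (simp add: norm_power)
    qed
    have "log_order (\<lambda>t. cmod (\<tau> t) ^ m) 1"
      by (rule log_order_squeeze[OF log_order_ident log_order_ident _ _ bds]) (use a1 b L K in auto)
    then have \<tau>_ord: "log_order (\<lambda>t. cmod (\<tau> t)) (1 / real m)" using m by (rule log_order_root) simp
    define w where "w t = cmod (\<psi> (\<tau> t) - \<psi> (\<omega> * \<tau> t))" for t
    obtain r' c' C' where r': "r' > 0" "c' > 0" "C' > 0" and w: "\<And>t. cmod t < r' \<Longrightarrow>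
       c' * cmod t ^ \<beta> (Suc i) \<le> cmod (\<psi> t - \<psi> (\<omega> * t)) \<and> cmod (\<psi> t - \<psi> (\<omega> * t)) \<le> C' * cmod t ^ \<beta> (Suc i)"
      using conjugate_difference_bounds[of \<rho>0 a m s \<beta> e i \<omega>, OF sum \<rho>0 m pc i] \<omega> unfolding \<psi>_def by auto
    have wbds: "\<forall>\<^sub>F t in at_right 0. c' * cmod (\<tau> t) ^ \<beta> (Suc i) \<le> w t \<and> w t \<le> C' * cmod (\<tau> t) ^ \<beta> (Suc i)"
      using \<tau>_small[OF r'(1)] by eventually_elim (use w in \<open>auto simp: w_def\<close>)
    have "log_order w (real (\<beta> (Suc i)) * (1 / real m))"
      using log_order_squeeze[OF log_order_power[OF \<tau>_ord] log_order_power[OF \<tau>_ord] r'(2,3) wbds] .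
    then have mx: "log_order (\<lambda>t. max (\<delta> t) (w t)) (min c (real (\<beta> (Suc i)) / real m))"
      using log_order_max[OF \<delta>] by simp
    show ?thesis
    proof (rule log_order_squeeze[OF mx mx, of "1/2" 2])
      \<comment> \<open>Since \<delta> is the smallest distance, the triangle inequality gives w
        \<le> \<delta> + v \<le> 2 v. In the other direction v \<le> \<delta> + w.\<close>
      show "\<forall>\<^sub>F t in at_right 0. 1/2 * max (\<delta> t) (w t) \<le> v \<omega> t \<and> v \<omega> t \<le> 2 * max (\<delta> t) (w t)"
      proof (intro always_eventually allI)
        fix t
        have "w t \<le> \<delta> t + v \<omega> t"
          using norm_triangle_ineq4[of "y t - \<psi> (\<omega> * \<tau> t)" "y t - \<psi> (\<tau> t)"] by (simp add: w_def \<delta>_def v_def)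
        moreover have "v \<omega> t \<le> \<delta> t + w t"
          using norm_triangle_ineq[of "y t - \<psi> (\<tau> t)" "\<psi> (\<tau> t) - \<psi> (\<omega> * \<tau> t)"] by (simp add: w_def \<delta>_def v_def)
        ultimately show "1/2 * max (\<delta> t) (w t) \<le> v \<omega> t \<and> v \<omega> t \<le> 2 * max (\<delta> t) (w t)"
          using v_lower[OF \<omega>(1), of t] norm_ge_zero[of "y t - \<psi> (\<omega> * \<tau> t)"] by (auto simp: max_def v_def)
      qed
    qed auto
  qed

  have dvd: "\<omega> ^ e i = 1" if "\<omega> ^ e j = 1" "i \<le> j" "j \<le> s" for \<omega> :: complex and i j
    using puiseux_char_dvd[OF pc that(2,3)] that(1) by (auto simp: power_mult)
  have e0: "e 0 = m" using pc by (simp add: puiseux_char_def)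
  have far: "log_order (v \<omega>) c" if \<omega>: "\<omega> ^ e k = 1" for \<omega>
  proof -
    have \<omega>U: "\<omega> \<in> ?U" using dvd[OF \<omega>, of 0] assms(8) e0 by simp
    consider "c = 1" | "\<omega> = 1" | "c > 1" "\<omega> \<noteq> 1" using c1 by linarith
    then show ?thesis
    proof cases
      case 1
      \<comment> \<open>For c = 1 the size of \<tau> is not under control, but both \<delta> and t
        have exponent 1 and enclose every vertical distance.\<close>
      have bds: "\<forall>\<^sub>F t in at_right 0. 1 * \<delta> t \<le> v \<omega> t \<and> v \<omega> t \<le> C1 * t"
        using v_upper by eventually_elim (use v_lower[OF \<omega>U] \<omega>U in auto)
      have "log_order (\<lambda>t. t) c" using log_order_ident 1 by simp
      from log_order_squeeze[OF \<delta> this _ C1 bds] show ?thesis by simp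
    next
      case 2
      have "v 1 = \<delta>" using v1 by (rule ext)
      then show ?thesis using \<delta> 2 by simp
    next
      case 3
      obtain i where i: "i < s" "\<omega> ^ e i = 1" "\<omega> ^ e (Suc i) \<noteq> 1"
        using puiseux_char_level[OF pc _ 3(2)] \<omega>U by auto
      have "k \<le> i"
      proof (rule ccontr)
        assume "\<not> k \<le> i"
        then show False using dvd[OF \<omega>, of "Suc i"] assms(8) i(3) by simp
      qed
      \<comment> \<open>From k \<le> i < s the strict bound m c < \<beta>_(k+1) is available, so c
        is the smaller of the two exponents in \<open>ord_conj\<close>.\<close>
      then have "\<beta> (Suc k) \<le> \<beta> (Suc i)" "k < s" using puiseux_char_mono[OF pc] i(1) by auto
      then have "c \<le> real (\<beta> (Suc i)) / real m" using assms(10) m by (simp add: field_simps)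
      then show ?thesis using ord_conj[OF 3(1) i(1) \<omega>U i(2,3)] by (simp add: min_absorb1)
    qed
  qed
  have close: "log_order (v \<omega>) (real (\<beta> (Suc i)) / real m)"
    if i: "i < k" and \<omega>: "\<omega> ^ e i = 1" "\<omega> ^ e (Suc i) \<noteq> 1" for i \<omega>
  proof -
    have \<omega>U: "\<omega> \<in> ?U" using dvd[OF \<omega>(1), of 0] assms(8) i e0 by simp
    \<comment> \<open>As k is positive, \<open>\<beta> k\<close> is a characteristic exponent, and m
      < \<beta>_(i+1) \<le> \<beta>_k \<le> m c. This yields c > 1 and makes \<beta>_(i+1) / m the
      smaller exponent.\<close>
    obtain k' where k': "k = Suc k'" using i by (cases k) auto
    have "real (\<beta> (Suc i)) \<le> real (\<beta> k)" using puiseux_char_mono[OF pc, of i k'] i k' assms(8) by simp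
    then have le: "real (\<beta> (Suc i)) \<le> real m * c" using assms(9) by linarith
    have "real m < real (\<beta> (Suc i))" using \<beta>1[of i] i assms(8) by simp
    then have "real m * 1 < real m * c" using le by linarith
    then have "c > 1" using m by simp
    moreover have "real (\<beta> (Suc i)) / real m \<le> c" using le m by (simp add: field_simps)
    ultimately show ?thesis using ord_conj[of i \<omega>] i assms(8) \<omega>U \<omega> by (simp add: min_absorb2)
  qed
  \<comment> \<open>Uniqueness of the exponent turns the cases \<open>far\<close> and
    \<open>close\<close> into one function on the roots of unity, which can be summed over the whole
    group.\<close>
  define d where "d \<omega> = (THE x. log_order (v \<omega>) x)" for \<omega>
  have d_eq: "d \<omega> = x" if "log_order (v \<omega>) x" for \<omega> x
    unfolding d_def using that log_order_unique by blast
  have "log_order (v \<omega>) (d \<omega>)" if \<omega>: "\<omega> \<in> ?U" for \<omega>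
  proof -
    have "\<exists>x. log_order (v \<omega>) x"
    proof (cases "\<omega> ^ e k = 1")
      case False
      then have "\<omega> \<noteq> 1" by auto
      then obtain i where i: "i < s" "\<omega> ^ e i = 1" "\<omega> ^ e (Suc i) \<noteq> 1"
        using puiseux_char_level[OF pc] \<omega> by auto
      have "i < k"
      proof (rule ccontr)
        assume "\<not> i < k"
        then show False using dvd[OF i(2), of k] i(1) False by simp
      qed
      then show ?thesis using close i by blast
    qed (use far in blast)
    then show ?thesis using d_eq by auto
  qed
  then have "log_order (\<lambda>t. \<Prod>\<omega>\<in>?U. v \<omega> t) (\<Sum>\<omega>\<in>?U. d \<omega>)"
    by (intro log_order_prod finite_unity_roots[OF m])
  also have "(\<Sum>\<omega>\<in>?U. d \<omega>) = real (e k) * c + (\<Sum>i<k. (real (e i) - real (e (Suc i))) * (real (\<beta> (Suc i)) / real m))"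
    by (rule puiseux_char_sum[OF pc m assms(8)]) (use d_eq far close in blast)+
  finally have "log_order (\<lambda>t. cmod (f (\<alpha> t)))
     (real (e k) * c + (\<Sum>i<k. (real (e i) - real (e (Suc i))) * (real (\<beta> (Suc i)) / real m)))"
    using log_order_squeeze[OF _ _ AB f_prod] by blast
  moreover have "analytic2_germ f" using assms(1) by (simp add: irreducible_germ_def)
  ultimately show ?thesis using has_order_if_log_order[OF _ arc] by simp
qed

end
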